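(* Let $\beta\in(0,1]$, $\mu>0$, $\gamma>0$ and $\alpha>1/2$. Let $u(t,x)$, $t>0$, $x\in\mathbb R$, be the random field that solves the fractional Riesz–Bessel equation $$\frac{\partial^\beta u(t,x)}{\partial t^\beta}=-\mu(I-\Delta)^{\gamma/2}(-\Delta)^{\alpha/2}u(t,x),\quad t>0,\qquad u(0,x)=\xi(x),$$ (in the mean-square sense given by the spectral representation in the context), where $\xi(x)$, $x\in\mathbb R$, is a real-valued zero-mean stationary Gaussian process with covariance function $$r(x)=\mathrm{Cov}(\xi(0),\xi(x))=\sum_{j=0}^{n}A_j\frac{\cos(w_jx)}{(1+x^2)^{\kappa_j/2}},\quad x\in\mathbb R,$$ with $\sum_{j=0}^nA_j=1$, $w_0=0$, $w_j>0$ and $\kappa_j\in(0,1)$ for $j=1,\dots,n$, and with $A_0=0$. Then, as $\varepsilon\to0$ ($\varepsilon>0$), the finite-dimensional distributions of the random fields $$U_\varepsilon(t,x)=\varepsilon^{-\beta/(2\alpha)}\,u\left(\frac t\varepsilon,\frac{x}{\varepsilon^{\beta/\alpha}}\right),\quad t>0,\ x\in\mathbb R,$$ converge weakly to the finite-dimensional distributions of the zero-mean Gaussian random field $$U_0(t,x)=\sqrt{\sum_{j=1}^{n}c_1(\kappa_j)A_jK_{\frac{\kappa_j-1}{2}}(|w_j|)|w_j|^{\frac{\kappa_j-1}{2}}}\int_{\mathbb R}e^{i\lambda x}E_\beta\left(-\mu t^\beta|\lambda|^\alpha\right)W(d\lambda),$$ which has the covariance function $$\mathrm{Cov}(U_0(t,x),U_0(t',x'))=\sum_{j=1}^{n}2c_1(\kappa_j)A_jK_{\frac{\kappa_j-1}{2}}(|w_j|)|w_j|^{\frac{\kappa_j-1}{2}}\int_0^{+\infty}\cos(\lambda(x-x'))\,E_\beta(-\mu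 t^\beta|\lambda|^\alpha)\,E_\beta(-\mu(t')^\beta|\lambda|^\alpha)\,d\lambda .$$
   Context: $\Delta=\partial^2/\partial x^2$. For $\beta=1$, $\partial^\beta u/\partial t^\beta$ is the ordinary time derivative; for $\beta\in(0,1)$ it is the regularized (Caputo–Djrbashian) derivative $\frac{1}{\Gamma(1-\beta)}\left[\frac{\partial}{\partial t}\int_0^t(t-\tau)^{-\beta}u(\tau,x)\,d\tau-\frac{u(0,x)}{t^\beta}\right]$. The operators $(I-\Delta)^{\gamma/2}$ and $(-\Delta)^{\alpha/2}$ are the inverses of the Bessel and Riesz potentials (Fourier symbols $(1+|\lambda|^2)^{\gamma/2}$ and $|\lambda|^\alpha$). The Mittag-Leffler function is $E_\beta(s)=\sum_{k=0}^\infty \frac{s^k}{\Gamma(1+\beta k)}$, $s\in\mathbb R$ (so $E_1(s)=e^s$). The process $\xi$ has a spectral density $f$, meaning $r(x)=\int_{\mathbb R}e^{ix\lambda}f(\lambda)\,d\lambda$, and the representation $\xi(x)=\int_{\mathbb R}e^{i\lambda x}\sqrt{f(\lambda)}\,W(d\lambda)$, where $W$ is a Gaussian white-noise random measure on $\mathbb R$ with $\mathbb E|W(d\lambda)|^2=d\lambda$, symmetric (Hermitian) so that all the stochastic integrals are real-valued. The mean-square solution of the initial value problem is $$u(t,x)=\int_{\mathbb R}e^{ix\lambda}E_\beta\left(-\mu|\lambda|^\alpha(1+|\lambda|^2)^{\gamma/2}t^\beta\right)\sqrt{f(\lambda)}\,W(d\lambda).$$ Constants and special functions: for $j\ge1$,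 $c_1(\kappa_j)=\dfrac{2^{(1-\kappa_j)/2}}{\sqrt\pi\,\Gamma(\kappa_j/2)}$; $K_\nu(z)=\frac12\int_0^\infty s^{\nu-1}\exp\left(-\frac12\left(s+\frac1s\right)z\right)ds$ is the modified Bessel function of the second kind. *)

theory Defs
  imports "HOL-Probability.Probability"
begin

definition mittag_leffler :: "real \<Rightarrow> real \<Rightarrow> real" where
  "mittag_leffler \<beta> s = (\<Sum>k. s ^ k / Gamma (1 + \<beta> * real k))"

definition bessel_K :: "real \<Rightarrow> real \<Rightarrow> real" where
  "bessel_K \<nu> z = 1 / 2 * (LBINT s:{0<..}. s powr (\<nu> - 1) * exp (- (1 / 2) * (s + 1 / s) * z))"

definition c1 :: "real \<Rightarrow> real" where
  "c1 \<kappa> = 2 powr ((1 - \<kappa>) / 2) / (sqrt pi * Gamma (\<kappa> / 2))"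

definition covariance :: "'w measure \<Rightarrow> ('w \<Rightarrow> real) \<Rightarrow> ('w \<Rightarrow> real) \<Rightarrow> real" where
  "covariance M X Y =
     integral\<^sup>L M (\<lambda>\<omega>. (X \<omega> - integral\<^sup>L M X) * (Y \<omega> - integral\<^sup>L M Y))"

text \<open>Constants count as (degenerate) Gaussian variables.\<close>

definition gaussian_rv :: "'w measure \<Rightarrow> ('w \<Rightarrow> real) \<Rightarrow> bool" where
  "gaussian_rv M X \<longleftrightarrow>
     X \<in> borel_measurable M \<and>
     ((\<exists>m s. s > 0 \<and> distributed M lborel X (normal_density m s)) \<or>
      (\<exists>m. AE \<omega> in M. X \<omega> = m))"

definition gaussian_process :: "'w measure \<Rightarrow> 'i set \<Rightarrow> ('i \<Rightarrow> 'w \<Rightarrow> real) \<Rightarrow> bool" where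
  "gaussian_process M I X \<longleftrightarrow>
     (\<forall>F c. finite F \<and> F \<subseteq> I \<longrightarrow> gaussian_rv M (\<lambda>\<omega>. \<Sum>i\<in>F. c i * X i \<omega>))"

definition zero_mean_process :: "'w measure \<Rightarrow> 'i set \<Rightarrow> ('i \<Rightarrow> 'w \<Rightarrow> real) \<Rightarrow> bool" where
  "zero_mean_process M I X \<longleftrightarrow> (\<forall>i\<in>I. integrable M (X i) \<and> integral\<^sup>L M (X i) = 0)"

text \<open>Strict stationarity: the law on the path space, which is determined by the
  finite-dimensional distributions, is invariant under shifts.\<close>

definition stationary_process :: "'w measure \<Rightarrow> (real \<Rightarrow> 'w \<Rightarrow> real) \<Rightarrow> bool" where
  "stationary_process M X \<longleftrightarrow>
     (\<forall>h. distr M (\<Pi>\<^sub>M x\<in>UNIV. borel) (\<lambda>\<omega> x. X (x + h) \<omega>) =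
          distr M (\<Pi>\<^sub>M x\<in>UNIV. borel) (\<lambda>\<omega> x. X x \<omega>))"

definition spectral_density :: "(real \<Rightarrow> real) \<Rightarrow> (real \<Rightarrow> real) \<Rightarrow> bool" where
  "spectral_density f r \<longleftrightarrow>
     (\<forall>l. 0 \<le> f l) \<and> integrable lborel f \<and>
     (\<forall>x. complex_of_real (r x) = (LINT l|lborel. exp (\<i> * of_real (x * l)) * of_real (f l)))"

text \<open>A Hermitian Gaussian white noise is indexed by the Borel sets of finite Lebesgue measure.
  Joint Gaussianity of all real and imaginary parts is expressed through
  \<open>Re (c * z) = Re c * Re z - Im c * Im z\<close>.  Countable additivity holds in mean square.\<close>

definition hermitian_white_noise :: "'w measure \<Rightarrow> (real set \<Rightarrow> 'w \<Rightarrow> complex) \<Rightarrow> bool" where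
  "hermitian_white_noise M W \<longleftrightarrow>
     (\<forall>A\<in>fmeasurable lborel. W A \<in> borel_measurable M) \<and>
     (\<forall>F c. finite F \<and> F \<subseteq> fmeasurable lborel \<longrightarrow>
        gaussian_rv M (\<lambda>\<omega>. Re (\<Sum>A\<in>F. c A * W A \<omega>))) \<and>
     (\<forall>A\<in>fmeasurable lborel. integral\<^sup>L M (W A) = 0) \<and>
     (\<forall>A\<in>fmeasurable lborel. \<forall>B\<in>fmeasurable lborel.
        integral\<^sup>L M (\<lambda>\<omega>. W A \<omega> * cnj (W B \<omega>)) = of_real (measure lborel (A \<inter> B))) \<and>
     (\<forall>A\<in>fmeasurable lborel. AE \<omega> in M. W (uminus ` A) \<omega> = cnj (W A \<omega>)) \<and>
     (\<forall>A :: nat \<Rightarrow> real set. disjoint_family A \<and> range A \<subseteq> fmeasurable lborel \<and>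
          (\<Union>i. A i) \<in> fmeasurable lborel \<longrightarrow>
        (\<lambda>n. \<integral>\<^sup>+\<omega>. ennreal ((cmod (W (\<Union>i. A i) \<omega> - (\<Sum>i<n. W (A i) \<omega>)))\<^sup>2) \<partial>M) \<longlonglongrightarrow> 0)"

definition step_fun :: "(complex \<times> real set) list \<Rightarrow> real \<Rightarrow> complex" where
  "step_fun s l = (\<Sum>(c, A)\<leftarrow>s. c * indicator A l)"

definition step_integral ::
    "(real set \<Rightarrow> 'w \<Rightarrow> complex) \<Rightarrow> (complex \<times> real set) list \<Rightarrow> 'w \<Rightarrow> complex" where
  "step_integral W s \<omega> = (\<Sum>(c, A)\<leftarrow>s. c * W A \<omega>)"

text \<open>\<open>X\<close> is a real-valued version of \<open>\<integral> g(\<lambda>) W(d\<lambda>)\<close>: a mean-square limit of integrals of step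
  functions approximating \<open>g\<close> in \<open>L\<^sup>2\<close>.  The integral is unique only up to null sets, so
  the integral operator below picks one version.\<close>

definition has_white_noise_integral ::
    "'w measure \<Rightarrow> (real set \<Rightarrow> 'w \<Rightarrow> complex) \<Rightarrow> (real \<Rightarrow> complex) \<Rightarrow> ('w \<Rightarrow> real) \<Rightarrow> bool" where
  "has_white_noise_integral M W g X \<longleftrightarrow>
     g \<in> borel_measurable lborel \<and> X \<in> borel_measurable M \<and>
     (\<exists>s :: nat \<Rightarrow> (complex \<times> real set) list.
        (\<forall>n. snd ` set (s n) \<subseteq> fmeasurable lborel) \<and>
        (\<lambda>n. \<integral>\<^sup>+l. ennreal ((cmod (g l - step_fun (s n) l))\<^sup>2) \<partial>lborel) \<longlonglongrightarrow> 0 \<and>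
        (\<lambda>n. \<integral>\<^sup>+\<omega>. ennreal ((cmod (of_real (X \<omega>) - step_integral W (s n) \<omega>))\<^sup>2) \<partial>M) \<longlonglongrightarrow> 0)"

definition white_noise_integral ::
    "'w measure \<Rightarrow> (real set \<Rightarrow> 'w \<Rightarrow> complex) \<Rightarrow> (real \<Rightarrow> complex) \<Rightarrow> 'w \<Rightarrow> real" where
  "white_noise_integral M W g = (SOME X. has_white_noise_integral M W g X)"

text \<open>The Fourier symbol of \<open>(I - \<Delta>)\<^bsup>\<gamma>/2\<^esup> (-\<Delta>)\<^bsup>\<alpha>/2\<^esup>\<close>.\<close>

definition riesz_bessel_symbol :: "real \<Rightarrow> real \<Rightarrow> real \<Rightarrow> real" where
  "riesz_bessel_symbol \<alpha> \<gamma> l = \<bar>l\<bar> powr \<alpha> * (1 + \<bar>l\<bar>\<^sup>2) powr (\<gamma> / 2)"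

text \<open>The mean-square solution of
  \<open>\<partial>\<^sup>\<beta>u/\<partial>t\<^sup>\<beta> = -\<mu> (I - \<Delta>)\<^bsup>\<gamma>/2\<^esup> (-\<Delta>)\<^bsup>\<alpha>/2\<^esup> u\<close>, \<open>u(0,x) = \<xi>(x)\<close>.  It is given by its spectral
  representation: the spatial operator acts on \<open>e\<^bsup>ix\<lambda>\<^esup>\<close> as multiplication by its symbol \<open>s\<close>, and
  \<open>t \<mapsto> E\<^sub>\<beta>(-\<mu> s t\<^sup>\<beta>)\<close> is the solution of the resulting Caputo--Djrbashian equation in time
  with value 1 at time 0.\<close>

definition mean_square_solution ::
    "'w measure \<Rightarrow> (real set \<Rightarrow> 'w \<Rightarrow> complex) \<Rightarrow> (real \<Rightarrow> real) \<Rightarrow> real \<Rightarrow> real \<Rightarrow> real \<Rightarrow> real \<Rightarrow>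
     (real \<Rightarrow> 'w \<Rightarrow> real) \<Rightarrow> (real \<Rightarrow> real \<Rightarrow> 'w \<Rightarrow> real) \<Rightarrow> bool" where
  "mean_square_solution M W f \<beta> \<mu> \<gamma> \<alpha> \<xi> u \<longleftrightarrow>
     (\<forall>x. AE \<omega> in M. u 0 x \<omega> = \<xi> x \<omega>) \<and>
     (\<forall>t>0. \<forall>x. has_white_noise_integral M W
        (\<lambda>l. exp (\<i> * of_real (x * l)) *
              of_real (mittag_leffler \<beta> (- \<mu> * riesz_bessel_symbol \<alpha> \<gamma> l * t powr \<beta>) * sqrt (f l)))
        (u t x))"

definition weakly_converges ::
    "('i \<Rightarrow> 'a::topological_space measure) \<Rightarrow> 'a measure \<Rightarrow> 'i filter \<Rightarrow> bool" where
  "weakly_converges N N0 F \<longleftrightarrow>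
     (\<forall>g :: 'a \<Rightarrow> real. continuous_on UNIV g \<and> bounded (range g) \<longrightarrow>
        ((\<lambda>i. integral\<^sup>L (N i) g) \<longlongrightarrow> integral\<^sup>L N0 g) F)"

definition fin_dim_distr ::
    "'w measure \<Rightarrow> (real \<Rightarrow> real \<Rightarrow> 'w \<Rightarrow> real) \<Rightarrow> ('m::finite \<Rightarrow> real \<times> real) \<Rightarrow> (real ^ 'm) measure" where
  "fin_dim_distr M X p = distr M borel (\<lambda>\<omega>. \<chi> i. X (fst (p i)) (snd (p i)) \<omega>)"

end

(* The field U_eps and the limit U_0 are white noise integrals, so finite-dimensional laws are centered
   Gaussian and it suffices that the variance of every linear combination converges.  After the
   substitution l = eta * lam with eta = eps^(beta/alpha) this variance is the integral of
   |sum_i theta_i exp(i x_i lam) E_beta(-mu t_i^beta |lam|^alpha (1 + (eta lam)^2)^(gamma/2))|^2 f(eta lam),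
   and the spectral density f is continuous at 0 with f(0) = C, although it is singular at the
   frequencies w_j.  The bound |E_beta(-x)| <= D / (1 + x), obtained from a maximum principle for the
   Caputo derivative, gives a dominating function near the origin and mass O(eta^(2 alpha - 1)) away
   from it.  Fourier uniqueness identifies f with a sum of shifted mixtures of normal densities. *)

theory Submission
  imports Defs
begin

section \<open>The Mittag-Leffler function on the negative half-line\<close>

text \<open>The density \<open>f\<close> is pinned down only almost everywhere, so its value at 0
  carries no information; limits are taken with an explicit representative that is continuous at 0,
  and \<open>f\<close> is exchanged for it under the integral. The weights \<open>A j\<close> may
  have either sign, so nonnegativity of the constant C is invisible in its formula: it is inherited
  from f \<ge> 0 through continuity. The condition \<alpha> > 1/2 enters through the decay
  |l|^(-\<alpha>) of the transforms, whose square has to be integrable at infinity. The series of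
  E_\<beta>(-x) alternates and shows no decay by itself; this is why the fractional equation and a
  comparison function are used. Weak convergence is tested on trigonometric polynomials, whose
  expectations depend on variances alone, and second moments control the replacement error outside a
  cube. The integral in the limit field is a chosen version, so the existence of a real-valued
  version has to be proved; this rests on Hermitian integrands and symmetrized step
  functions.\<close>

lemma Gamma_lower_bound:
  fixes x R :: real
  assumes "x \<ge> 0" "R > 0"
  shows "R powr x * exp (- R) \<le> Gamma (1 + x)"
proof -
  have 1: "((\<lambda>t. t powr x / exp t) has_integral Gamma (1 + x)) {0..}"
    using Gamma_integral_real[of "1 + x"] assms by simp
  \<comment> \<open>The Gamma integral is truncated to [R, \<infinity>), where t^x \<ge> R^x. Since
    R is free, Gamma (1 + x) outgrows every exponential in x.\<close>
  have "((\<lambda>t. R powr x * exp (- 1 * t)) has_integral R powr x * (exp (- 1 * R) / 1)) {R..}"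
    by (intro has_integral_mult_right has_integral_exp_minus_to_infinity) simp
  hence "((\<lambda>t. if t \<in> {R..} then R powr x * exp (- t) else 0) has_integral R powr x * exp (- R)) {0..}"
    using assms by (subst has_integral_restrict) auto
  from this 1 show ?thesis
    by (rule has_integral_le) (use assms in \<open>auto simp: exp_minus divide_inverse intro!: powr_mono2\<close>)
qed

lemma summable_mittag_leffler:
  assumes "\<beta> > 0"
  shows "summable (\<lambda>k. 1 / Gamma (1 + \<beta> * real k) * (y::real) ^ k)"
proof (rule summable_comparison_test')
  \<comment> \<open>R is chosen so that R^(\<beta> k) = q^k; the k-th term is then at most exp R
    times the k-th power of |y| / q, and |y| / q < 1/2.\<close>
  define q R where "q = 2 * \<bar>y\<bar> + 1" and "R = q powr (1 / \<beta>)"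
  have q: "q > 0" and R: "R > 0" unfolding R_def q_def by auto
  show "summable (\<lambda>k. exp R * (\<bar>y\<bar> / q) ^ k)"
    using q by (intro summable_mult summable_geometric) (auto simp: q_def)
  show "norm (1 / Gamma (1 + \<beta> * real k) * y ^ k) \<le> exp R * (\<bar>y\<bar> / q) ^ k" for k
  proof -
    have "R powr (\<beta> * real k) = q ^ k"
      using assms q by (simp add: R_def powr_powr powr_realpow)
    hence le: "q ^ k * exp (- R) \<le> Gamma (1 + \<beta> * real k)"
      using Gamma_lower_bound[of "\<beta> * real k" R] assms R by simp
    have pos: "0 < q ^ k * exp (- R)" using q by simp
    have qk: "0 < q ^ k" and Gk: "0 < Gamma (1 + \<beta> * real k)" using q less_le_trans[OF pos le] by auto
    have "norm (1 / Gamma (1 + \<beta> * real k) * y ^ k) = 1 / Gamma (1 + \<beta> * real k) * \<bar>y\<bar> ^ k"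
      using le pos by (simp add: abs_mult power_abs)
    also have "\<dots> \<le> 1 / (q ^ k * exp (- R)) * \<bar>y\<bar> ^ k"
      using le pos qk Gk by (intro mult_right_mono divide_left_mono mult_pos_pos) auto
    also have "\<dots> = exp R * (\<bar>y\<bar> / q) ^ k"
      by (simp add: exp_minus power_divide field_simps)
    finally show ?thesis .
  qed
qed

lemma summable_mittag_leffler':
  assumes "\<beta> > 0"
  shows "summable (\<lambda>k. (y::real) ^ k / Gamma (1 + \<beta> * real k))"
  using summable_mittag_leffler[OF assms, of y] by simp

text \<open>Kept as a power series because its coefficients are needed twice: for continuity and for
  the termwise Beta integrals below.\<close>

definition mittag_leffler_deriv :: "real \<Rightarrow> real \<Rightarrow> real" where
  "mittag_leffler_deriv \<beta> y = (\<Sum>k. diffs (\<lambda>k. 1 / Gamma (1 + \<beta> * real k)) k * y ^ k)"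

lemma has_real_derivative_mittag_leffler:
  assumes "\<beta> > 0"
  shows "(mittag_leffler \<beta> has_real_derivative mittag_leffler_deriv \<beta> y) (at y)"
  using termdiffs_strong_converges_everywhere[OF summable_mittag_leffler[OF assms], of y]
  unfolding mittag_leffler_deriv_def by (simp add: mittag_leffler_def[abs_def])

lemma continuous_mittag_leffler_deriv:
  assumes "\<beta> > 0"
  shows "isCont (mittag_leffler_deriv \<beta>) y"
  unfolding mittag_leffler_deriv_def
  by (rule DERIV_isCont[OF termdiffs_strong_converges_everywhere])
     (rule termdiff_converges_all[OF summable_mittag_leffler[OF assms]])

lemma continuous_on_mittag_leffler:
  "\<beta> > 0 \<Longrightarrow> continuous_on S (mittag_leffler \<beta>)"
  by (meson DERIV_isCont continuous_at_imp_continuous_on has_real_derivative_mittag_leffler)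

lemma mittag_leffler_0 [simp]: "mittag_leffler \<beta> 0 = 1"
  unfolding mittag_leffler_def by (subst suminf_finite[of "{0}"]) auto

lemma mittag_leffler_1: "mittag_leffler 1 s = exp s"
proof -
  have "Gamma (1 + 1 * real k) = fact k" for k using Gamma_fact[of k, where ?'a = real] by simp
  thus ?thesis unfolding mittag_leffler_def exp_def by (simp add: divide_inverse mult.commute)
qed

text \<open>Termwise Beta integrals show that \<open>t \<mapsto> E\<^sub>\<beta>(y t\<^sup>\<beta>)\<close> solves \<open>D\<^sup>\<beta> u = y u\<close>, here at time 1.\<close>

lemma caputo_mittag_leffler:
  fixes y :: real
  assumes "0 < \<beta>" "\<beta> < 1"
  shows "((\<lambda>s. mittag_leffler_deriv \<beta> (y * s powr \<beta>) * (y * (\<beta> * s powr (\<beta> - 1))) * (1 - s) powr (- \<beta>))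
           has_integral Gamma (1 - \<beta>) * y * mittag_leffler \<beta> y) {0..1}"
proof -
  let ?F = "\<lambda>y s. mittag_leffler_deriv \<beta> (y * s powr \<beta>) * (y * (\<beta> * s powr (\<beta> - 1))) * (1 - s) powr (- \<beta>)"
  define a where "a = (\<lambda>k::nat. \<beta> * real (Suc k))"
  define B where "B = (\<lambda>k s. s powr (a k - 1) * (1 - s) powr ((1 - \<beta>) - 1))"
  define g where "g = (\<lambda>k s. indicator {0..1} s *\<^sub>R (y ^ Suc k / Gamma (a k) * B k s))"
  have a: "a k > 0" for k using assms by (simp add: a_def)
  \<comment> \<open>The Beta arguments add up to 1 + \<beta> k, so integration turns the denominator
    Gamma (a k) into the Mittag-Leffler denominator of index k. The power y^(k+1) has one factor y
    left over, which is the eigenvalue.\<close>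
  have Beta: "Beta (a k) (1 - \<beta>) / Gamma (a k) = Gamma (1 - \<beta>) / Gamma (1 + \<beta> * real k)" for k
  proof -
    have e: "a k + (1 - \<beta>) = 1 + \<beta> * real k" by (simp add: a_def algebra_simps)
    have "Gamma (a k) > 0" using a by (rule Gamma_real_pos)
    thus ?thesis unfolding Beta_def e by simp
  qed
  have sB: "set_integrable lborel {0..1} (B k)" for k
    unfolding B_def using integrable_Beta[OF a, of "1 - \<beta>" k] assms by simp
  have iB: "(LINT s:{0..1}|lborel. B k s) = Beta (a k) (1 - \<beta>)" for k
    using set_borel_integral_eq_integral(2)[OF sB, of k] has_integral_Beta_real[OF a, of "1-\<beta>" k] assms
    unfolding B_def by (metis diff_gt_0_iff_gt integral_unique)
  have g_int: "integrable lborel (g k)" for k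
    using sB[of k] unfolding g_def set_integrable_def
    by (auto intro!: integrable_mult_right[of _ _ "\<lambda>s. indicator {0..1} s * B k s", simplified] simp: mult.left_commute)
  have norm_g: "norm (g k s) = \<bar>y\<bar> ^ Suc k / Gamma (a k) * (indicator {0..1} s *\<^sub>R B k s)" for k s
    using Gamma_real_pos[OF a, of k]
    by (auto simp: g_def B_def abs_mult power_abs indicator_def)
  have int_norm: "(LBINT s. norm (g k s)) = \<bar>y\<bar> * Gamma (1 - \<beta>) * (\<bar>y\<bar> ^ k / Gamma (1 + \<beta> * real k))" for k
  proof -
    have "(LBINT s. norm (g k s)) = \<bar>y\<bar> ^ Suc k / Gamma (a k) * Beta (a k) (1 - \<beta>)"
      unfolding norm_g iB[symmetric] set_lebesgue_integral_def by (rule integral_mult_right_zero)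
    also have "\<dots> = \<bar>y\<bar> ^ Suc k * (Beta (a k) (1 - \<beta>) / Gamma (a k))" by simp
    finally show ?thesis unfolding Beta by simp
  qed
  have int_g: "(LBINT s. g k s) = y * Gamma (1 - \<beta>) * (y ^ k / Gamma (1 + \<beta> * real k))" for k
  proof -
    have "(LBINT s. g k s) = y ^ Suc k / Gamma (a k) * Beta (a k) (1 - \<beta>)"
      unfolding g_def iB[symmetric] set_lebesgue_integral_def 
      by (subst integral_mult_right_zero[symmetric]) (simp add: mult.left_commute)
    also have "\<dots> = y ^ Suc k * (Beta (a k) (1 - \<beta>) / Gamma (a k))" by simp
    finally show ?thesis unfolding Beta by simp
  qed
  \<comment> \<open>Stated for every z: z = y gives the sum of the series, z = |y| its absolute
    summability.\<close>
  have term_sums: "(\<lambda>k. z ^ Suc k / Gamma (a k) * B k s) sums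
       ?F z s"
    if s: "s \<in> {0<..1}" for s z :: real
  proof -
    define P where "P = z * (\<beta> * s powr (\<beta> - 1)) * (1 - s) powr (- \<beta>)"
    define d where "d = diffs (\<lambda>k. 1 / Gamma (1 + \<beta> * real k))"
    have "(\<lambda>k. d k * (z * s powr \<beta>) ^ k) sums mittag_leffler_deriv \<beta> (z * s powr \<beta>)"
      unfolding mittag_leffler_deriv_def d_def
      by (intro summable_sums termdiff_converges_all summable_mittag_leffler assms)
    hence "(\<lambda>k. d k * (z * s powr \<beta>) ^ k * P) sums (mittag_leffler_deriv \<beta> (z * s powr \<beta>) * P)"
      by (rule sums_mult2)
    moreover have "d k * (z * s powr \<beta>) ^ k * P = z ^ Suc k / Gamma (a k) * B k s" for k
    proof -
      have 1: "d k * \<beta> = 1 / Gamma (a k)"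
      proof -
        have "a k \<notin> \<int>\<^sub>\<le>\<^sub>0" using a[of k] nonpos_Ints_nonpos by force
        hence "Gamma (1 + a k) = a k * Gamma (a k)"
          using Gamma_plus1[of "a k"] by (simp add: add.commute)
        moreover have "Gamma (a k) > 0" using a by (rule Gamma_real_pos)
        ultimately show ?thesis using assms unfolding d_def diffs_def a_def
          by (simp add: divide_simps del: of_nat_Suc)
      qed
      have 2: "(s powr \<beta>) ^ k * s powr (\<beta> - 1) = s powr (a k - 1)"
        using s by (simp add: powr_realpow[symmetric] powr_powr powr_add[symmetric] a_def algebra_simps)
      have "d k * (z * s powr \<beta>) ^ k * P =
          (d k * \<beta>) * z ^ Suc k * ((s powr \<beta>) ^ k * s powr (\<beta> - 1)) * (1 - s) powr (- \<beta>)"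
        by (simp add: P_def power_mult_distrib mult_ac)
      thus ?thesis unfolding 1 2 by (simp add: B_def)
    qed
    ultimately show ?thesis by (simp add: P_def mult.assoc)
  qed
  \<comment> \<open>\<open>0 powr a\<close> is 0 for every exponent, so at the singular endpoint s =
    0 both the terms and their sum vanish.\<close>
  have g0: "g k s = 0" if "s \<notin> {0<..1}" for k s
    using that by (cases "s = 0") (auto simp: g_def B_def)
  have sums_s: "(\<lambda>k. g k s) sums (indicator {0..1} s *\<^sub>R
       ?F y s)"
    (is "_ sums ?D s") for s
  proof (cases "s \<in> {0<..1}")
    case True
    thus ?thesis using term_sums[OF True, of y] by (simp add: g_def)
  next
    case False
    have D0: "?D s = 0" using False by (cases "s = 0") auto
    show ?thesis unfolding g0[OF False] D0 by (rule sums_zero)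
  qed
  define D where "D = (\<lambda>s. indicator {0..1} s *\<^sub>R
       ?F y s)"
  have D: "D s = (\<Sum>k. g k s)" for s unfolding D_def using sums_s[of s] by (rule sums_unique)
  have AE: "AE s in lborel. summable (\<lambda>k. norm (g k s))"
  proof (rule AE_I2)
    fix s :: real
    show "summable (\<lambda>k. norm (g k s))"
    proof (cases "s \<in> {0<..1}")
      case True
      thus ?thesis using sums_summable[OF term_sums[OF True, of "\<bar>y\<bar>"]] unfolding norm_g by simp
    qed (simp add: g0)
  qed
  have sm: "summable (\<lambda>k. \<integral>s. norm (g k s) \<partial>lborel)"
    unfolding int_norm by (intro summable_mult summable_mittag_leffler' assms)
  have intD: "integrable lborel D"
    using integrable_suminf[OF g_int AE sm] unfolding D[symmetric] by simp
  have "(\<lambda>k. \<integral>s. g k s \<partial>lborel) sums (LBINT s. D s)"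
    using sums_integral[OF g_int AE sm] unfolding D[symmetric] by simp
  moreover have "(\<lambda>k. \<integral>s. g k s \<partial>lborel) sums (y * Gamma (1 - \<beta>) * mittag_leffler \<beta> y)"
    unfolding int_g mittag_leffler_def by (intro sums_mult summable_sums summable_mittag_leffler' assms)
  ultimately have "(LBINT s. D s) = y * Gamma (1 - \<beta>) * mittag_leffler \<beta> y"
    by (rule sums_unique2)
  with has_integral_integral_lborel[OF intD]
  have "(D has_integral y * Gamma (1 - \<beta>) * mittag_leffler \<beta> y) UNIV" by simp
  hence "((\<lambda>s. if s \<in> {0..1} then ?F y s else 0)
      has_integral y * Gamma (1 - \<beta>) * mittag_leffler \<beta> y) UNIV"
    by (rule has_integral_eq[rotated]) (auto simp: D_def indicator_def)
  thus ?thesis by (subst (asm) has_integral_restrict_UNIV) (simp add: mult_ac)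
qed

section \<open>Comparison principle and decay of the Mittag-Leffler function\<close>

text \<open>Integration by parts against the singular kernel, phrased as monotonicity. With F(s) =
  (w(s) - w(1)) (1 - s)^(-\<beta>) and \<Phi> the primitive of the given integrand, (F - \<Phi>)' =
  \<beta> (w(s) - w(1)) (1 - s)^(-\<beta>-1) \<ge> 0, because w is minimal at 1. Comparing F -
  \<Phi> at 0 and at 1, where F vanishes, gives the claim.\<close>

lemma extremum_principle:
  fixes w w' :: "real \<Rightarrow> real"
  assumes \<beta>: "0 < \<beta>" "\<beta> < 1"
    and cont: "continuous_on {0..1} w"
    and deriv: "\<And>s. s \<in> {0<..<1} \<Longrightarrow> (w has_real_derivative w' s) (at s)"
    and cont': "\<And>s. s \<in> {0<..<1} \<Longrightarrow> isCont w' s"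
    and deriv1: "(w has_real_derivative d) (at 1)"
    and min: "\<And>s. s \<in> {0..1} \<Longrightarrow> w 1 \<le> w s"
    and I: "((\<lambda>s. w' s * (1 - s) powr (- \<beta>)) has_integral I) {0..1}"
  shows "I \<le> w 1 - w 0"
proof -
  define h where "h = (\<lambda>s. w' s * (1 - s) powr (- \<beta>))"
  define \<Phi> where "\<Phi> = (\<lambda>s. integral {0..s} h)"
  define F where "F = (\<lambda>s. (w s - w 1) * (1 - s) powr (- \<beta>))"
  have h: "h integrable_on {0..1}" using I unfolding h_def by blast
  \<comment> \<open>Differentiability at 1 gives w(s) - w(1) = O(1 - s), which beats (1 -
    s)^(-\<beta>) since \<beta> < 1; hence the boundary term disappears.\<close>
  have F1: "(F \<longlongrightarrow> F 1) (at 1 within {0..1})"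
  proof -
    have "((\<lambda>s. (w s - w 1) / (s - 1)) \<longlongrightarrow> d) (at 1 within {0..1})"
      using deriv1 has_field_derivative_iff[of w d 1] tendsto_within_subset by blast
    moreover have "((\<lambda>s. (1 - s) powr (1 - \<beta>)) \<longlongrightarrow> 0) (at 1 within {0..1})"
    proof -
      have "((\<lambda>s. (1 - s) powr (1 - \<beta>)) \<longlongrightarrow> (1 - 1) powr (1 - \<beta>)) (at 1 within {0..1::real})"
        using \<beta> by (intro tendsto_powr2 tendsto_intros) (auto simp: eventually_at_filter)
      thus ?thesis using \<beta> by simp
    qed
    ultimately have "((\<lambda>s. - ((w s - w 1) / (s - 1)) * (1 - s) powr (1 - \<beta>)) \<longlongrightarrow> - d * 0) (at 1 within {0..1})"
      by (intro tendsto_intros)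
    moreover have "\<forall>\<^sub>F s in at 1 within {0..1}. - ((w s - w 1) / (s - 1)) * (1 - s) powr (1 - \<beta>) = F s"
      unfolding eventually_at_filter
    proof (intro always_eventually allI impI)
      fix s :: real assume s: "s \<noteq> 1" "s \<in> {0..1}"
      hence "(1 - s) powr (1 - \<beta>) = (1 - s) * (1 - s) powr (- \<beta>)"
        using powr_add[of "1 - s" 1 "- \<beta>"] by simp
      moreover have "- (b / (s - 1)) * ((1 - s) * X) = b * X" for b X :: real
        using s by (simp add: field_simps)
      ultimately show "- ((w s - w 1) / (s - 1)) * (1 - s) powr (1 - \<beta>) = F s"
        by (simp only: F_def)
    qed
    ultimately show ?thesis by (simp add: F_def tendsto_cong)
  qed
  have contF: "continuous_on {0..1} F"
    unfolding continuous_on_def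
  proof
    fix s :: real assume s: "s \<in> {0..1}"
    show "(F \<longlongrightarrow> F s) (at s within {0..1})"
    proof (cases "s = 1")
      case False
      have "(w \<longlongrightarrow> w s) (at s within {0..1})" using cont s by (simp add: continuous_on_def)
      thus ?thesis unfolding F_def using False s by (intro tendsto_intros) auto
    qed (use F1 in simp)
  qed
  have contPhi: "continuous_on {0..1} \<Phi>" unfolding \<Phi>_def by (rule indefinite_integral_continuous_1[OF h])
  have "F 0 - \<Phi> 0 \<le> F 1 - \<Phi> 1"
  proof (rule DERIV_nonneg_imp_increasing_open[of 0 1 "\<lambda>s. F s - \<Phi> s"])
    show "continuous_on {0..1} (\<lambda>s. F s - \<Phi> s)" by (intro continuous_intros contF contPhi)
    fix s :: real assume s: "0 < s" "s < 1"
    have "isCont h s" unfolding h_def using s by (intro continuous_intros cont') auto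
    hence cw: "continuous (at s within ({0..1} - {})) h"
      by (rule continuous_at_imp_continuous_at_within)
    have s': "s \<in> {0..1} - {}" using s by simp
    have "((\<lambda>u. integral {0..u} h) has_vector_derivative h s) (at s within ({0..1} - {}))"
      by (rule integral_has_vector_derivative_continuous_at[OF h s' finite.emptyI cw])
    hence Ph: "(\<Phi> has_real_derivative h s) (at s)"
      using s by (simp add: \<Phi>_def has_real_derivative_iff_has_vector_derivative at_within_Icc_at)
    have "(F has_real_derivative w' s * (1 - s) powr (- \<beta>) + (w s - w 1) * (\<beta> * (1 - s) powr (- \<beta> - 1))) (at s)"
      unfolding F_def using s by (auto intro!: derivative_eq_intros deriv simp: powr_diff)
    from DERIV_diff[OF this Ph]
    have "((\<lambda>s. F s - \<Phi> s) has_real_derivative (w s - w 1) * (\<beta> * (1 - s) powr (- \<beta> - 1))) (at s)"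
      by (simp add: h_def)
    moreover have "(w s - w 1) * (\<beta> * (1 - s) powr (- \<beta> - 1)) \<ge> 0" using min[of s] s \<beta> by auto
    ultimately show "\<exists>y. ((\<lambda>s. F s - \<Phi> s) has_real_derivative y) (at s) \<and> 0 \<le> y" by blast
  qed simp
  moreover have "\<Phi> 1 = I" using I unfolding \<Phi>_def h_def by (rule integral_unique)
  ultimately show ?thesis by (simp add: F_def \<Phi>_def)
qed

text \<open>The integrand is the derivative of (1 + c s)^(-\<beta>) times the Caputo kernel. Writing
  1 + c = (1 + c s) + c (1 - s) lets each summand absorb one of the two factors: (1 + c) j(s) \<le>
  (1 - s)^(-\<beta>) + c (1 + c s)^(-\<beta>-1). The right side integrates to at most 1/(1 -
  \<beta>) + 1/\<beta> = 1/(\<beta> (1 - \<beta>)).\<close>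

lemma barrier_integral:
  fixes c :: real
  assumes "0 < \<beta>" "\<beta> < 1" "c > 0"
  defines "h \<equiv> (\<lambda>s. (- \<beta> * c * (1 + c * s) powr (- \<beta> - 1)) * (1 - s) powr (- \<beta>))"
  shows "h integrable_on {0..1}" "integral {0..1} h \<ge> - c / ((1 + c) * (1 - \<beta>))"
proof -
  define j where "j = (\<lambda>s. (1 + c * s) powr (- \<beta> - 1) * (1 - s) powr (- \<beta>))"
  have B: "set_integrable lborel {0..1} (\<lambda>s. (1 - s) powr (- \<beta>))"
  proof -
    have "set_integrable lborel {0..1} (\<lambda>t. t powr (1 - 1) * (1 - t) powr ((1 - \<beta>) - 1))"
      by (rule integrable_Beta) (use assms in auto)
    \<comment> \<open>\<open>0 powr 0\<close> is 0, so at the single point 0 the Beta integrand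
      differs from (1 - x)^(-\<beta>).\<close>
    moreover have "AE x in lborel. x \<noteq> (0::real)" by (rule AE_lborel_singleton)
    hence "AE x in lborel. indicator {0..1} x *\<^sub>R (x powr (1 - 1) * (1 - x) powr ((1 - \<beta>) - 1)) =
        indicator {0..1} x *\<^sub>R ((1 - x) powr (- \<beta>))"
      by eventually_elim auto
    ultimately show ?thesis unfolding set_integrable_def
      by (subst (asm) integrable_cong_AE) auto
  qed
  have iB: "((\<lambda>s. (1 - s) powr (- \<beta>)) has_integral 1 / (1 - \<beta>)) {0..1}"
  proof -
    have "((\<lambda>t. t powr (1 - 1) * (1 - t) powr ((1 - \<beta>) - 1)) has_integral Beta 1 (1 - \<beta>)) {0..1}"
      by (rule has_integral_Beta_real) (use assms in auto)
    moreover have "Beta 1 (1 - \<beta>) = 1 / (1 - \<beta>)"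
    proof -
      have "1 - \<beta> \<notin> \<int>\<^sub>\<le>\<^sub>0" using assms nonpos_Ints_nonpos by force
      hence "Gamma (1 + (1 - \<beta>)) = (1 - \<beta>) * Gamma (1 - \<beta>)"
        using Gamma_plus1[of "1 - \<beta>"] by (simp add: add.commute)
      moreover have "Gamma (1 - \<beta>) > 0" using assms by simp
      ultimately show ?thesis unfolding Beta_def by simp
    qed
    ultimately have "((\<lambda>t. t powr (1 - 1) * (1 - t) powr ((1 - \<beta>) - 1)) has_integral 1 / (1 - \<beta>)) {0..1}" by simp
    thus ?thesis by (rule has_integral_spike[of "{0}", rotated 2]) auto
  qed
  have "set_integrable lborel {0..1} j"
    unfolding set_integrable_def
  proof (rule Bochner_Integration.integrable_bound[OF B[unfolded set_integrable_def]])
    show "AE s in lborel. norm (indicator {0..1} s *\<^sub>R j s) \<le> norm (indicator {0..1} s *\<^sub>R (1 - s) powr (- \<beta>))"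
    proof (rule AE_I2)
      fix s :: real
      have "(1 + c * s) powr (- \<beta> - 1) \<le> 1 powr (- \<beta> - 1)" if "s \<in> {0..1}"
        using that assms by (intro powr_mono2') auto
      thus "norm (indicator {0..1} s *\<^sub>R j s) \<le> norm (indicator {0..1} s *\<^sub>R (1 - s) powr (- \<beta>))"
        by (auto simp: j_def indicator_def abs_mult intro!: mult_left_le_one_le)
    qed
  qed (simp add: j_def)
  hence j: "j integrable_on {0..1}" by (rule set_borel_integral_eq_integral)
  have h_j: "h = (\<lambda>s. - \<beta> * c * j s)" by (simp add: h_def j_def fun_eq_iff)
  show "h integrable_on {0..1}" unfolding h_j using has_integral_mult_right[OF integrable_integral[OF j]] by blast
  have pw: "(1 + c) * j s \<le> (1 - s) powr (- \<beta>) + c * (1 + c * s) powr (- \<beta> - 1)" if s: "s \<in> {0..1}" for s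
  proof (cases "s = 1")
    case False
    have p: "1 + c * s > 0" "1 - s > 0" using s assms False by (auto intro: add_pos_nonneg)
    have e1: "(1 + c * s) * (1 + c * s) powr (- \<beta> - 1) = (1 + c * s) powr (- \<beta>)"
      using p by (simp add: powr_diff)
    have e2: "(1 - s) * (1 - s) powr (- \<beta>) = (1 - s) powr (1 - \<beta>)"
      using p powr_add[of "1 - s" 1 "- \<beta>"] by simp
    have "(1 + c) * j s = ((1 + c * s) + c * (1 - s)) * j s" by (simp add: algebra_simps)
    also have "\<dots> = (1 + c * s) * (1 + c * s) powr (- \<beta> - 1) * (1 - s) powr (- \<beta>)
        + c * ((1 - s) * (1 - s) powr (- \<beta>)) * (1 + c * s) powr (- \<beta> - 1)"
      by (simp add: j_def algebra_simps)
    also have "\<dots> \<le> 1 * (1 - s) powr (- \<beta>) + c * 1 * (1 + c * s) powr (- \<beta> - 1)"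
    proof (unfold e1 e2, intro add_mono mult_right_mono mult_left_mono)
      show "(1 + c * s) powr - \<beta> \<le> 1"
        using powr_mono2'[of "- \<beta>" 1 "1 + c * s"] s assms by simp
      show "(1 - s) powr (1 - \<beta>) \<le> 1"
        using s assms by (simp add: powr_le1)
    qed (use assms in auto)
    finally show ?thesis by simp
  qed (use assms in \<open>simp add: j_def\<close>)
  have "((\<lambda>s. c * (1 + c * s) powr (- \<beta> - 1)) has_integral
      ((- ((1 + c * 1) powr (- \<beta>) / \<beta>)) - (- ((1 + c * 0) powr (- \<beta>) / \<beta>)))) {0..1}"
  proof (rule fundamental_theorem_of_calculus)
    fix s :: real assume s: "s \<in> {0..1}"
    hence p: "1 + c * s > 0" using assms by (auto intro: add_pos_nonneg)
    have "((\<lambda>s. - ((1 + c * s) powr (- \<beta>) / \<beta>)) has_real_derivative c * (1 + c * s) powr (- \<beta> - 1)) (at s within {0..1})"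
    proof -
      have "((\<lambda>s. (1 + c * s) powr (- \<beta>)) has_real_derivative - \<beta> * c * (1 + c * s) powr (- \<beta> - 1)) (at s within {0..1})"
        using p by (auto intro!: derivative_eq_intros simp: powr_diff field_simps)
      from DERIV_minus[OF DERIV_cdivide[OF this, of \<beta>]] show ?thesis using assms by simp
    qed
    thus "((\<lambda>s. - ((1 + c * s) powr (- \<beta>) / \<beta>)) has_vector_derivative c * (1 + c * s) powr (- \<beta> - 1)) (at s within {0..1})"
      by (simp add: has_real_derivative_iff_has_vector_derivative)
  qed simp
  from has_integral_add[OF iB this]
  have "(1 + c) * integral {0..1} j \<le> 1 / (1 - \<beta>) + ((- ((1 + c * 1) powr (- \<beta>) / \<beta>)) - (- ((1 + c * 0) powr (- \<beta>) / \<beta>)))"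
    by (intro has_integral_le[OF has_integral_mult_right[OF integrable_integral[OF j]] _ pw]) 
  also have "\<dots> \<le> 1 / (1 - \<beta>) + 1 / \<beta>"
  proof -
    have "0 \<le> (1 + c * 1) powr (- \<beta>) / \<beta>" using assms by simp
    moreover have "(1 + c * 0) powr (- \<beta>) = 1" by simp
    ultimately show ?thesis by (simp only:)
  qed
  also have "\<dots> = 1 / (\<beta> * (1 - \<beta>))" using assms by (simp add: field_simps)
  finally have le: "(1 + c) * integral {0..1} j \<le> 1 / (\<beta> * (1 - \<beta>))" .
  have "x \<le> b / a" if "a * x \<le> b" "a > 0" for a b x :: real
    using that by (simp add: pos_le_divide_eq mult.commute)
  from this[OF le] have "integral {0..1} j \<le> 1 / (\<beta> * (1 - \<beta>)) / (1 + c)" using assms(3) by simp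
  hence "\<beta> * c * integral {0..1} j \<le> \<beta> * c * (1 / (\<beta> * (1 - \<beta>)) / (1 + c))"
    using assms by (intro mult_left_mono) auto
  also have "\<dots> = c / ((1 + c) * (1 - \<beta>))" using assms(1-3) by (simp add: divide_simps)
  finally show "integral {0..1} h \<ge> - c / ((1 + c) * (1 - \<beta>))"
    unfolding h_j by simp
qed

text \<open>Comparison with the barrier \<open>(1 + c t)\<^bsup>-\<beta>\<^esup>\<close>: \<open>w\<close> is the sum of the barrier and \<open>\<sigma> E\<^sub>\<beta>(-t\<^sup>\<beta>)\<close>,
  rescaled so that a negative minimum sits at 1; the extremum principle excludes it.\<close>

lemma mittag_leffler_barrier:
  fixes \<beta> t \<sigma> :: real
  assumes b: "0 < \<beta>" "\<beta> < 1" and t: "t \<ge> 0" and \<sigma>: "\<bar>\<sigma>\<bar> = 1"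
  defines "c \<equiv> Gamma (2 - \<beta>) powr (1 / \<beta>)"
  shows "0 \<le> (1 + c * t) powr (- \<beta>) + \<sigma> * mittag_leffler \<beta> (- (t powr \<beta>))"
proof (rule ccontr)
  define w where "w = (\<lambda>t. (1 + c * t) powr (- \<beta>) + \<sigma> * mittag_leffler \<beta> (- (t powr \<beta>)))"
  assume "\<not> ?thesis"
  hence neg: "w t < 0" by (simp add: w_def)
  have G: "Gamma (2 - \<beta>) > 0" using b by simp
  have c: "c > 0" unfolding c_def using G by (simp del: Gamma_real_pos)
  have contw: "continuous_on {0..} w"
  proof -
    have "continuous_on {0..} (\<lambda>t::real. - (t powr \<beta>))"
      using b by (intro continuous_intros continuous_on_powr') auto
    hence "continuous_on {0..} (\<lambda>t::real. mittag_leffler \<beta> (- (t powr \<beta>)))"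
      by (rule continuous_on_compose2[OF continuous_on_mittag_leffler[OF b(1), of UNIV]]) auto
    thus ?thesis unfolding w_def
      using c by (intro continuous_intros) (auto simp: add_nonneg_eq_0_iff)
  qed
  have "\<exists>T\<in>{0..t}. \<forall>s\<in>{0..t}. w T \<le> w s"
    by (rule continuous_attains_inf) (use t in \<open>auto intro: continuous_on_subset[OF contw]\<close>)
  then obtain T where T: "T \<in> {0..t}" "\<And>s. s \<in> {0..t} \<Longrightarrow> w T \<le> w s" by blast
  have wT: "w T < 0" using T(2)[of t] t neg by simp
  \<comment> \<open>The value at time 0 is 1 + \<sigma>, that is 0 or 2, so a negative minimum sits
    at a positive time T.\<close>
  have w0: "w 0 \<ge> 0" using \<sigma> by (auto simp: w_def)
  have T0: "T > 0" using wT w0 T(1) by (cases "T = 0") auto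
  \<comment> \<open>Rescaling time by T moves the minimum to 1 and turns E_\<beta>(-(T s)^\<beta>)
    into E_\<beta>(y s^\<beta>), to which the Caputo identity at time 1 applies.\<close>
  define y where "y = - (T powr \<beta>)"
  have y: "- ((T * s) powr \<beta>) = y * s powr \<beta>" if "s \<ge> 0" for s
    using T0 that by (simp add: y_def powr_mult)
  define wd where "wd = (\<lambda>s. - \<beta> * (c * T) * (1 + (c * T) * s) powr (- \<beta> - 1)
      + \<sigma> * (mittag_leffler_deriv \<beta> (y * s powr \<beta>) * (y * (\<beta> * s powr (\<beta> - 1)))))"
  define v where "v = (\<lambda>s. (1 + (c * T) * s) powr (- \<beta>) + \<sigma> * mittag_leffler \<beta> (y * s powr \<beta>))"
  have v: "v s = w (T * s)" if "s \<ge> 0" for s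
    using y[OF that] by (simp add: v_def w_def mult.assoc)
  have deriv: "(v has_real_derivative wd s) (at s)" if s: "s > 0" for s
  proof -
    have p: "1 + (c * T) * s > 0" using s c T0 by (auto intro: add_pos_pos)
    have 1: "((\<lambda>s. (1 + (c * T) * s) powr (- \<beta>)) has_real_derivative
        - \<beta> * (c * T) * (1 + (c * T) * s) powr (- \<beta> - 1)) (at s)"
      using p by (auto intro!: derivative_eq_intros simp: powr_diff field_simps)
    have 2: "((\<lambda>s. y * s powr \<beta>) has_real_derivative y * (\<beta> * s powr (\<beta> - 1))) (at s)"
      using s by (auto intro!: derivative_eq_intros)
    show ?thesis unfolding v_def wd_def
      by (intro DERIV_add 1 DERIV_cmult DERIV_chain2[OF has_real_derivative_mittag_leffler 2] b)
  qed
  have Iv: "((\<lambda>s. (- \<beta> * (c * T) * (1 + (c * T) * s) powr (- \<beta> - 1)) * (1 - s) powr (- \<beta>)) has_integral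
     integral {0..1} (\<lambda>s. (- \<beta> * (c * T) * (1 + (c * T) * s) powr (- \<beta> - 1)) * (1 - s) powr (- \<beta>))) {0..1}"
    (is "(_ has_integral ?I) _")
    using c T0 b by (intro integrable_integral barrier_integral) auto
  have I: "((\<lambda>s. wd s * (1 - s) powr (- \<beta>)) has_integral ?I + \<sigma> * (Gamma (1 - \<beta>) * y * mittag_leffler \<beta> y)) {0..1}"
    using has_integral_add[OF Iv has_integral_mult_right[OF caputo_mittag_leffler[OF b, of y], of \<sigma>]]
    by (rule has_integral_eq[rotated]) (simp add: wd_def algebra_simps)
  have "?I + \<sigma> * (Gamma (1 - \<beta>) * y * mittag_leffler \<beta> y) \<le> v 1 - v 0"
  proof (rule extremum_principle[OF b _ _ _ deriv[of 1] _ I])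
    have "continuous_on {0..1} (\<lambda>s. w (T * s))"
      by (rule continuous_on_compose2[OF contw]) (use T0 in \<open>auto intro!: continuous_intros\<close>)
    thus "continuous_on {0..1} v" by (rule continuous_on_eq) (simp add: v)
    show "isCont wd s" if "s \<in> {0<..<1}" for s
    proof -
      have p: "1 + (c * T) * s > 0" using that c T0 by (auto intro: add_pos_pos)
      have "isCont (\<lambda>s. y * s powr \<beta>) s" using that by (intro continuous_intros) auto
      hence "isCont (\<lambda>s. mittag_leffler_deriv \<beta> (y * s powr \<beta>)) s"
        by (rule isCont_o2[OF _ continuous_mittag_leffler_deriv[OF b(1)]])
      thus ?thesis unfolding wd_def using p that by (intro continuous_intros) auto
    qed
    show "v 1 \<le> v s" if "s \<in> {0..1}" for s
    proof -
      have "T * s \<le> T" using mult_left_le[of s T] T0 that by simp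
      moreover have "T \<le> t" "0 \<le> T * s" using T(1) T0 that by auto
      ultimately have "T * s \<in> {0..t}" unfolding atLeastAtMost_iff by linarith
      from T(2)[OF this] show ?thesis using v[of 1] v[of s] that by simp
    qed
  qed (use deriv in auto)
  also have "v 1 - v 0 < 0" using v[of 1] v[of 0] wT w0 by simp
  finally have neg': "?I + \<sigma> * (Gamma (1 - \<beta>) * y * mittag_leffler \<beta> y) < 0" .
  have less: "\<sigma> * mittag_leffler \<beta> y < - ((1 + c * T) powr (- \<beta>))"
    using wT by (simp add: w_def y_def)
  have G1: "Gamma (1 - \<beta>) > 0" using b by simp
  have G2: "Gamma (2 - \<beta>) = (1 - \<beta>) * Gamma (1 - \<beta>)"
  proof -
    have "1 - \<beta> \<notin> \<int>\<^sub>\<le>\<^sub>0" using b nonpos_Ints_nonpos by force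
    thus ?thesis using Gamma_plus1[of "1 - \<beta>"] by (simp add: add.commute)
  qed
  \<comment> \<open>Here the value of \<open>c\<close> is explained: c^\<beta> = \<Gamma>(2 -
    \<beta>) = (1 - \<beta>) \<Gamma>(1 - \<beta>). It turns the lower bound of
    \<open>barrier_integral\<close> into -\<Gamma>(1 - \<beta>) T^\<beta> (1 + c T)^(-\<beta>), so
    the barrier is a supersolution of D^\<beta> u = -u. By \<open>less\<close>, the term with
    \<sigma> makes up for this amount, against \<open>neg'\<close>.\<close>
  have cT: "(c * T) powr \<beta> = Gamma (2 - \<beta>) * T powr \<beta>"
    using c T0 b G by (simp add: powr_mult c_def powr_powr)
  have pos: "1 + c * T > 0" using c T0 by (simp add: add_pos_pos)
  have "- (c * T) / ((1 + c * T) * (1 - \<beta>)) \<le> ?I"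
    using c T0 b by (intro barrier_integral) auto
  moreover have "Gamma (1 - \<beta>) * T powr \<beta> * (1 + c * T) powr (- \<beta>) \<le> \<sigma> * (Gamma (1 - \<beta>) * y * mittag_leffler \<beta> y)"
  proof -
    have "Gamma (1 - \<beta>) * T powr \<beta> * (1 + c * T) powr (- \<beta>) \<le> Gamma (1 - \<beta>) * T powr \<beta> * (- (\<sigma> * mittag_leffler \<beta> y))"
      using less G1 by (intro mult_left_mono) auto
    thus ?thesis by (simp add: y_def mult_ac)
  qed
  moreover have "(c * T) / ((1 + c * T) * (1 - \<beta>)) \<le> Gamma (1 - \<beta>) * T powr \<beta> * (1 + c * T) powr (- \<beta>)"
  proof -
    have "c * T = (c * T) powr \<beta> * (c * T) powr (1 - \<beta>)"
      using c T0 by (simp add: powr_add[symmetric])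
    also have "\<dots> \<le> (c * T) powr \<beta> * (1 + c * T) powr (1 - \<beta>)"
      using c T0 b by (intro mult_left_mono powr_mono2) auto
    also have "\<dots> = (1 - \<beta>) * (Gamma (1 - \<beta>) * T powr \<beta> * ((1 + c * T) * (1 + c * T) powr (- \<beta>)))"
      using pos powr_add[of "1 + c * T" 1 "- \<beta>"] by (simp add: cT G2)
    finally show ?thesis using pos b by (simp add: divide_simps mult_ac)
  qed
  ultimately show False using neg' by simp
qed

text \<open>For \<beta> < 1 put x = t^\<beta>; the barrier with both signs of \<sigma> gives
  |E_\<beta>(-x)| \<le> (1 + c t)^(-\<beta>). Both 1 and G x = (c t)^\<beta> are at most (1 + c
  t)^\<beta>, whence D = 2 max(1, 1/G). For \<beta> = 1 the function is the exponential.\<close>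

lemma mittag_leffler_bound:
  assumes "0 < \<beta>" "\<beta> \<le> 1"
  obtains D where "D > 0" "\<And>x. x \<ge> 0 \<Longrightarrow> \<bar>mittag_leffler \<beta> (- x)\<bar> \<le> D / (1 + x)"
proof (cases "\<beta> = 1")
  case True
  have "\<bar>mittag_leffler \<beta> (- x)\<bar> \<le> 1 / (1 + x)" if "x \<ge> 0" for x
    using that exp_ge_add_one_self[of x] unfolding True mittag_leffler_1
    by (simp add: exp_minus field_simps)
  thus ?thesis using that[of 1] by simp
next
  case False
  hence b: "0 < \<beta>" "\<beta> < 1" using assms by auto
  define G c where "G = Gamma (2 - \<beta>)" and "c = G powr (1 / \<beta>)"
  define D where "D = 2 * max 1 (1 / G)"
  have G: "G > 0" unfolding G_def using b by simp
  have c: "c > 0" using G by (simp add: c_def)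
  have "\<bar>mittag_leffler \<beta> (- x)\<bar> \<le> D / (1 + x)" if x: "x \<ge> 0" for x
  proof -
    define t where "t = x powr (1 / \<beta>)"
    have t: "t \<ge> 0" "t powr \<beta> = x" using b x by (auto simp: t_def powr_powr)
    have le: "\<bar>mittag_leffler \<beta> (- x)\<bar> \<le> (1 + c * t) powr (- \<beta>)"
      using mittag_leffler_barrier[OF b t(1), of 1] mittag_leffler_barrier[OF b t(1), of "-1"] t
      by (simp add: c_def G_def)
    have "(c * t) powr \<beta> = G * x" using G t c b by (simp add: powr_mult c_def powr_powr)
    moreover have "(c * t) powr \<beta> \<le> (1 + c * t) powr \<beta>" using c t b by (intro powr_mono2) auto
    moreover have "1 \<le> (1 + c * t) powr \<beta>" using c t b by (intro ge_one_powr_ge_zero) auto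
    moreover have "1 + x \<le> max 1 (1 / G) * 1 + max 1 (1 / G) * (G * x)"
    proof -
      have "1 / G * (G * x) \<le> max 1 (1 / G) * (G * x)" using G x by (intro mult_right_mono) auto
      thus ?thesis using G by simp
    qed
    moreover have "max 1 (1 / G) * 1 \<le> max 1 (1 / G) * (1 + c * t) powr \<beta>"
        "max 1 (1 / G) * (G * x) \<le> max 1 (1 / G) * (1 + c * t) powr \<beta>"
      using calculation by (intro mult_left_mono; simp)+
    ultimately have "1 + x \<le> D * (1 + c * t) powr \<beta>" unfolding D_def by linarith
    hence "(1 + c * t) powr (- \<beta>) \<le> D / (1 + x)"
      using x c t by (simp add: powr_minus divide_simps mult.commute add_nonneg_eq_0_iff)
    with le show ?thesis by simp
  qed
  thus ?thesis using that[of D] by (simp add: D_def)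
qed

section \<open>Weak convergence of centered Gaussian vectors\<close>

text \<open>The law is encoded by its characteristic function, which admits variance 0 and passes
  directly to mean-square limits.\<close>

definition centered_gaussian :: "'w measure \<Rightarrow> ('w \<Rightarrow> real) \<Rightarrow> real \<Rightarrow> bool" where
  "centered_gaussian M X v \<longleftrightarrow> X \<in> borel_measurable M \<and> 0 \<le> v \<and>
     (\<forall>t. char (distr M borel X) t = of_real (exp (- v * t\<^sup>2 / 2)))"

lemma (in prob_space) char_distr:
  assumes [measurable]: "X \<in> borel_measurable M"
  shows "char (distr M borel X) t = (\<integral>\<omega>. iexp (t * X \<omega>) \<partial>M)"
  unfolding char_def by (subst integral_distr) auto

lemma (in prob_space) gaussian_rv_imp_centered:
  assumes g: "gaussian_rv M X" and m: "expectation X = 0"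
  shows "integrable M (\<lambda>\<omega>. (X \<omega>)\<^sup>2)" "centered_gaussian M X (expectation (\<lambda>\<omega>. (X \<omega>)\<^sup>2))"
proof -
  let ?q = "\<lambda>\<omega>. (X \<omega>)\<^sup>2"
  have X[measurable]: "X \<in> borel_measurable M" using g by (simp add: gaussian_rv_def)
  from g consider (normal) m' s where "s > 0" "distributed M lborel X (normal_density m' s)"
    | (const) m' where "AE \<omega> in M. X \<omega> = m'"
    unfolding gaussian_rv_def by blast
  hence "integrable M ?q \<and> centered_gaussian M X (expectation ?q)"
  proof cases
    case normal
    have [simp]: "m' = 0" using normal_distributed_expectation[OF normal] m by simp
    have var: "expectation ?q = s\<^sup>2"
      using normal_distributed_variance[OF normal] m by simp
    \<comment> \<open>A nonintegrable function has integral 0 by convention, whereas this integral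
      is s^2 > 0.\<close>
    have int: "integrable M ?q"
      using var normal(1) not_integrable_integral_eq[of M "\<lambda>\<omega>. (X \<omega>)\<^sup>2"] by force
    have "distributed M lborel (\<lambda>x. (X x - 0) / s) std_normal_density"
      using normal by (subst normal_standard_normal_convert[symmetric]) auto
    hence d: "distr M borel (\<lambda>x. X x / s) = std_normal_distribution"
      by (simp add: distributed_def cong: distr_cong)
    have "char (distr M borel X) t = of_real (exp (- s\<^sup>2 * t\<^sup>2 / 2))" for t
    proof -
      have "char (distr M borel X) t = char (distr M borel (\<lambda>x. X x / s)) (s * t)"
        using normal(1) by (simp add: char_distr)
      also have "\<dots> = of_real (exp (- s\<^sup>2 * t\<^sup>2 / 2))"
        unfolding d char_std_normal_distribution by (simp add: power_mult_distrib)
      finally show ?thesis .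
    qed
    thus ?thesis using int var by (simp add: centered_gaussian_def)
  next
    case const
    have [simp]: "m' = 0"
      using m integral_cong_AE[of X M "\<lambda>_. m'"] const by (simp add: prob_space)
    have AE: "AE \<omega> in M. X \<omega> = 0" using const by simp
    have "AE \<omega> in M. (X \<omega>)\<^sup>2 = 0" using AE by eventually_elim simp
    hence 1: "integrable M ?q" "expectation ?q = 0"
      using integrable_cong_AE[of "\<lambda>\<omega>. (X \<omega>)\<^sup>2" M "\<lambda>_. 0"] integral_cong_AE[of "\<lambda>\<omega>. (X \<omega>)\<^sup>2" M "\<lambda>_. 0"] by auto
    have "(\<integral>\<omega>. iexp (t * X \<omega>) \<partial>M) = (\<integral>\<omega>. 1 \<partial>M)" for t
      by (rule integral_cong_AE) (use AE in \<open>auto elim!: eventually_mono\<close>)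
    thus ?thesis using 1 by (simp add: centered_gaussian_def char_distr prob_space)
  qed
  thus "integrable M ?q" "centered_gaussian M X (expectation ?q)" by auto
qed

lemma (in prob_space) centered_gaussian_imp_gaussian_rv:
  assumes c: "centered_gaussian M X v"
  shows "gaussian_rv M X"
proof -
  have X[measurable]: "X \<in> borel_measurable M" and v: "v \<ge> 0"
    and ch: "\<And>t. char (distr M borel X) t = of_real (exp (- v * t\<^sup>2 / 2))"
    using c by (auto simp: centered_gaussian_def)
  have rd: "real_distribution (distr M borel X)" by (rule real_distribution_distr) simp
  show ?thesis
  proof (cases "v = 0")
    case True
    have "real_distribution (return borel (0::real))"
      by (intro real_distribution.intro prob_space_return) (auto simp: real_distribution_axioms_def)
    moreover have "char (distr M borel X) = char (return borel 0)"
      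
    proof
      fix t
      have "char (return borel 0) t = 1" unfolding char_def by (subst integral_return) auto
      thus "char (distr M borel X) t = char (return borel 0) t" by (simp only: ch True) simp
    qed
    ultimately have d: "distr M borel X = return borel 0" using Levy_uniqueness rd by blast
    have "AE x in distr M borel X. x = 0" unfolding d by (subst AE_return) auto
    hence "AE \<omega> in M. X \<omega> = 0" by (subst (asm) AE_distr_iff) auto
    thus ?thesis by (auto simp: gaussian_rv_def)
  next
    case False
    define s where "s = sqrt v"
    have s: "s > 0" "v = s\<^sup>2" using False v by (auto simp: s_def)
    have rd': "real_distribution (distr M borel (\<lambda>\<omega>. X \<omega> / s))" by (rule real_distribution_distr) simp
    have "char (distr M borel (\<lambda>\<omega>. X \<omega> / s)) t = char std_normal_distribution t" for t
    proof -
      have "char (distr M borel (\<lambda>\<omega>. X \<omega> / s)) t = char (distr M borel X) (t / s)"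
        by (simp add: char_distr)
      also have "\<dots> = char std_normal_distribution t"
        unfolding ch char_std_normal_distribution using s by (simp add: power_divide)
      finally show ?thesis .
    qed
    hence d: "distr M borel (\<lambda>\<omega>. X \<omega> / s) = std_normal_distribution"
      by (intro Levy_uniqueness rd' real_dist_normal_dist ext)
    have "distributed M lborel (\<lambda>x. (X x - 0) / s) std_normal_density"
      unfolding distributed_def using d by (simp cong: distr_cong)
    hence "distributed M lborel X (normal_density 0 s)"
      using s by (subst normal_standard_normal_convert) auto
    thus ?thesis using s by (auto simp: gaussian_rv_def)
  qed
qed

lemma (in prob_space) centered_gaussian_cos:
  assumes c: "centered_gaussian M X v"
  shows "expectation (\<lambda>\<omega>. cos (X \<omega> + \<phi>)) = cos \<phi> * exp (- v / 2)"
proof -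
  have X[measurable]: "X \<in> borel_measurable M"
    and ch: "char (distr M borel X) 1 = of_real (exp (- v / 2))"
    using c by (auto simp: centered_gaussian_def)
  have int: "integrable M (\<lambda>\<omega>. iexp (1 * X \<omega>))"
    by (rule integrable_const_bound[of _ 1]) auto
  have "complex_of_real (cos \<phi> * exp (- v / 2)) = Re (iexp \<phi> * char (distr M borel X) 1)"
    unfolding ch by (simp add: Re_exp)
  also have "iexp \<phi> * char (distr M borel X) 1 = (\<integral>\<omega>. iexp \<phi> * iexp (1 * X \<omega>) \<partial>M)"
    using int by (simp add: char_distr)
  also have "Re \<dots> = (\<integral>\<omega>. Re (iexp \<phi> * iexp (1 * X \<omega>)) \<partial>M)"
    using int by (intro integral_Re[symmetric] integrable_mult_right)
  also have "(\<lambda>\<omega>. Re (iexp \<phi> * iexp (1 * X \<omega>))) = (\<lambda>\<omega>. cos (X \<omega> + \<phi>))"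
    by (auto simp: fun_eq_iff Re_exp Im_exp cos_add)
  finally show ?thesis by (simp only: of_real_eq_iff)
qed

section \<open>Trigonometric polynomials as test functions\<close>

text \<open>The phase \<phi> covers sines and \<theta> = 0 covers constants, so one generator
  suffices and products reduce to a single addition formula.\<close>

inductive trig_poly :: "('a::euclidean_space \<Rightarrow> real) \<Rightarrow> bool" where
  cos: "trig_poly (\<lambda>x. c * cos (\<theta> \<bullet> x + \<phi>))"
| add: "trig_poly p \<Longrightarrow> trig_poly q \<Longrightarrow> trig_poly (\<lambda>x. p x + q x)"

lemma trig_poly_mult:
  assumes "trig_poly p" "trig_poly q"
  shows "trig_poly (\<lambda>x. p x * q x)"
  using assms
proof (induction arbitrary: q)
  case (cos c \<theta> \<phi>)
  from cos.prems show ?case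
  proof induction
    case (cos c' \<theta>' \<phi>')
    have "(\<lambda>x. c * cos (\<theta> \<bullet> x + \<phi>) * (c' * cos (\<theta>' \<bullet> x + \<phi>'))) =
      (\<lambda>x. c * c' / 2 * cos ((\<theta> - \<theta>') \<bullet> x + (\<phi> - \<phi>')) + c * c' / 2 * cos ((\<theta> + \<theta>') \<bullet> x + (\<phi> + \<phi>')))"
    proof
      fix x
      have e: "(\<theta> - \<theta>') \<bullet> x + (\<phi> - \<phi>') = (\<theta> \<bullet> x + \<phi>) - (\<theta>' \<bullet> x + \<phi>')"
        "(\<theta> + \<theta>') \<bullet> x + (\<phi> + \<phi>') = (\<theta> \<bullet> x + \<phi>) + (\<theta>' \<bullet> x + \<phi>')"
        by (simp_all add: inner_left_distrib inner_diff_left)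
      show "c * cos (\<theta> \<bullet> x + \<phi>) * (c' * cos (\<theta>' \<bullet> x + \<phi>')) =
        c * c' / 2 * cos ((\<theta> - \<theta>') \<bullet> x + (\<phi> - \<phi>')) + c * c' / 2 * cos ((\<theta> + \<theta>') \<bullet> x + (\<phi> + \<phi>'))"
        unfolding e cos_add[of "\<theta> \<bullet> x + \<phi>"] cos_diff[of "\<theta> \<bullet> x + \<phi>"] by (simp add: field_simps)
    qed
    thus ?case by (simp only:) (intro trig_poly.intros)
  next
    case (add p q)
    thus ?case using trig_poly.add by (simp add: distrib_left)
  qed
next
  case (add p p')
  show ?case using trig_poly.add[OF add.IH(1)[OF add.prems] add.IH(2)[OF add.prems]]
    by (simp add: distrib_right)
qed

lemma trig_poly_const: "trig_poly (\<lambda>x. c)"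
  using trig_poly.cos[of c 0 0] by simp

lemma trig_poly_sum:
  "finite I \<Longrightarrow> (\<And>i. i \<in> I \<Longrightarrow> trig_poly (p i)) \<Longrightarrow> trig_poly (\<lambda>x. \<Sum>i\<in>I. p i x)"
  by (induction I rule: finite_induct) (auto intro: trig_poly_const trig_poly.add)

lemma trig_poly_continuous: "trig_poly p \<Longrightarrow> continuous_on UNIV p"
  by (induction rule: trig_poly.induct) (auto intro!: continuous_intros)

lemma trig_poly_bounded: "trig_poly p \<Longrightarrow> \<exists>B. \<forall>x. \<bar>p x\<bar> \<le> B"
proof (induction rule: trig_poly.induct)
  case (cos c \<theta> \<phi>)
  thus ?case by (intro exI[of _ "\<bar>c\<bar>"]) (auto simp: abs_mult intro!: mult_left_le)
next
  case (add p q)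
  then obtain A B where "\<forall>x. \<bar>p x\<bar> \<le> A" "\<forall>x. \<bar>q x\<bar> \<le> B" by blast
  thus ?case by (intro exI[of _ "A + B"]) (meson abs_triangle_ineq add_mono order_trans)
qed

lemma trig_poly_polynomial:
  fixes p :: "'a::euclidean_space \<Rightarrow> real" and \<psi> :: "'b::euclidean_space \<Rightarrow> 'a"
  assumes "real_polynomial_function p" and \<psi>: "\<And>b. b \<in> Basis \<Longrightarrow> trig_poly (\<lambda>x. \<psi> x \<bullet> b)"
  shows "trig_poly (\<lambda>x. p (\<psi> x))"
  using assms(1)
proof induction
  case (linear f)
  have "f (\<psi> x) = (\<Sum>b\<in>Basis. (\<psi> x \<bullet> b) * f b)" for x
  proof -
    interpret bounded_linear f by fact
    have "f (\<Sum>b\<in>Basis. (\<psi> x \<bullet> b) *\<^sub>R b) = (\<Sum>b\<in>Basis. (\<psi> x \<bullet> b) * f b)"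
      unfolding sum by (simp add: scaleR)
    thus ?thesis by (simp add: euclidean_representation)
  qed
  thus ?case by (simp only:) (intro trig_poly_sum trig_poly_mult \<psi> trig_poly_const, auto)
qed (auto intro: trig_poly_const trig_poly.add trig_poly_mult)

text \<open>The sine substitution turns polynomial approximation on a cube into approximation by
  trigonometric polynomials that stay bounded on the whole space.\<close>

lemma trig_poly_approx:
  fixes g :: "real ^ 'm::finite \<Rightarrow> real"
  assumes cont: "continuous_on UNIV g" and B: "\<And>x. \<bar>g x\<bar> \<le> B" and "e > 0" "R > 0"
  obtains P where "trig_poly P" "\<And>x. \<bar>P x\<bar> \<le> B + e" "\<And>x. (\<And>i. \<bar>x $ i\<bar> \<le> R) \<Longrightarrow> \<bar>P x - g x\<bar> \<le> e"
proof -
  define Q where "Q = cbox (- 1 :: real ^ 'm) 1"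
  \<comment> \<open>The values of \<open>h\<close> are values of \<open>g\<close>, hence bounded by
    B. A polynomial close to \<open>h\<close> on the cube, evaluated at sin(x_i / R), is therefore
    bounded by B + e at every x, while arcsin undoes sin only for |x_i| \<le> R, where |x_i / R|
    \<le> 1 \<le> pi / 2.\<close>
  define h where "h = (\<lambda>s :: real ^ 'm. g (\<chi> i. R * arcsin (s $ i)))"
  have Q: "s \<in> Q \<longleftrightarrow> (\<forall>i. \<bar>s $ i\<bar> \<le> 1)" for s
    by (auto simp: Q_def mem_box_cart abs_le_iff)
  have "continuous_on Q (\<lambda>s. \<chi> i. R * arcsin (s $ i))"
    by (intro continuous_intros) (auto simp: Q abs_le_iff)
  hence "continuous_on Q h" unfolding h_def
    by (rule continuous_on_compose2[OF cont]) auto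
  moreover have "compact Q" unfolding Q_def by simp
  ultimately obtain p where p: "real_polynomial_function p" "\<And>s. s \<in> Q \<Longrightarrow> \<bar>h s - p s\<bar> < e"
    using Stone_Weierstrass_real_polynomial_function[of Q h e] \<open>e > 0\<close> by blast
  define \<psi> where "\<psi> = (\<lambda>x :: real ^ 'm. (\<chi> i. sin (x $ i / R)) :: real ^ 'm)"
  have \<psi>Q: "\<psi> x \<in> Q" for x by (auto simp: \<psi>_def Q)
  have "trig_poly (\<lambda>x. \<psi> x \<bullet> b)" if b: "b \<in> Basis" for b
  proof -
    obtain i where i: "b = axis i 1" using b by (auto simp: Basis_vec_def)
    have "\<psi> x \<bullet> b = 1 * cos ((1 / R) *\<^sub>R axis i 1 \<bullet> x + (- pi / 2))" for x
      by (simp add: \<psi>_def i inner_axis inner_commute[of "axis i 1"] cos_diff minus_divide_left[symmetric] sin_cos_eq[symmetric])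
    thus ?thesis by (simp only:) (rule trig_poly.cos)
  qed
  hence tp: "trig_poly (\<lambda>x. p (\<psi> x))" by (rule trig_poly_polynomial[OF p(1)])
  show ?thesis
  proof (rule that[OF tp])
    fix x :: "real ^ 'm"
    show "\<bar>p (\<psi> x)\<bar> \<le> B + e"
      using p(2)[OF \<psi>Q, of x] B[of "\<chi> i. R * arcsin (\<psi> x $ i)"] unfolding h_def by linarith
    assume x: "\<And>i. \<bar>x $ i\<bar> \<le> R"
    have "\<bar>x $ i / R\<bar> \<le> pi / 2" for i
    proof -
      have "\<bar>x $ i / R\<bar> \<le> 1" using x[of i] \<open>R > 0\<close> by (simp add: abs_divide)
      also have "1 \<le> pi / 2" using pi_gt3 by simp
      finally show ?thesis .
    qed
    hence "arcsin (sin (x $ i / R)) = x $ i / R" for i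
      by (intro arcsin_sin) (smt (verit))+
    hence "R * arcsin (\<psi> x $ i) = x $ i" for i
      using \<open>R > 0\<close> by (simp add: \<psi>_def)
    hence "h (\<psi> x) = g x" unfolding h_def by simp
    thus "\<bar>p (\<psi> x) - g x\<bar> \<le> e" using p(2)[OF \<psi>Q, of x] by simp
  qed
qed

text \<open>For a trigonometric polynomial the expectation is an explicit continuous function of the
  variances v i \<theta>. A bounded continuous g is replaced by such a polynomial on a large cube,
  and Chebyshev's inequality bounds the error outside it uniformly along the filter. The hypothesis
  on \<open>Y\<close> is only eventual because rescaled fields are Gaussian for positive scaling
  parameters.\<close>

lemma (in prob_space) gaussian_weak_convergence:
  fixes Y :: "'i \<Rightarrow> 'a \<Rightarrow> real ^ 'm::finite" and Y\<^sub>0 :: "'a \<Rightarrow> real ^ 'm"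
  assumes Y: "\<forall>\<^sub>F i in F. Y i \<in> borel_measurable M \<and> (\<forall>\<theta>. centered_gaussian M (\<lambda>\<omega>. \<theta> \<bullet> Y i \<omega>) (v i \<theta>) \<and>
        integrable M (\<lambda>\<omega>. (\<theta> \<bullet> Y i \<omega>)\<^sup>2) \<and> expectation (\<lambda>\<omega>. (\<theta> \<bullet> Y i \<omega>)\<^sup>2) = v i \<theta>)"
    and Y0: "Y\<^sub>0 \<in> borel_measurable M" "\<And>\<theta>. centered_gaussian M (\<lambda>\<omega>. \<theta> \<bullet> Y\<^sub>0 \<omega>) (v\<^sub>0 \<theta>)"
        "\<And>\<theta>. integrable M (\<lambda>\<omega>. (\<theta> \<bullet> Y\<^sub>0 \<omega>)\<^sup>2)" "\<And>\<theta>. expectation (\<lambda>\<omega>. (\<theta> \<bullet> Y\<^sub>0 \<omega>)\<^sup>2) = v\<^sub>0 \<theta>"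
    and lim: "\<And>\<theta>. ((\<lambda>i. v i \<theta>) \<longlongrightarrow> v\<^sub>0 \<theta>) F"
  shows "weakly_converges (\<lambda>i. distr M borel (Y i)) (distr M borel Y\<^sub>0) F"
  unfolding weakly_converges_def
proof (intro allI impI, elim conjE)
  fix g :: "real ^ 'm \<Rightarrow> real" assume cont: "continuous_on UNIV g" and "bounded (range g)"
  then obtain B' where B': "\<And>x. \<bar>g x\<bar> \<le> B'" unfolding bounded_iff by auto
  let ?S = "\<lambda>Z \<omega>. \<Sum>k\<in>UNIV. (axis k 1 \<bullet> (Z \<omega> :: real ^ 'm))\<^sup>2"
    and ?d = "\<lambda>P Z \<omega>. \<bar>P (Z \<omega>) - g (Z \<omega> :: real ^ 'm) :: real\<bar>"
  define B where "B = max B' 0"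
  have B: "\<bar>g x\<bar> \<le> B" "B \<ge> 0" for x using B'[of x] by (auto simp: B_def)
  have g[measurable]: "g \<in> borel_measurable borel" using cont by (rule borel_measurable_continuous_onI)
  \<comment> \<open>The added 1 leaves room: the sums of coordinate variances of \<open>Y i\<close>
    are eventually below V.\<close>
  define V where "V = (\<Sum>k\<in>UNIV. v\<^sub>0 (axis k 1)) + 1"
  have v0: "v\<^sub>0 \<theta> \<ge> 0" for \<theta> using Y0(2)[of \<theta>] by (simp add: centered_gaussian_def)
  have V: "V > 0" unfolding V_def using v0 by (intro add_nonneg_pos sum_nonneg) auto
  have "((\<lambda>i. expectation (\<lambda>\<omega>. g (Y i \<omega>))) \<longlongrightarrow> expectation (\<lambda>\<omega>. g (Y\<^sub>0 \<omega>))) F"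
  proof (rule tendstoI)
    fix e :: real assume e: "e > 0"
    \<comment> \<open>The replacement of g by P costs 2 d for \<open>Y i\<close> and 2 d for the
      limit, the convergence for P costs d; together 5 d < e.\<close>
    define d where "d = e / 8"
    have d: "d > 0" using e by (simp add: d_def)
    \<comment> \<open>Outside the cube the error is at most 2 B + d \<le> (2 B + d) S / R^2, with S
      the sum of squared coordinates; this R makes (2 B + d) V / R^2 equal to d.\<close>
    define R where "R = sqrt (V * (2 * B + d) / d)"
    let ?C = "(2 * B + d) / R\<^sup>2"
    have R: "R > 0" "R\<^sup>2 = V * (2 * B + d) / d" unfolding R_def using V d B by auto
    obtain P where P: "trig_poly P" "\<And>x. \<bar>P x\<bar> \<le> B + d" "\<And>x. (\<And>i. \<bar>x $ i\<bar> \<le> R) \<Longrightarrow> \<bar>P x - g x\<bar> \<le> d"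
      using trig_poly_approx[OF cont B(1) d R(1)] by blast
    have [measurable]: "P \<in> borel_measurable borel"
      using trig_poly_continuous[OF P(1)] by (rule borel_measurable_continuous_onI)
    have close: "\<bar>expectation (\<lambda>\<omega>. P (Z \<omega>)) - expectation (\<lambda>\<omega>. g (Z \<omega>))\<bar> \<le> 2 * d"
      if Z[measurable]: "Z \<in> borel_measurable M" and Z2: "\<And>k. integrable M (\<lambda>\<omega>. (axis k 1 \<bullet> Z \<omega>)\<^sup>2)"
        and le: "(\<Sum>k\<in>UNIV. expectation (\<lambda>\<omega>. (axis k 1 \<bullet> Z \<omega>)\<^sup>2)) \<le> V" for Z :: "'a \<Rightarrow> real ^ 'm"
    proof -
      have iP: "integrable M (\<lambda>\<omega>. P (Z \<omega>))"
        by (rule integrable_const_bound[of _ "B + d"]) (use P(2) in auto)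
      have ig: "integrable M (\<lambda>\<omega>. g (Z \<omega>))"
        by (rule integrable_const_bound[of _ B]) (use B in auto)
      have iS: "integrable M (\<lambda>\<omega>. d + ?C * ?S Z \<omega>)"
        by (intro Bochner_Integration.integrable_add integrable_mult_right Bochner_Integration.integrable_sum Z2) simp
      have "\<bar>expectation (\<lambda>\<omega>. P (Z \<omega>)) - expectation (\<lambda>\<omega>. g (Z \<omega>))\<bar> =
          \<bar>expectation (\<lambda>\<omega>. P (Z \<omega>) - g (Z \<omega>))\<bar>" using iP ig by simp
      also have "\<dots> \<le> expectation (\<lambda>\<omega>. ?d P Z \<omega>)"
        using integral_norm_bound[of M "\<lambda>\<omega>. P (Z \<omega>) - g (Z \<omega>)"] by simp
      also have "\<dots> \<le> expectation (\<lambda>\<omega>. d + ?C * ?S Z \<omega>)"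
      proof (rule integral_mono)
        fix \<omega>
        define S where "S = ?S Z \<omega>"
        have S0: "S \<ge> 0" by (simp add: S_def sum_nonneg)
        show "?d P Z \<omega> \<le> d + ?C * ?S Z \<omega>"
          unfolding S_def[symmetric]
        proof (cases "\<forall>i. \<bar>Z \<omega> $ i\<bar> \<le> R")
          case True
          hence "?d P Z \<omega> \<le> d" by (intro P(3)) auto
          moreover have "?C * S \<ge> 0" using B d S0 by auto
          ultimately show "?d P Z \<omega> \<le> d + ?C * S" by linarith
        next
          case False
          then obtain k where k: "\<bar>Z \<omega> $ k\<bar> > R" by (auto simp: not_le)
          have "R\<^sup>2 \<le> (Z \<omega> $ k)\<^sup>2" using k R(1) by (simp add: abs_le_square_iff[symmetric])
          also have "\<dots> = (axis k 1 \<bullet> Z \<omega>)\<^sup>2" by (simp add: inner_axis inner_commute[of "axis k 1"])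
          also have "\<dots> \<le> S" unfolding S_def by (rule member_le_sum) auto
          finally have "?C * R\<^sup>2 \<le> ?C * S"
            using B d by (intro mult_left_mono) auto
          moreover have "?C * R\<^sup>2 = 2 * B + d" using R(1) by simp
          moreover define X where "X = ?C * S"
          ultimately have "2 * B + d \<le> X" by simp
          thus "?d P Z \<omega> \<le> d + ?C * S"
            unfolding X_def[symmetric] using P(2)[of "Z \<omega>"] B(1)[of "Z \<omega>"] d by linarith
        qed
      qed (use iP ig iS in auto)
      also have "\<dots> = d + ?C * (\<Sum>k\<in>UNIV. expectation (\<lambda>\<omega>. (axis k 1 \<bullet> Z \<omega>)\<^sup>2))"
        using Z2 by (simp add: prob_space integrable_sum)
      also have "\<dots> \<le> d + ?C * V"
        using le B d by (intro add_left_mono mult_left_mono) auto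
      also have "?C * V = d"
      proof -
        have "K / (V * K / d) * V = d" if "K > 0" for K using that V d by (simp add: field_simps)
        thus ?thesis unfolding R(2) using B(2) d by simp
      qed
      finally show ?thesis by simp
    qed
    have close0: "\<bar>expectation (\<lambda>\<omega>. P (Y\<^sub>0 \<omega>)) - expectation (\<lambda>\<omega>. g (Y\<^sub>0 \<omega>))\<bar> \<le> 2 * d"
      by (rule close) (use Y0 in \<open>auto simp: V_def\<close>)
    have "((\<lambda>i. \<Sum>k\<in>UNIV. v i (axis k 1)) \<longlongrightarrow> (\<Sum>k\<in>UNIV. v\<^sub>0 (axis k 1))) F"
      by (intro tendsto_sum lim)
    hence evV: "\<forall>\<^sub>F i in F. (\<Sum>k\<in>UNIV. v i (axis k 1)) < V"
      by (rule order_tendstoD) (simp add: V_def)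
    have "((\<lambda>i. expectation (\<lambda>\<omega>. P (Y i \<omega>))) \<longlongrightarrow> expectation (\<lambda>\<omega>. P (Y\<^sub>0 \<omega>))) F"
      using P(1)
    proof induction
      case (cos c \<theta> \<phi>)
      have L: "((\<lambda>i. c * (cos \<phi> * exp (- v i \<theta> / 2))) \<longlongrightarrow> c * (cos \<phi> * exp (- v\<^sub>0 \<theta> / 2))) F"
        by (intro tendsto_intros lim) auto
      have E: "\<forall>\<^sub>F i in F. c * (cos \<phi> * exp (- v i \<theta> / 2)) = expectation (\<lambda>\<omega>. c * cos (\<theta> \<bullet> Y i \<omega> + \<phi>))"
        using Y
      proof eventually_elim
        case (elim i)
        hence "centered_gaussian M (\<lambda>\<omega>. \<theta> \<bullet> Y i \<omega>) (v i \<theta>)" by blast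
        from centered_gaussian_cos[OF this, of \<phi>] show ?case by simp
      qed
      have e0: "c * (cos \<phi> * exp (- v\<^sub>0 \<theta> / 2)) = expectation (\<lambda>\<omega>. c * cos (\<theta> \<bullet> Y\<^sub>0 \<omega> + \<phi>))"
        using centered_gaussian_cos[OF Y0(2), of \<theta> \<phi>] by simp
      show ?case using Lim_transform_eventually[OF L E] unfolding e0 .
    next
      case (add p q)
      have int: "integrable M (\<lambda>\<omega>. r (Z \<omega>))" if r: "trig_poly r" and [measurable]: "Z \<in> borel_measurable M"
        for r and Z :: "'a \<Rightarrow> real ^ 'm"
      proof -
        have [measurable]: "r \<in> borel_measurable borel"
          using trig_poly_continuous[OF r] by (rule borel_measurable_continuous_onI)
        obtain K where "\<And>x. \<bar>r x\<bar> \<le> K" using trig_poly_bounded[OF r] by blast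
        thus ?thesis by (intro integrable_const_bound[of _ K]) auto
      qed
      have "((\<lambda>i. expectation (\<lambda>\<omega>. p (Y i \<omega>)) + expectation (\<lambda>\<omega>. q (Y i \<omega>))) \<longlongrightarrow>
          expectation (\<lambda>\<omega>. p (Y\<^sub>0 \<omega>)) + expectation (\<lambda>\<omega>. q (Y\<^sub>0 \<omega>))) F"
        by (intro tendsto_intros add.IH)
      moreover have "\<forall>\<^sub>F i in F. expectation (\<lambda>\<omega>. p (Y i \<omega>)) + expectation (\<lambda>\<omega>. q (Y i \<omega>)) =
          expectation (\<lambda>\<omega>. p (Y i \<omega>) + q (Y i \<omega>))"
        using Y by eventually_elim (simp add: int add.hyps)
      ultimately show ?case using int[OF add.hyps(1) Y0(1)] int[OF add.hyps(2) Y0(1)]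
        by (simp add: tendsto_cong)
    qed
    hence "\<forall>\<^sub>F i in F. dist (expectation (\<lambda>\<omega>. P (Y i \<omega>))) (expectation (\<lambda>\<omega>. P (Y\<^sub>0 \<omega>))) < d"
      using d by (rule tendstoD)
    thus "\<forall>\<^sub>F i in F. dist (expectation (\<lambda>\<omega>. g (Y i \<omega>))) (expectation (\<lambda>\<omega>. g (Y\<^sub>0 \<omega>))) < e"
      using Y evV
    proof eventually_elim
      case (elim i)
      have "\<bar>expectation (\<lambda>\<omega>. P (Y i \<omega>)) - expectation (\<lambda>\<omega>. g (Y i \<omega>))\<bar> \<le> 2 * d"
        by (rule close) (use elim in auto)
      thus ?case using elim(1) close0 d unfolding dist_real_def d_def by linarith
    qed
  qed
  moreover have "\<forall>\<^sub>F i in F. expectation (\<lambda>\<omega>. g (Y i \<omega>)) = integral\<^sup>L (distr M borel (Y i)) g"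
    using Y by eventually_elim (simp add: integral_distr)
  moreover have "expectation (\<lambda>\<omega>. g (Y\<^sub>0 \<omega>)) = integral\<^sup>L (distr M borel Y\<^sub>0) g"
    using Y0(1) by (simp add: integral_distr)
  ultimately show "((\<lambda>i. integral\<^sup>L (distr M borel (Y i)) g) \<longlongrightarrow> integral\<^sup>L (distr M borel Y\<^sub>0) g) F"
    by (simp add: tendsto_cong)
qed

section \<open>White noise integrals\<close>

lemma cmod_sq_add_le: "(cmod (x + y))\<^sup>2 \<le> 2 * (cmod x)\<^sup>2 + 2 * (cmod y)\<^sup>2"
proof -
  have "(cmod (x + y))\<^sup>2 \<le> (cmod x + cmod y)\<^sup>2"
    by (intro power_mono norm_triangle_ineq) simp
  also have "\<dots> \<le> 2 * (cmod x)\<^sup>2 + 2 * (cmod y)\<^sup>2"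
    using sum_squares_ge_zero[of "cmod x - cmod y" 0] by (simp add: power2_eq_square algebra_simps)
  finally show ?thesis .
qed

lemma integrable_cmod_sq_iff:
  assumes [measurable]: "f \<in> borel_measurable M"
  shows "integrable M (\<lambda>x. (cmod (f x))\<^sup>2) \<longleftrightarrow> (\<integral>\<^sup>+x. ennreal ((cmod (f x))\<^sup>2) \<partial>M) < \<infinity>"
  by (simp add: integrable_iff_bounded)

text \<open>The limit is expressed by extended integrals because \<open>a\<close> is not known to be
  square integrable; one finite term of the sequence already yields this. Norms converge by | |b|^2
  - |a|^2 | \<le> (1 + 1/\<delta>) |a - b|^2 + \<delta> |a|^2.\<close>

lemma L2_limit:
  fixes a :: "'a \<Rightarrow> complex" and b :: "nat \<Rightarrow> 'a \<Rightarrow> complex"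
  assumes a[measurable]: "a \<in> borel_measurable M"
    and b[measurable]: "\<And>n. b n \<in> borel_measurable M"
    and int: "\<And>n. integrable M (\<lambda>x. (cmod (b n x))\<^sup>2)"
    and lim: "(\<lambda>n. \<integral>\<^sup>+x. ennreal ((cmod (a x - b n x))\<^sup>2) \<partial>M) \<longlonglongrightarrow> 0"
  shows "integrable M (\<lambda>x. (cmod (a x))\<^sup>2)"
    and "\<forall>\<^sub>F n in sequentially. integrable M (\<lambda>x. (cmod (a x - b n x))\<^sup>2)"
    and "(\<lambda>n. \<integral>x. (cmod (a x - b n x))\<^sup>2 \<partial>M) \<longlonglongrightarrow> 0"
    and "(\<lambda>n. \<integral>x. (cmod (b n x))\<^sup>2 \<partial>M) \<longlonglongrightarrow> (\<integral>x. (cmod (a x))\<^sup>2 \<partial>M)"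
proof -
  let ?e = "\<lambda>n x. (cmod (a x - b n x))\<^sup>2" and ?b = "\<lambda>n x. (cmod (b n x))\<^sup>2" and ?a = "\<lambda>x. (cmod (a x))\<^sup>2"
  show ev: "\<forall>\<^sub>F n in sequentially. integrable M (\<lambda>x. ?e n x)"
    using order_tendstoD(2)[OF lim, of \<infinity>]
    by (simp add: integrable_cmod_sq_iff)
  then obtain N where N: "integrable M (\<lambda>x. ?e N x)"
    by (auto simp: eventually_sequentially)
  show inta: "integrable M (\<lambda>x. ?a x)"
  proof (rule Bochner_Integration.integrable_bound)
    show "integrable M (\<lambda>x. 2 * ?e N x + 2 * ?b N x)"
      using N int by auto
    show "AE x in M. norm (?a x) \<le> norm (2 * ?e N x + 2 * ?b N x)"
      using cmod_sq_add_le[of "a x - b N x" "b N x" for x] by (intro AE_I2) simp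
  qed auto
  show d: "(\<lambda>n. \<integral>x. ?e n x \<partial>M) \<longlonglongrightarrow> 0"
  proof -
    have "(\<lambda>n. enn2real (\<integral>\<^sup>+x. ennreal (?e n x) \<partial>M)) \<longlonglongrightarrow> 0"
      by (rule tendsto_enn2real) (use lim in simp_all)
    thus ?thesis by (simp add: integral_eq_nn_integral)
  qed
  define I where "I = (\<integral>x. ?a x \<partial>M)"
  have I: "I \<ge> 0" by (simp add: I_def)
  show "(\<lambda>n. \<integral>x. ?b n x \<partial>M) \<longlonglongrightarrow> I"
  proof (rule tendstoI)
    fix e :: real assume e: "e > 0"
    \<comment> \<open>Makes \<delta> I < e/2; the 1 keeps the denominator positive when I =
      0.\<close>
    define \<delta> where "\<delta> = e / (2 * (I + 1))"
    have \<delta>: "\<delta> > 0" "\<delta> * I < e / 2" using e I by (auto simp: \<delta>_def field_simps)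
    have "(\<lambda>n. (1 + 1 / \<delta>) * (\<integral>x. ?e n x \<partial>M)) \<longlonglongrightarrow> (1 + 1 / \<delta>) * 0"
      by (intro tendsto_intros d)
    hence "\<forall>\<^sub>F n in sequentially. (1 + 1 / \<delta>) * (\<integral>x. ?e n x \<partial>M) < e / 2"
      using e by (intro order_tendstoD(2)) auto
    thus "\<forall>\<^sub>F n in sequentially. dist (\<integral>x. ?b n x \<partial>M) I < e"
      using ev
    proof eventually_elim
      case (elim n)
      have "\<bar>(\<integral>x. ?b n x \<partial>M) - I\<bar> = \<bar>\<integral>x. ?b n x - ?a x \<partial>M\<bar>"
        unfolding I_def using int inta by simp
      also have "\<dots> \<le> (\<integral>x. \<bar>?b n x - ?a x\<bar> \<partial>M)"
        using integral_norm_bound[of M "\<lambda>x. ?b n x - ?a x"] by simp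
      also have "\<dots> \<le> (\<integral>x. (1 + 1 / \<delta>) * ?e n x + \<delta> * ?a x \<partial>M)"
      proof (rule integral_mono)
        fix x
        define p q r where "p = cmod (a x)" and "q = cmod (b n x)" and "r = cmod (a x - b n x)"
        have pqr: "\<bar>q - p\<bar> \<le> r" "p \<ge> 0" "q \<ge> 0" "r \<ge> 0"
          using norm_triangle_ineq3[of "b n x" "a x"] by (auto simp: p_def q_def r_def norm_minus_commute)
        have "\<bar>q\<^sup>2 - p\<^sup>2\<bar> = \<bar>q - p\<bar> * (q + p)"
          using pqr by (simp add: power2_eq_square square_diff_square_factored abs_mult)
        also have "\<dots> \<le> r * (r + 2 * p)" using pqr by (intro mult_mono) auto
        also have "\<dots> = r\<^sup>2 + 2 * (r * p)" by (simp add: power2_eq_square algebra_simps)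
        also have "2 * (r * p) \<le> r\<^sup>2 / \<delta> + \<delta> * p\<^sup>2"
        proof -
          have "0 \<le> (r - \<delta> * p)\<^sup>2 / \<delta>" using \<delta> by simp
          also have "\<dots> = r\<^sup>2 / \<delta> + \<delta> * p\<^sup>2 - 2 * (r * p)"
            using \<delta> by (simp add: power2_eq_square field_simps)
          finally show ?thesis by simp
        qed
        finally show "\<bar>q\<^sup>2 - p\<^sup>2\<bar> \<le> (1 + 1 / \<delta>) * r\<^sup>2 + \<delta> * p\<^sup>2"
          by (simp add: algebra_simps)
      qed (use int inta elim in auto)
      also have "\<dots> = (1 + 1 / \<delta>) * (\<integral>x. ?e n x \<partial>M) + \<delta> * I"
        unfolding I_def using inta elim by simp
      finally show ?case unfolding dist_real_def using elim(1) \<delta>(2) by linarith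
    qed
  qed
qed

text \<open>Riesz-Fischer with a rate. A subsequence with a (r k) < 4^(-k) has increments with
  summable means and so converges almost surely. Splitting the Cauchy bound as a m + a n lets
  Fatou's lemma, applied along the subsequence in m, leave exactly a n.\<close>

lemma (in prob_space) L2_complete:
  fixes Z :: "nat \<Rightarrow> 'a \<Rightarrow> real"
  assumes Z[measurable]: "\<And>n. Z n \<in> borel_measurable M"
    and a: "a \<longlonglongrightarrow> (0::real)" "\<And>n. a n \<ge> 0"
    and le: "\<And>m n. (\<integral>\<^sup>+\<omega>. ennreal ((Z m \<omega> - Z n \<omega>)\<^sup>2) \<partial>M) \<le> ennreal (a m + a n)"
  obtains X where "X \<in> borel_measurable M"
    "\<And>n. (\<integral>\<^sup>+\<omega>. ennreal ((X \<omega> - Z n \<omega>)\<^sup>2) \<partial>M) \<le> ennreal (a n)"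
proof -
  have "\<exists>n. a n < (1/4) ^ k" for k
    using order_tendstoD(2)[OF a(1), of "(1/4)^k"] by (auto simp: eventually_sequentially)
  then obtain r where r: "\<And>k. a (r k) < (1/4) ^ k" by metis
  define X where "X = (\<lambda>\<omega>. lim (\<lambda>k. Z (r k) \<omega>))"
  let ?z = "\<lambda>k \<omega>. Z (r (Suc k)) \<omega> - Z (r k) \<omega>" and ?E = "\<lambda>n. \<integral>\<^sup>+\<omega>. ennreal ((X \<omega> - Z n \<omega>)\<^sup>2) \<partial>M"
    and ?f = "\<lambda>k n \<omega>. ennreal ((Z (r k) \<omega> - Z n \<omega>)\<^sup>2)"
  have X[measurable]: "X \<in> borel_measurable M" unfolding X_def by measurable
  have diff: "(\<integral>\<^sup>+\<omega>. ennreal \<bar>?z k \<omega>\<bar> \<partial>M) \<le> ennreal (3 * (1/2) ^ k)" for k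
  proof -
    have "(\<integral>\<^sup>+\<omega>. ennreal \<bar>?z k \<omega>\<bar> \<partial>M) \<le>
        (\<integral>\<^sup>+\<omega>. ennreal ((1/2)^k) + ennreal (2 ^ k) * ennreal ((?z k \<omega>)\<^sup>2) \<partial>M)"
    proof (rule nn_integral_mono)
      fix \<omega>
      \<comment> \<open>The inequality y \<le> 2^(-k) + 2^k y^2 trades the first moment for the
        second; as E y^2 \<le> 2 * 4^(-k), the mean of y is at most 3 * 2^(-k).\<close>
      define y where "y = \<bar>?z k \<omega>\<bar>"
      have "y \<le> (1/2)^k + 2 ^ k * y\<^sup>2"
      proof (cases "y \<le> (1/2)^k")
        case True
        thus ?thesis by (simp add: add_increasing2)
      next
        case False
        hence "2 ^ k * y \<ge> 1" by (simp add: power_divide field_simps)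
        hence "y * 1 \<le> y * (2 ^ k * y)" by (intro mult_left_mono) (auto simp: y_def)
        thus ?thesis by (simp add: power2_eq_square mult_ac add_increasing)
      qed
      moreover have "y\<^sup>2 = (?z k \<omega>)\<^sup>2" by (simp add: y_def)
      ultimately show "ennreal \<bar>?z k \<omega>\<bar> \<le>
          ennreal ((1/2)^k) + ennreal (2 ^ k) * ennreal ((?z k \<omega>)\<^sup>2)"
        by (simp add: y_def[symmetric] ennreal_mult'[symmetric] ennreal_plus[symmetric] del: ennreal_plus)
    qed
    also have "\<dots> = ennreal ((1/2)^k) + ennreal (2 ^ k) * (\<integral>\<^sup>+\<omega>. ennreal ((?z k \<omega>)\<^sup>2) \<partial>M)"
      by (simp add: nn_integral_add nn_integral_cmult emeasure_space_1)
    also have "\<dots> \<le> ennreal ((1/2)^k) + ennreal (2 ^ k) * ennreal (2 * (1/4)^k)"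
    proof (intro add_left_mono mult_left_mono order_trans[OF le] ennreal_leI)
      have "(1/4::real) ^ Suc k \<le> (1/4)^k" by simp
      thus "a (r (Suc k)) + a (r k) \<le> 2 * (1/4)^k" using r[of k] r[of "Suc k"] by linarith
    qed auto
    also have "\<dots> = ennreal ((1/2)^k + 2 ^ k * (2 * (1/4)^k))"
      by (simp add: ennreal_mult'[symmetric] ennreal_plus[symmetric] del: ennreal_plus)
    also have "(1/2::real)^k + 2 ^ k * (2 * (1/4)^k) = 3 * (1/2)^k"
    proof -
      have "(2::real) ^ k * (1/4)^k = (1/2)^k" by (simp add: power_mult_distrib[symmetric])
      thus ?thesis by (simp add: mult.left_commute)
    qed
    finally show ?thesis .
  qed
  have "(\<integral>\<^sup>+\<omega>. (\<Sum>k. ennreal \<bar>?z k \<omega>\<bar>) \<partial>M) =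
      (\<Sum>k. \<integral>\<^sup>+\<omega>. ennreal \<bar>?z k \<omega>\<bar> \<partial>M)"
    by (rule nn_integral_suminf) simp
  also have "\<dots> \<le> (\<Sum>k. ennreal (3 * (1/2) ^ k))" by (intro suminf_le diff) auto
  also have "\<dots> < \<infinity>"
    by (subst suminf_ennreal2) (auto intro!: summable_mult summable_geometric)
  finally have "AE \<omega> in M. (\<Sum>k. ennreal \<bar>?z k \<omega>\<bar>) \<noteq> \<infinity>"
    by (intro nn_integral_PInf_AE) auto
  hence conv: "AE \<omega> in M. (\<lambda>k. Z (r k) \<omega>) \<longlonglongrightarrow> X \<omega>"
  proof eventually_elim
    case (elim \<omega>)
    have "summable (\<lambda>k. \<bar>?z k \<omega>\<bar>)"
      using elim by (intro summable_suminf_not_top) auto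
    hence "summable (\<lambda>k. Z (r (Suc k)) \<omega> - Z (r k) \<omega>)" by (rule summable_rabs_cancel)
    hence "convergent (\<lambda>n. Z (r n) \<omega> - Z (r 0) \<omega>)"
      unfolding summable_iff_convergent sum_lessThan_telescope[of "\<lambda>k. Z (r k) \<omega>"] .
    hence "convergent (\<lambda>n. (Z (r n) \<omega> - Z (r 0) \<omega>) + Z (r 0) \<omega>)"
      by (intro convergent_add convergent_const)
    thus ?case unfolding X_def by (simp add: convergent_LIMSEQ_iff)
  qed
  have "?E n \<le> ennreal (a n)" for n
  proof -
    have "?E n =
        (\<integral>\<^sup>+\<omega>. liminf (\<lambda>k. ?f k n \<omega>) \<partial>M)"
    proof (rule nn_integral_cong_AE)
      show "AE \<omega> in M. ennreal ((X \<omega> - Z n \<omega>)\<^sup>2) = liminf (\<lambda>k. ?f k n \<omega>)"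
        using conv
      proof eventually_elim
        case (elim \<omega>)
        have "(\<lambda>k. ?f k n \<omega>) \<longlonglongrightarrow> ennreal ((X \<omega> - Z n \<omega>)\<^sup>2)"
          by (intro tendsto_intros elim)
        thus ?case by (intro lim_imp_Liminf[symmetric]) auto
      qed
    qed
    also have "\<dots> \<le> liminf (\<lambda>k. \<integral>\<^sup>+\<omega>. ?f k n \<omega> \<partial>M)"
      by (rule nn_integral_liminf) simp
    also have "\<dots> \<le> liminf (\<lambda>k. ennreal ((1/4)^k + a n))"
    proof (intro Liminf_mono always_eventually allI order_trans[OF le] ennreal_leI)
      show "a (r k) + a n \<le> (1/4)^k + a n" for k using r[of k] by simp
    qed
    also have "\<dots> = ennreal (0 + a n)"
      by (intro lim_imp_Liminf tendsto_intros LIMSEQ_power_zero) auto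
    finally show ?thesis by simp
  qed
  thus thesis using that X by blast
qed

lemma (in prob_space) gaussian_rv_integrable:
  assumes g: "gaussian_rv M X"
  shows "integrable M X"
proof -
  have X[measurable]: "X \<in> borel_measurable M" using g by (simp add: gaussian_rv_def)
  from g consider (normal) m s where "s > 0" "distributed M lborel X (normal_density m s)"
    | (const) m where "AE \<omega> in M. X \<omega> = m"
    unfolding gaussian_rv_def by blast
  thus ?thesis
  proof cases
    case normal
    \<comment> \<open>The positive variance rules out the conventional value 0 of a nonintegrable
      function; integrability of \<open>X\<close> itself follows only from this.\<close>
    have "integrable M (\<lambda>\<omega>. (X \<omega> - expectation X)\<^sup>2)"
      using normal_distributed_variance[OF normal] normal(1)
        not_integrable_integral_eq[of M "\<lambda>\<omega>. (X \<omega> - expectation X)\<^sup>2"] by force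
    hence "integrable M (\<lambda>\<omega>. X \<omega> - expectation X)" by (rule square_integrable_imp_integrable[rotated]) simp
    hence "integrable M (\<lambda>\<omega>. (X \<omega> - expectation X) + expectation X)"
      by (intro Bochner_Integration.integrable_add integrable_const)
    thus ?thesis by simp
  next
    case const
    thus ?thesis using integrable_cong_AE[of X M "\<lambda>_. m"] by simp
  qed
qed

section \<open>Step functions, isometry and Gaussianity\<close>

lemma step_fun_Nil [simp]: "step_fun [] l = 0"
  and step_fun_Cons [simp]: "step_fun ((c, A) # s) l = c * indicator A l + step_fun s l"
  and step_fun_append [simp]: "step_fun (s @ s') l = step_fun s l + step_fun s' l"
  and step_integral_Nil [simp]: "step_integral W [] \<omega> = 0"
  and step_integral_Cons [simp]: "step_integral W ((c, A) # s) \<omega> = c * W A \<omega> + step_integral W s \<omega>"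
  and step_integral_append [simp]: "step_integral W (s @ s') \<omega> = step_integral W s \<omega> + step_integral W s' \<omega>"
  by (simp_all add: step_fun_def step_integral_def)

definition step_scale :: "complex \<Rightarrow> (complex \<times> real set) list \<Rightarrow> (complex \<times> real set) list" where
  "step_scale a s = map (\<lambda>(c, A). (a * c, A)) s"

text \<open>On functions this is g \<mapsto> cnj (g (- l)), the involution fixing Hermitian
  integrands; the symmetry of the noise makes it conjugate the integral almost surely.\<close>

definition step_reflect :: "(complex \<times> real set) list \<Rightarrow> (complex \<times> real set) list" where
  "step_reflect s = map (\<lambda>(c, A). (cnj c, uminus ` A)) s"

lemma step_fun_scale [simp]: "step_fun (step_scale a s) l = a * step_fun s l"
  by (induction s) (simp_all add: step_scale_def distrib_left case_prod_beta step_fun_def)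

lemma step_integral_scale [simp]: "step_integral W (step_scale a s) \<omega> = a * step_integral W s \<omega>"
  by (induction s) (simp_all add: step_scale_def distrib_left case_prod_beta step_integral_def)

lemma snd_step_scale [simp]: "snd ` set (step_scale a s) = snd ` set s"
  by (simp add: step_scale_def image_image case_prod_beta)

lemma step_fun_reflect [simp]: "step_fun (step_reflect s) l = cnj (step_fun s (- l))"
proof (induction s)
  case (Cons p s)
  obtain c A where p: "p = (c, A)" by fastforce
  have "indicator (uminus ` A) l = cnj (indicator A (- l) :: complex)"
    by (auto simp: indicator_def image_iff)
  thus ?case using Cons by (simp add: step_reflect_def p)
qed (simp add: step_reflect_def)

lemma step_integral_eq_sum:
  "step_integral W s \<omega> = (\<Sum>i<length s. fst (s ! i) * W (snd (s ! i)) \<omega>)"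
  unfolding step_integral_def by (subst sum_list_sum_nth) (simp add: case_prod_beta atLeast0LessThan)

lemma step_fun_eq_sum:
  "step_fun s l = (\<Sum>i<length s. fst (s ! i) * indicator (snd (s ! i)) l)"
  unfolding step_fun_def by (subst sum_list_sum_nth) (simp add: case_prod_beta atLeast0LessThan)

lemma step_fun_measurable [measurable]:
  assumes "snd ` set s \<subseteq> fmeasurable lborel"
  shows "step_fun s \<in> borel_measurable borel"
proof -
  have "snd (s ! i) \<in> sets borel" if "i < length s" for i
  proof -
    have "snd (s ! i) \<in> fmeasurable lborel" using assms that by (force simp: set_conv_nth)
    thus ?thesis using fmeasurableD[of _ lborel] by simp
  qed
  thus ?thesis unfolding step_fun_eq_sum[abs_def]
    by (intro borel_measurable_sum borel_measurable_times borel_measurable_indicator) auto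
qed

lemma measurable_cnj [measurable (raw)]:
  "f \<in> borel_measurable M \<Longrightarrow> (\<lambda>x. cnj (f x)) \<in> borel_measurable M"
  by (rule borel_measurable_continuous_on[OF continuous_on_cnj]) (auto intro: continuous_intros)

locale white_noise = prob_space M for M :: "'w measure" +
  fixes W :: "real set \<Rightarrow> 'w \<Rightarrow> complex"
  assumes noise: "hermitian_white_noise M W"
begin

lemma W_measurable [measurable]: "A \<in> fmeasurable lborel \<Longrightarrow> W A \<in> borel_measurable M"
  using noise unfolding hermitian_white_noise_def by blast

lemma W_covariance:
  "A \<in> fmeasurable lborel \<Longrightarrow> B \<in> fmeasurable lborel \<Longrightarrow>
     (\<integral>\<omega>. W A \<omega> * cnj (W B \<omega>) \<partial>M) = of_real (measure lborel (A \<inter> B))"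
  using noise unfolding hermitian_white_noise_def by blast

lemma W_hermitian: "A \<in> fmeasurable lborel \<Longrightarrow> AE \<omega> in M. W (uminus ` A) \<omega> = cnj (W A \<omega>)"
  using noise unfolding hermitian_white_noise_def by blast

lemma W_gaussian:
  "finite F \<Longrightarrow> F \<subseteq> fmeasurable lborel \<Longrightarrow> gaussian_rv M (\<lambda>\<omega>. Re (\<Sum>A\<in>F. c A * W A \<omega>))"
  using noise unfolding hermitian_white_noise_def by blast

lemma W_mult_gaussian: "A \<in> fmeasurable lborel \<Longrightarrow> gaussian_rv M (\<lambda>\<omega>. Re (c * W A \<omega>))"
  using W_gaussian[of "{A}" "\<lambda>_. c"] by simp

text \<open>A vanishing Bochner integral does not by itself say that W A is integrable. The Gaussian
  laws of the real and imaginary parts do; the coefficient -\<i> extracts the imaginary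
  part.\<close>

lemma W_integrable: "A \<in> fmeasurable lborel \<Longrightarrow> integrable M (W A)"
proof -
  assume A: "A \<in> fmeasurable lborel"
  have "integrable M (\<lambda>\<omega>. Re (1 * W A \<omega>))" "integrable M (\<lambda>\<omega>. Re (- \<i> * W A \<omega>))"
    using gaussian_rv_integrable[OF W_mult_gaussian[OF A]] by blast+
  hence "integrable M (\<lambda>\<omega>. of_real (Re (W A \<omega>)) + \<i> * of_real (Im (W A \<omega>)))"
    by (intro Bochner_Integration.integrable_add integrable_mult_right integrable_of_real) simp_all
  thus ?thesis by (simp flip: complex_eq)
qed

lemma W_mean: "A \<in> fmeasurable lborel \<Longrightarrow> (\<integral>\<omega>. W A \<omega> \<partial>M) = 0"
  using noise unfolding hermitian_white_noise_def by blast

lemma W_square_integrable: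
  assumes A: "A \<in> fmeasurable lborel"
  shows "integrable M (\<lambda>\<omega>. (cmod (W A \<omega>))\<^sup>2)"
proof -
  have mean: "expectation (\<lambda>\<omega>. Re (c * W A \<omega>)) = 0" for c
    using W_mean[OF A] W_integrable[OF A] by (subst integral_Re) auto
  have "integrable M (\<lambda>\<omega>. (Re (1 * W A \<omega>))\<^sup>2)" "integrable M (\<lambda>\<omega>. (Re (- \<i> * W A \<omega>))\<^sup>2)"
    using gaussian_rv_imp_centered(1)[OF W_mult_gaussian[OF A] mean] by blast+
  from Bochner_Integration.integrable_add[OF this] show ?thesis by (simp add: cmod_power2)
qed

lemma W_mult_integrable:
  assumes A: "A \<in> fmeasurable lborel" and B: "B \<in> fmeasurable lborel"
  shows "integrable M (\<lambda>\<omega>. W A \<omega> * cnj (W B \<omega>))"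
proof (rule Bochner_Integration.integrable_bound)
  show "integrable M (\<lambda>\<omega>. (cmod (W A \<omega>))\<^sup>2 + (cmod (W B \<omega>))\<^sup>2)"
    using W_square_integrable A B by auto
  show "(\<lambda>\<omega>. W A \<omega> * cnj (W B \<omega>)) \<in> borel_measurable M"
    using A B by measurable
  have "p * q \<le> p\<^sup>2 + q\<^sup>2" if "p \<ge> 0" "q \<ge> 0" for p q :: real
  proof -
    have "0 \<le> (p - q)\<^sup>2 + p * q" using that by simp
    also have "\<dots> = p\<^sup>2 + q\<^sup>2 - p * q" by (simp add: power2_eq_square algebra_simps)
    finally show ?thesis by simp
  qed
  thus "AE \<omega> in M. norm (W A \<omega> * cnj (W B \<omega>)) \<le> norm ((cmod (W A \<omega>))\<^sup>2 + (cmod (W B \<omega>))\<^sup>2)"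
    by (intro AE_I2) (simp add: norm_mult)
qed

abbreviation simple_steps :: "(complex \<times> real set) list \<Rightarrow> bool" where
  "simple_steps s \<equiv> snd ` set s \<subseteq> fmeasurable lborel"

lemma simple_steps_nth: "simple_steps s \<Longrightarrow> i < length s \<Longrightarrow> snd (s ! i) \<in> fmeasurable lborel"
  by (force simp: set_conv_nth)

lemma step_integral_measurable [measurable]:
  assumes "simple_steps s"
  shows "step_integral W s \<in> borel_measurable M"
proof -
  have "(\<lambda>\<omega>. \<Sum>i<length s. fst (s ! i) * W (snd (s ! i)) \<omega>) \<in> borel_measurable M"
    using simple_steps_nth[OF assms] by (intro borel_measurable_sum borel_measurable_times W_measurable) auto
  thus ?thesis by (simp add: step_integral_eq_sum[abs_def])
qed

lemma step_integral_gaussian: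
  assumes s: "simple_steps s"
  shows "gaussian_rv M (\<lambda>\<omega>. Re (step_integral W s \<omega>))"
proof -
  \<comment> \<open>A set may occur several times in the list, while joint Gaussianity is stated for
    sums over a finite set of Borel sets; hence coefficients of equal sets are collected.\<close>
  define c where "c = (\<lambda>A. \<Sum>i | i < length s \<and> snd (s ! i) = A. fst (s ! i))"
  have "step_integral W s \<omega> = (\<Sum>A\<in>snd ` set s. c A * W A \<omega>)" for \<omega>
  proof -
    have "step_integral W s \<omega> = (\<Sum>A\<in>snd ` set s. \<Sum>i\<in>{i \<in> {..<length s}. snd (s ! i) = A}. fst (s ! i) * W (snd (s ! i)) \<omega>)"
      unfolding step_integral_eq_sum by (rule sum.group[symmetric]) auto
    also have "\<dots> = (\<Sum>A\<in>snd ` set s. c A * W A \<omega>)"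
      unfolding c_def sum_distrib_right by (intro sum.cong refl) auto
    finally show ?thesis .
  qed
  thus ?thesis using W_gaussian[of "snd ` set s" c] s by simp
qed

lemma step_integral_integrable:
  assumes "simple_steps s"
  shows "integrable M (step_integral W s)" "(\<integral>\<omega>. step_integral W s \<omega> \<partial>M) = 0"
proof -
  have i: "integrable M (\<lambda>\<omega>. fst (s ! i) * W (snd (s ! i)) \<omega>)" if "i < length s" for i
    using W_integrable[OF simple_steps_nth[OF assms that]] by (rule integrable_mult_right)
  show "integrable M (step_integral W s)"
    unfolding step_integral_eq_sum[abs_def] using i by (intro Bochner_Integration.integrable_sum) auto
  show "(\<integral>\<omega>. step_integral W s \<omega> \<partial>M) = 0"
    unfolding step_integral_eq_sum using i W_mean simple_steps_nth[OF assms]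
    by (subst Bochner_Integration.integral_sum) auto
qed

text \<open>The sets of the list may overlap. Both squared moduli expand into double sums with the
  same coefficients, and the covariance of W B_i and W B_j is the Lebesgue measure of the
  intersection, which is also the integral of the product of the indicators.\<close>

lemma step_isometry:
  assumes s: "simple_steps s"
  shows "integrable M (\<lambda>\<omega>. (cmod (step_integral W s \<omega>))\<^sup>2)"
    and "integrable lborel (\<lambda>l. (cmod (step_fun s l))\<^sup>2)"
    and "(\<integral>\<omega>. (cmod (step_integral W s \<omega>))\<^sup>2 \<partial>M) = (LBINT l. (cmod (step_fun s l))\<^sup>2)"
proof -
  let ?u = "\<lambda>\<omega>. (cmod (step_integral W s \<omega>))\<^sup>2" and ?v = "\<lambda>l. (cmod (step_fun s l))\<^sup>2"
  define c B where "c = (\<lambda>i. fst (s ! i))" and "B = (\<lambda>i. snd (s ! i))"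
  define n where "n = length s"
  let ?a = "\<lambda>i j \<omega>. (c i * cnj (c j)) * (W (B i) \<omega> * cnj (W (B j) \<omega>))"
    and ?b = "\<lambda>i j l. (c i * cnj (c j)) * complex_of_real (indicator (B i \<inter> B j) l)"
  have B: "B i \<in> fmeasurable lborel" if "i < n" for i
    using simple_steps_nth[OF s] that by (simp add: B_def n_def)
  have 1: "complex_of_real (?u \<omega>) =
      (\<Sum>i<n. \<Sum>j<n. ?a i j \<omega>)" for \<omega>
    unfolding complex_norm_square step_integral_eq_sum c_def B_def n_def
    by (simp add: sum_product mult_ac)
  have 2: "complex_of_real (?v l) =
      (\<Sum>i<n. \<Sum>j<n. (c i * cnj (c j)) * of_real (indicator (B i \<inter> B j) l))" for l
  proof -
    have "complex_of_real (?v l) =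
        (\<Sum>i<n. c i * indicator (B i) l) * (\<Sum>j<n. cnj (c j * indicator (B j) l))"
      unfolding complex_norm_square step_fun_eq_sum c_def B_def n_def cnj_sum ..
    also have "\<dots> = (\<Sum>i<n. \<Sum>j<n. (c i * indicator (B i) l) * cnj (c j * indicator (B j) l))"
      by (rule sum_product)
    also have "\<dots> = (\<Sum>i<n. \<Sum>j<n. (c i * cnj (c j)) * of_real (indicator (B i \<inter> B j) l))"
      by (intro sum.cong refl) (auto simp: indicator_def)
    finally show ?thesis .
  qed
  have i1: "integrable M (\<lambda>\<omega>. ?a i j \<omega>)" if "i < n" "j < n" for i j
    by (intro integrable_mult_right W_mult_integrable B that)
  have hb: "has_bochner_integral lborel (\<lambda>l. complex_of_real (indicator (B i \<inter> B j) l)) (of_real (measure lborel (B i \<inter> B j)))"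
    if "i < n" "j < n" for i j
  proof -
    have "B i \<inter> B j \<in> fmeasurable lborel" using B that by (intro fmeasurable.Int) auto
    hence "has_bochner_integral lborel (indicator (B i \<inter> B j) :: real \<Rightarrow> real) (measure lborel (B i \<inter> B j))"
      by (intro has_bochner_integral_real_indicator) (auto simp: fmeasurable_def less_top[symmetric])
    from has_bochner_integral_of_real[OF this] show ?thesis .
  qed
  have i2: "integrable lborel (\<lambda>l. ?b i j l)" if "i < n" "j < n" for i j
    using hb[OF that] by (intro integrable_mult_right) (auto intro: integrable.intros)
  have "integrable M (\<lambda>\<omega>. complex_of_real (?u \<omega>))"
    unfolding 1 using i1 by (intro Bochner_Integration.integrable_sum) auto
  thus iM: "integrable M (\<lambda>\<omega>. ?u \<omega>)"
    by (rule complex_of_real_integrable_eq[THEN iffD1])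
  have "integrable lborel (\<lambda>l. complex_of_real (?v l))"
    unfolding 2 using i2 by (intro Bochner_Integration.integrable_sum) auto
  thus iL: "integrable lborel (\<lambda>l. ?v l)"
    by (rule complex_of_real_integrable_eq[THEN iffD1])
  have "complex_of_real (\<integral>\<omega>. ?u \<omega> \<partial>M) =
      (\<Sum>i<n. \<Sum>j<n. (c i * cnj (c j)) * of_real (measure lborel (B i \<inter> B j)))"
  proof -
    have "complex_of_real (\<integral>\<omega>. ?u \<omega> \<partial>M) =
        (\<integral>\<omega>. complex_of_real (?u \<omega>) \<partial>M)" by (rule integral_of_real[OF iM, symmetric])
    also have "\<dots> = (\<Sum>i<n. \<integral>\<omega>. (\<Sum>j<n. ?a i j \<omega>) \<partial>M)"
      unfolding 1 by (intro Bochner_Integration.integral_sum Bochner_Integration.integrable_sum i1) auto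
    also have "\<dots> = (\<Sum>i<n. \<Sum>j<n. \<integral>\<omega>. ?a i j \<omega> \<partial>M)"
      by (intro sum.cong refl Bochner_Integration.integral_sum i1) auto
    also have "\<dots> = (\<Sum>i<n. \<Sum>j<n. (c i * cnj (c j)) * of_real (measure lborel (B i \<inter> B j)))"
      by (intro sum.cong refl) (simp add: W_covariance B)
    finally show ?thesis .
  qed
  also have "\<dots> = complex_of_real (LBINT l. ?v l)"
  proof -
    have "complex_of_real (LBINT l. ?v l) =
        (LBINT l. complex_of_real (?v l))" by (rule integral_of_real[OF iL, symmetric])
    also have "\<dots> = (\<Sum>i<n. \<integral>l. (\<Sum>j<n. ?b i j l) \<partial>lborel)"
      unfolding 2 by (intro Bochner_Integration.integral_sum Bochner_Integration.integrable_sum i2) auto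
    also have "\<dots> = (\<Sum>i<n. \<Sum>j<n. \<integral>l. ?b i j l \<partial>lborel)"
      by (intro sum.cong refl Bochner_Integration.integral_sum i2) auto
    also have "\<dots> = (\<Sum>i<n. \<Sum>j<n. (c i * cnj (c j)) * of_real (measure lborel (B i \<inter> B j)))"
    proof (intro sum.cong refl)
      fix i j assume "i \<in> {..<n}" "j \<in> {..<n}"
      hence "(LBINT l. complex_of_real (indicator (B i \<inter> B j) l)) = of_real (measure lborel (B i \<inter> B j))"
        using has_bochner_integral_integral_eq[OF hb] by blast
      thus "(LBINT l. ?b i j l) =
          (c i * cnj (c j)) * of_real (measure lborel (B i \<inter> B j))" by (simp only: integral_mult_right_zero)
    qed
    finally show ?thesis by simp
  qed
  finally show "(\<integral>\<omega>. ?u \<omega> \<partial>M) = (LBINT l. ?v l)"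
    by (simp only: of_real_eq_iff)
qed

text \<open>As \<open>X\<close> is real, the real parts \<open>Y n\<close> of the approximating step
  integrals are at least as close to it, and they are centered Gaussian. The isometry identifies the
  limit of the second moments with the L2 norm of \<open>g\<close>, and |exp(ia) - exp(ib)| \<le> |a
  - b| carries mean-square closeness to the characteristic functions.\<close>

lemma white_noise_integral_gaussian:
  assumes X: "has_white_noise_integral M W g X"
  shows "integrable lborel (\<lambda>l. (cmod (g l))\<^sup>2)"
    and "integrable M X" "expectation X = 0"
    and "integrable M (\<lambda>\<omega>. (X \<omega>)\<^sup>2)"
    and "expectation (\<lambda>\<omega>. (X \<omega>)\<^sup>2) = (LBINT l. (cmod (g l))\<^sup>2)"
    and "centered_gaussian M X (LBINT l. (cmod (g l))\<^sup>2)"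
proof -
  from X have g[measurable]: "g \<in> borel_measurable borel" and Xm[measurable]: "X \<in> borel_measurable M"
    by (auto simp: has_white_noise_integral_def)
  from X obtain s where s: "\<And>n. simple_steps (s n)"
    and lg: "(\<lambda>n. \<integral>\<^sup>+l. ennreal ((cmod (g l - step_fun (s n) l))\<^sup>2) \<partial>lborel) \<longlonglongrightarrow> 0"
    and lX: "(\<lambda>n. \<integral>\<^sup>+\<omega>. ennreal ((cmod (of_real (X \<omega>) - step_integral W (s n) \<omega>))\<^sup>2) \<partial>M) \<longlonglongrightarrow> 0"
    unfolding has_white_noise_integral_def by blast
  note [measurable] = step_integral_measurable[OF s] step_fun_measurable[OF s]
  note Lg = L2_limit[of g lborel "\<lambda>n. step_fun (s n)", OF _ _ step_isometry(2)[OF s] lg]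
  note LX = L2_limit[of "\<lambda>\<omega>. of_real (X \<omega>)" M "\<lambda>n. step_integral W (s n)", OF _ _ step_isometry(1)[OF s] lX]
  show "integrable lborel (\<lambda>l. (cmod (g l))\<^sup>2)" by (rule Lg(1)) simp_all
  show X2: "integrable M (\<lambda>\<omega>. (X \<omega>)\<^sup>2)" using LX(1) by simp
  show iX: "integrable M X" by (rule square_integrable_imp_integrable[OF _ X2]) simp
  define v where "v = (LBINT l. (cmod (g l))\<^sup>2)"
  have l1: "(\<lambda>n. \<integral>l. (cmod (step_fun (s n) l))\<^sup>2 \<partial>lborel) \<longlonglongrightarrow> v"
    unfolding v_def by (rule Lg(4)) simp_all
  have l2: "(\<lambda>n. \<integral>\<omega>. (cmod (step_integral W (s n) \<omega>))\<^sup>2 \<partial>M) \<longlonglongrightarrow> expectation (\<lambda>\<omega>. (X \<omega>)\<^sup>2)"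
    using LX(4) by simp
  show EX2: "expectation (\<lambda>\<omega>. (X \<omega>)\<^sup>2) = v"
    using LIMSEQ_unique[OF l2 l1[folded step_isometry(3)[OF s]]] .
  define Y where "Y = (\<lambda>n \<omega>. Re (step_integral W (s n) \<omega>))"
  let ?D = "\<lambda>n. expectation (\<lambda>\<omega>. \<bar>X \<omega> - Y n \<omega>\<bar>)" and ?S = "\<lambda>n. expectation (\<lambda>\<omega>. (X \<omega> - Y n \<omega>)\<^sup>2)"
    and ?c = "\<lambda>Z. char (distr M borel Z)"
  have Y[measurable]: "Y n \<in> borel_measurable M" for n unfolding Y_def by measurable
  have gY: "gaussian_rv M (Y n)" for n unfolding Y_def by (rule step_integral_gaussian[OF s])
  have mY: "expectation (Y n) = 0" for n
    unfolding Y_def using step_integral_integrable[OF s, of n] by (subst integral_Re) auto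
  have iY: "integrable M (Y n)" for n by (rule gaussian_rv_integrable[OF gY])
  have Y2: "integrable M (\<lambda>\<omega>. (Y n \<omega>)\<^sup>2)" for n by (rule gaussian_rv_imp_centered(1)[OF gY mY])
  have XY: "(\<lambda>n. \<integral>\<^sup>+\<omega>. ennreal ((cmod (of_real (X \<omega>) - of_real (Y n \<omega>)))\<^sup>2) \<partial>M) \<longlonglongrightarrow> 0"
  proof (rule tendsto_sandwich[OF _ _ tendsto_const lX])
    show "\<forall>\<^sub>F n in sequentially. (\<integral>\<^sup>+\<omega>. ennreal ((cmod (of_real (X \<omega>) - of_real (Y n \<omega>)))\<^sup>2) \<partial>M) \<le>
        (\<integral>\<^sup>+\<omega>. ennreal ((cmod (of_real (X \<omega>) - step_integral W (s n) \<omega>))\<^sup>2) \<partial>M)"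
    proof (intro always_eventually allI nn_integral_mono ennreal_leI power_mono)
      fix n \<omega>
      have "\<bar>Re (of_real (X \<omega>) - step_integral W (s n) \<omega>)\<bar> \<le> cmod (of_real (X \<omega>) - step_integral W (s n) \<omega>)"
        by (rule abs_Re_le_cmod)
      moreover have "cmod (of_real (X \<omega>) - of_real (Y n \<omega>)) = \<bar>X \<omega> - Y n \<omega>\<bar>"
        by (simp flip: of_real_diff)
      ultimately show "cmod (of_real (X \<omega>) - of_real (Y n \<omega>)) \<le> cmod (of_real (X \<omega>) - step_integral W (s n) \<omega>)"
        by (simp add: Y_def)
    qed simp
  qed simp
  note LY = L2_limit[of "\<lambda>\<omega>. of_real (X \<omega>)" M "\<lambda>n \<omega>. of_real (Y n \<omega>)", OF _ _ _ XY]
  have var: "(\<lambda>n. expectation (\<lambda>\<omega>. (Y n \<omega>)\<^sup>2)) \<longlonglongrightarrow> v"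
    using LY(4) Y2 EX2 by simp
  have d: "(\<lambda>n. ?S n) \<longlonglongrightarrow> 0"
  proof -
    have "(\<lambda>n. \<integral>\<omega>. (cmod (of_real (X \<omega>) - of_real (Y n \<omega>)))\<^sup>2 \<partial>M) \<longlonglongrightarrow> 0"
      by (rule LY(3)) (use Y2 in simp_all)
    thus ?thesis by (simp flip: of_real_diff)
  qed
  have XY2: "integrable M (\<lambda>\<omega>. (X \<omega> - Y n \<omega>)\<^sup>2)" for n
  proof (rule Bochner_Integration.integrable_bound)
    show "integrable M (\<lambda>\<omega>. 2 * (X \<omega>)\<^sup>2 + 2 * (Y n \<omega>)\<^sup>2)" using X2 Y2 by auto
    have "(x - y)\<^sup>2 \<le> 2 * x\<^sup>2 + 2 * y\<^sup>2" for x y :: real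
      using sum_squares_ge_zero[of "x + y" 0] by (simp add: power2_eq_square algebra_simps)
    thus "AE \<omega> in M. norm ((X \<omega> - Y n \<omega>)\<^sup>2) \<le> norm (2 * (X \<omega>)\<^sup>2 + 2 * (Y n \<omega>)\<^sup>2)" by simp
  qed simp
  have L1: "(\<lambda>n. ?D n) \<longlonglongrightarrow> 0"
  proof (rule tendsto_sandwich[of "\<lambda>_. 0"])
    show "(\<lambda>n. sqrt (?S n)) \<longlonglongrightarrow> 0"
      using tendsto_real_sqrt[OF d] by simp
    show "\<forall>\<^sub>F n in sequentially. ?D n \<le> sqrt (?S n)"
    proof (intro always_eventually allI real_le_rsqrt)
      fix n
      \<comment> \<open>For Z = X - Y n, the bound E|Z| \<le> sqrt(E Z^2) is read off from the
        nonnegative variance of |Z|.\<close>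
      have "0 \<le> variance (\<lambda>\<omega>. \<bar>X \<omega> - Y n \<omega>\<bar>)" by simp
      also have "\<dots> = expectation (\<lambda>\<omega>. (\<bar>X \<omega> - Y n \<omega>\<bar>)\<^sup>2) - (?D n)\<^sup>2"
        using iX iY XY2 by (intro variance_eq) auto
      finally show "(?D n)\<^sup>2 \<le> ?S n" by simp
    qed
  qed auto
  show "expectation X = 0"
  proof -
    have "\<bar>expectation X\<bar> \<le> ?D n" for n
    proof -
      have "expectation X = expectation (\<lambda>\<omega>. X \<omega> - Y n \<omega>)" using iX iY mY by simp
      thus ?thesis using integral_norm_bound[of M "\<lambda>\<omega>. X \<omega> - Y n \<omega>"] by simp
    qed
    hence "\<bar>expectation X\<bar> \<le> 0" by (intro LIMSEQ_le_const[OF L1]) auto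
    thus ?thesis by simp
  qed
  have "?c X t = of_real (exp (- v * t\<^sup>2 / 2))" for t
  proof -
    have ch: "?c (Y n) t = of_real (exp (- expectation (\<lambda>\<omega>. (Y n \<omega>)\<^sup>2) * t\<^sup>2 / 2))" for n
      using gaussian_rv_imp_centered(2)[OF gY mY] by (simp add: centered_gaussian_def)
    have "(\<lambda>n. ?c (Y n) t) \<longlonglongrightarrow> of_real (exp (- v * t\<^sup>2 / 2))"
      unfolding ch by (intro tendsto_intros var) auto
    moreover have "(\<lambda>n. ?c (Y n) t) \<longlonglongrightarrow> ?c X t"
    proof (rule metric_tendsto_imp_tendsto)
      show "(\<lambda>n. \<bar>t\<bar> * ?D n) \<longlonglongrightarrow> \<bar>t\<bar> * 0"
        by (intro tendsto_intros L1)
      show "\<forall>\<^sub>F n in sequentially. dist (?c (Y n) t) (?c X t) \<le>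
          dist (\<bar>t\<bar> * ?D n) (\<bar>t\<bar> * 0)"
      proof (intro always_eventually allI)
        fix n
        let ?i = "\<lambda>\<omega>. iexp (t * Y n \<omega>) - iexp (t * X \<omega>)"
        have ie: "integrable M (\<lambda>\<omega>. iexp (t * Z \<omega>))" if [measurable]: "Z \<in> borel_measurable M" for Z
          by (rule integrable_const_bound[of _ 1]) auto
        have "dist (?c (Y n) t) (?c X t) =
            cmod (\<integral>\<omega>. ?i \<omega> \<partial>M)"
          using ie[of X] ie[of "Y n"] by (simp add: char_distr dist_norm)
        also have "\<dots> \<le> (\<integral>\<omega>. cmod (?i \<omega>) \<partial>M)"
          by (rule integral_norm_bound)
        also have "\<dots> \<le> (\<integral>\<omega>. \<bar>t\<bar> * \<bar>X \<omega> - Y n \<omega>\<bar> \<partial>M)"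
        proof (rule integral_mono)
          show "cmod (?i \<omega>) \<le> \<bar>t\<bar> * \<bar>X \<omega> - Y n \<omega>\<bar>" for \<omega>
          proof -
            have "?i \<omega> = iexp (t * X \<omega>) * (iexp (t * (Y n \<omega> - X \<omega>)) - 1)"
              by (simp add: algebra_simps flip: exp_add)
            hence "cmod (?i \<omega>) = cmod (iexp (t * (Y n \<omega> - X \<omega>)) - 1)"
              by (simp add: norm_mult)
            also have "\<dots> \<le> \<bar>t * (Y n \<omega> - X \<omega>)\<bar>"
              using iexp_approx1[of "t * (Y n \<omega> - X \<omega>)" 0] by simp
            finally show ?thesis by (simp add: abs_mult abs_minus_commute)
          qed
        qed (use iX iY ie[of X] ie[of "Y n"] in auto)
        finally show "dist (?c (Y n) t) (?c X t) \<le>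
          dist (\<bar>t\<bar> * ?D n) (\<bar>t\<bar> * 0)"
          by (simp add: dist_real_def)
      qed
    qed
    ultimately show ?thesis using LIMSEQ_unique by blast
  qed
  thus "centered_gaussian M X v" by (simp add: centered_gaussian_def v_def)
qed

lemma white_noise_integral_zero: "has_white_noise_integral M W (\<lambda>_. 0) (\<lambda>_. 0)"
  unfolding has_white_noise_integral_def by (intro conjI exI[of _ "\<lambda>_. []"]) auto

text \<open>Stated over an arbitrary measure space, since the same estimate serves the frequency
  side and the probability side of \<open>has_white_noise_integral\<close>.\<close>

lemma L2_limit_add_mult:
  fixes p p' :: "'z \<Rightarrow> complex" and u u' :: "nat \<Rightarrow> 'z \<Rightarrow> complex" and a b :: real
  assumes [measurable]: "p \<in> borel_measurable N" "p' \<in> borel_measurable N"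
      "\<And>n. u n \<in> borel_measurable N" "\<And>n. u' n \<in> borel_measurable N"
    and l: "(\<lambda>n. \<integral>\<^sup>+x. ennreal ((cmod (p x - u n x))\<^sup>2) \<partial>N) \<longlonglongrightarrow> 0"
      "(\<lambda>n. \<integral>\<^sup>+x. ennreal ((cmod (p' x - u' n x))\<^sup>2) \<partial>N) \<longlonglongrightarrow> 0"
  shows "(\<lambda>n. \<integral>\<^sup>+x. ennreal ((cmod ((of_real a * p x + of_real b * p' x) -
      (of_real a * u n x + of_real b * u' n x)))\<^sup>2) \<partial>N) \<longlonglongrightarrow> 0"
proof (rule tendsto_sandwich[OF _ _ tendsto_const])
  let ?d = "\<lambda>n x. (cmod ((of_real a * p x + of_real b * p' x) - (of_real a * u n x + of_real b * u' n x)))\<^sup>2"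
  let ?L = "\<lambda>n. \<integral>\<^sup>+x. ennreal (?d n x) \<partial>N" and ?I = "\<lambda>n. \<integral>\<^sup>+x. ennreal ((cmod (p x - u n x))\<^sup>2) \<partial>N"
    and ?J = "\<lambda>n. \<integral>\<^sup>+x. ennreal ((cmod (p' x - u' n x))\<^sup>2) \<partial>N"
  show "(\<lambda>n. ennreal (2 * a\<^sup>2) * ?I n +
      ennreal (2 * b\<^sup>2) * ?J n) \<longlonglongrightarrow> 0"
  proof -
    have "(\<lambda>n. ennreal (2 * a\<^sup>2) * ?I n +
      ennreal (2 * b\<^sup>2) * ?J n) \<longlonglongrightarrow> ennreal (2 * a\<^sup>2) * 0 + ennreal (2 * b\<^sup>2) * 0"
      by (intro tendsto_add ennreal_tendsto_cmult l) auto
    thus ?thesis by simp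
  qed
  show "\<forall>\<^sub>F n in sequentially. ?L n
    \<le> ennreal (2 * a\<^sup>2) * ?I n + ennreal (2 * b\<^sup>2) * ?J n"
  proof (intro always_eventually allI)
    fix n
    have "?L n
        \<le> (\<integral>\<^sup>+x. ennreal (2 * a\<^sup>2) * ennreal ((cmod (p x - u n x))\<^sup>2) + ennreal (2 * b\<^sup>2) * ennreal ((cmod (p' x - u' n x))\<^sup>2) \<partial>N)"
    proof (rule nn_integral_mono)
      fix x
      have "?d n x =
          (cmod (of_real a * (p x - u n x) + of_real b * (p' x - u' n x)))\<^sup>2" by (simp add: algebra_simps)
      also have "\<dots> \<le> 2 * (cmod (of_real a * (p x - u n x)))\<^sup>2 + 2 * (cmod (of_real b * (p' x - u' n x)))\<^sup>2"
        by (rule cmod_sq_add_le)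
      also have "\<dots> = 2 * a\<^sup>2 * (cmod (p x - u n x))\<^sup>2 + 2 * b\<^sup>2 * (cmod (p' x - u' n x))\<^sup>2"
        by (simp add: norm_mult power_mult_distrib)
      finally show "ennreal (?d n x) \<le>
        ennreal (2 * a\<^sup>2) * ennreal ((cmod (p x - u n x))\<^sup>2) + ennreal (2 * b\<^sup>2) * ennreal ((cmod (p' x - u' n x))\<^sup>2)"
        by (simp add: ennreal_mult'[symmetric] ennreal_plus[symmetric] ennreal_leI del: ennreal_plus)
    qed
    thus "?L n
    \<le> ennreal (2 * a\<^sup>2) * ?I n + ennreal (2 * b\<^sup>2) * ?J n"
      by (simp add: nn_integral_add nn_integral_cmult)
  qed
qed simp

lemma white_noise_integral_add_mult:
  fixes a b :: real
  assumes "has_white_noise_integral M W g X" "has_white_noise_integral M W h Y"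
  shows "has_white_noise_integral M W (\<lambda>l. of_real a * g l + of_real b * h l) (\<lambda>\<omega>. a * X \<omega> + b * Y \<omega>)"
proof -
  from assms have [measurable]: "g \<in> borel_measurable borel" "X \<in> borel_measurable M"
      "h \<in> borel_measurable borel" "Y \<in> borel_measurable M"
    by (auto simp: has_white_noise_integral_def)
  from assms(1) obtain s where s: "\<And>n. simple_steps (s n)"
    and sg: "(\<lambda>n. \<integral>\<^sup>+l. ennreal ((cmod (g l - step_fun (s n) l))\<^sup>2) \<partial>lborel) \<longlonglongrightarrow> 0"
    and sX: "(\<lambda>n. \<integral>\<^sup>+\<omega>. ennreal ((cmod (of_real (X \<omega>) - step_integral W (s n) \<omega>))\<^sup>2) \<partial>M) \<longlonglongrightarrow> 0"
    unfolding has_white_noise_integral_def by blast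
  from assms(2) obtain r where r: "\<And>n. simple_steps (r n)"
    and rg: "(\<lambda>n. \<integral>\<^sup>+l. ennreal ((cmod (h l - step_fun (r n) l))\<^sup>2) \<partial>lborel) \<longlonglongrightarrow> 0"
    and rX: "(\<lambda>n. \<integral>\<^sup>+\<omega>. ennreal ((cmod (of_real (Y \<omega>) - step_integral W (r n) \<omega>))\<^sup>2) \<partial>M) \<longlonglongrightarrow> 0"
    unfolding has_white_noise_integral_def by blast
  note [measurable] = step_integral_measurable[OF s] step_fun_measurable[OF s]
    step_integral_measurable[OF r] step_fun_measurable[OF r]
  define q where "q = (\<lambda>n. step_scale (of_real a) (s n) @ step_scale (of_real b) (r n))"
  show ?thesis unfolding has_white_noise_integral_def
  proof (intro conjI exI[of _ q] allI)
    show "snd ` set (q n) \<subseteq> fmeasurable lborel" for n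
      using s[of n] r[of n] by (simp add: q_def image_Un)
    show "(\<lambda>n. \<integral>\<^sup>+l. ennreal ((cmod (of_real a * g l + of_real b * h l - step_fun (q n) l))\<^sup>2) \<partial>lborel) \<longlonglongrightarrow> 0"
      unfolding q_def step_fun_append step_fun_scale by (rule L2_limit_add_mult[OF _ _ _ _ sg rg]) simp_all
    show "(\<lambda>n. \<integral>\<^sup>+\<omega>. ennreal ((cmod (of_real (a * X \<omega> + b * Y \<omega>) - step_integral W (q n) \<omega>))\<^sup>2) \<partial>M) \<longlonglongrightarrow> 0"
      unfolding q_def step_integral_append step_integral_scale of_real_add of_real_mult
      by (rule L2_limit_add_mult[OF _ _ _ _ sX rX]) simp_all
  qed simp_all
qed

lemma white_noise_integral_sum:
  assumes "finite I" "\<And>i. i \<in> I \<Longrightarrow> has_white_noise_integral M W (g i) (X i)"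
  shows "has_white_noise_integral M W (\<lambda>l. \<Sum>i\<in>I. of_real (c i) * g i l) (\<lambda>\<omega>. \<Sum>i\<in>I. c i * X i \<omega>)"
  using assms
proof (induction I rule: finite_induct)
  case empty
  show ?case using white_noise_integral_zero by simp
next
  case (insert i I)
  from white_noise_integral_add_mult[OF insert.prems[of i] insert.IH, of "c i" 1] insert
  show ?case by simp
qed

end

section \<open>Existence of real-valued white noise integrals\<close>

text \<open>Level sets of nonzero values have finite measure by Chebyshev's inequality. The value 0
  is left out: its level set may have infinite measure and contributes nothing to the sum.\<close>

lemma simple_function_step_fun:
  fixes F :: "real \<Rightarrow> complex"
  assumes F: "simple_function lborel F" and int: "integrable lborel (\<lambda>l. (cmod (F l))\<^sup>2)"
  obtains s where "snd ` set s \<subseteq> fmeasurable lborel" "\<And>l. step_fun s l = F l"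
proof -
  have fin: "finite (range F)" using simple_functionD(1)[OF F] by simp
  have [measurable]: "F \<in> borel_measurable borel"
    using borel_measurable_simple_function[OF F] by simp
  obtain ys where ys: "set ys = range F - {0}" "distinct ys"
    using finite_distinct_list[of "range F - {0}"] fin by auto
  define s where "s = map (\<lambda>y. (y, F -` {y})) ys"
  have fm: "F -` {y} \<in> fmeasurable lborel" if "y \<noteq> 0" for y
  proof (rule fmeasurableI)
    show m: "F -` {y} \<in> sets lborel" using measurable_sets[of F borel borel "{y}"] by simp
    have "ennreal ((cmod y)\<^sup>2) * emeasure lborel (F -` {y}) = (\<integral>\<^sup>+l. ennreal ((cmod y)\<^sup>2) * indicator (F -` {y}) l \<partial>lborel)"
      using m by (simp add: nn_integral_cmult_indicator)
    also have "\<dots> \<le> (\<integral>\<^sup>+l. ennreal ((cmod (F l))\<^sup>2) \<partial>lborel)"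
      by (intro nn_integral_mono) (auto simp: indicator_def)
    also have "\<dots> < \<infinity>" using int by (simp add: integrable_iff_bounded)
    finally have "ennreal ((cmod y)\<^sup>2) * emeasure lborel (F -` {y}) < \<infinity>" .
    thus "emeasure lborel (F -` {y}) < \<infinity>" using that by (auto simp: ennreal_mult_less_top)
  qed
  have "snd ` set s = (\<lambda>y. F -` {y}) ` (range F - {0})" by (simp add: s_def image_image ys)
  hence 1: "snd ` set s \<subseteq> fmeasurable lborel" using fm by (simp only:) blast
  have "step_fun s l = F l" for l
  proof -
    have "step_fun s l = (\<Sum>y\<leftarrow>ys. y * indicator (F -` {y}) l)"
      by (simp add: step_fun_def s_def comp_def)
    also have "\<dots> = (\<Sum>y\<in>set ys. y * indicator (F -` {y}) l)"
      using ys(2) by (simp add: sum_list_distinct_conv_sum_set)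
    also have "\<dots> = (\<Sum>y\<in>range F - {0}. if F l = y then y else 0)"
      unfolding ys(1) by (intro sum.cong) (auto simp: indicator_def)
    also have "\<dots> = F l" using fin by (subst sum.delta') auto
    finally show ?thesis .
  qed
  with 1 show thesis using that by blast
qed

lemma L2_step_fun_approx:
  fixes g :: "real \<Rightarrow> complex"
  assumes g[measurable]: "g \<in> borel_measurable borel" and int: "integrable lborel (\<lambda>l. (cmod (g l))\<^sup>2)"
  obtains s where "\<And>n. snd ` set (s n) \<subseteq> fmeasurable lborel"
    "\<And>n. integrable lborel (\<lambda>l. (cmod (g l - step_fun (s n) l))\<^sup>2)"
    "(\<lambda>n. \<integral>l. (cmod (g l - step_fun (s n) l))\<^sup>2 \<partial>lborel) \<longlonglongrightarrow> 0"
proof -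
  obtain F where F: "\<And>i. simple_function lborel (F i)" "\<And>l. (\<lambda>i. F i l) \<longlonglongrightarrow> g l"
      "\<And>i l. dist (F i l) 0 \<le> 2 * dist (g l) 0"
    using borel_measurable_implies_sequence_metric[of g lborel 0] by auto
  have [measurable]: "F i \<in> borel_measurable borel" for i
    using borel_measurable_simple_function[OF F(1)[of i]] by simp
  have le: "(cmod (F i l))\<^sup>2 \<le> 4 * (cmod (g l))\<^sup>2" for i l
    using power_mono[OF F(3)[of i l], of 2] by (simp add: power_mult_distrib)
  have iF: "integrable lborel (\<lambda>l. (cmod (F i l))\<^sup>2)" for i
    by (rule Bochner_Integration.integrable_bound[OF integrable_mult_right[OF int, of 4]]) (use le in auto)
  \<comment> \<open>10 = 2 + 2 * 4, with the 4 coming from |F i l| \<le> 2 |g l|.\<close>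
  have bound: "(cmod (g l - F i l))\<^sup>2 \<le> 10 * (cmod (g l))\<^sup>2" for i l
    using cmod_sq_add_le[of "g l" "- F i l"] le[of i l] by simp
  have "\<exists>s. snd ` set s \<subseteq> fmeasurable lborel \<and> (\<forall>l. step_fun s l = F i l)" for i
    using simple_function_step_fun[OF F(1) iF, of i] by metis
  then obtain s where s: "\<And>i. snd ` set (s i) \<subseteq> fmeasurable lborel" "\<And>i l. step_fun (s i) l = F i l"
    by metis
  have "integrable lborel (\<lambda>l. (cmod (g l - F i l))\<^sup>2)" for i
    by (rule Bochner_Integration.integrable_bound[OF integrable_mult_right[OF int, of 10]]) (use bound in auto)
  moreover have "(\<lambda>n. \<integral>l. (cmod (g l - F n l))\<^sup>2 \<partial>lborel) \<longlonglongrightarrow> (\<integral>l. 0 \<partial>(lborel::real measure))"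
  proof (rule integral_dominated_convergence[where w = "\<lambda>l. 10 * (cmod (g l))\<^sup>2"])
    show "AE l in lborel. (\<lambda>n. (cmod (g l - F n l))\<^sup>2) \<longlonglongrightarrow> 0"
    proof (rule AE_I2)
      fix l
      have "(\<lambda>n. (cmod (g l - F n l))\<^sup>2) \<longlonglongrightarrow> (cmod (g l - g l))\<^sup>2"
        by (intro tendsto_intros F(2))
      thus "(\<lambda>n. (cmod (g l - F n l))\<^sup>2) \<longlonglongrightarrow> 0" by simp
    qed
  qed (use int bound in auto)
  ultimately show thesis using that[of s] s by simp
qed

context white_noise
begin

text \<open>The isometry turns L2 approximation of \<open>g\<close> into a Cauchy sequence of random
  variables, and completeness gives the limit. A real limit requires approximants whose integrals
  are real, which is where the Hermitian symmetry of \<open>g\<close> enters.\<close>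

lemma white_noise_integral_exists:
  assumes g[measurable]: "g \<in> borel_measurable borel" and int: "integrable lborel (\<lambda>l. (cmod (g l))\<^sup>2)"
    and herm: "\<And>l. g (- l) = cnj (g l)"
  shows "\<exists>X. has_white_noise_integral M W g X"
proof -
  let ?e = "\<lambda>s (n::nat) l. (cmod (g l - step_fun (s n) l))\<^sup>2"
  obtain s where s: "\<And>n. simple_steps (s n)"
    and i_s: "\<And>n. integrable lborel (\<lambda>l. ?e s n l)"
    and ls: "(\<lambda>n. \<integral>l. ?e s n l \<partial>lborel) \<longlonglongrightarrow> 0"
    using L2_step_fun_approx[OF g int] by blast
  \<comment> \<open>Averaging with the reflection gives a Hermitian step function, whose integral is
    almost surely real. Since \<open>g\<close> equals its own reflection, the approximation error
    does not grow.\<close>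
  define q where "q = (\<lambda>n. step_scale (1/2) (s n) @ step_scale (1/2) (step_reflect (s n)))"
  have refl: "uminus ` A \<in> fmeasurable lborel" if "A \<in> fmeasurable lborel" for A :: "real set"
  proof -
    have A: "A \<in> sets borel" "emeasure lborel A < \<infinity>" using that by (auto simp: fmeasurable_def)
    have e: "uminus ` A = uminus -` A" by force
    have m: "uminus -` A \<in> sets borel" using measurable_sets[of uminus borel borel A] A by simp
    have "emeasure lborel (uminus -` A) = emeasure (distr lborel borel uminus) A"
      using A by (subst emeasure_distr) auto
    also have "\<dots> = emeasure lborel A" by (simp add: lborel_distr_uminus)
    finally show ?thesis using A m unfolding e by (intro fmeasurableI) auto
  qed
  have sr: "simple_steps (step_reflect (s n))" for n
  proof -
    have "snd ` set (step_reflect (s n)) = (`) uminus ` (snd ` set (s n))"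
      by (simp add: step_reflect_def image_image case_prod_beta)
    thus ?thesis using s[of n] refl by (simp only:) blast
  qed
  have q: "simple_steps (q n)" for n
    using s[of n] sr[of n] by (simp add: q_def image_Un)
  note [measurable] = step_integral_measurable[OF q] step_fun_measurable[OF q] step_fun_measurable[OF s]
  define d where "d = (\<lambda>n. \<integral>l. ?e s n l \<partial>lborel)"
  have q_le: "?e q n l \<le>
      ?e s n l / 2 + ?e s n (- l) / 2" for n l
  proof -
    have "g l - step_fun (q n) l = (g l - step_fun (s n) l) / 2 + cnj (g (- l) - step_fun (s n) (- l)) / 2"
      by (simp add: q_def herm field_simps)
    hence "?e q n l \<le> 2 * (cmod ((g l - step_fun (s n) l) / 2))\<^sup>2 +
        2 * (cmod (cnj (g (- l) - step_fun (s n) (- l)) / 2))\<^sup>2" by (simp only: cmod_sq_add_le)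
    also have "\<dots> = ?e s n l / 2 + ?e s n (- l) / 2"
      unfolding norm_divide power_divide complex_mod_cnj by simp
    finally show ?thesis .
  qed
  have irefl: "integrable lborel (\<lambda>l. ?e s n (- l))" for n
    using lborel_integrable_real_affine[OF i_s[of n], of "-1" 0] by simp
  have drefl: "(LBINT l. ?e s n (- l)) = d n" for n
    unfolding d_def using lborel_integral_real_affine[of "-1" "\<lambda>l. ?e s n l" 0] by simp
  have iq: "integrable lborel (\<lambda>l. ?e q n l)" for n
  proof (rule Bochner_Integration.integrable_bound)
    show "integrable lborel (\<lambda>l. ?e s n l / 2 + ?e s n (- l) / 2)"
      using i_s irefl by auto
    show "AE l in lborel. norm (?e q n l) \<le> norm (?e s n l / 2 + ?e s n (- l) / 2)"
      using q_le by (intro AE_I2) simp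
  qed simp
  have dq: "(LBINT l. ?e q n l) \<le> d n" for n
  proof -
    have "(LBINT l. ?e q n l) \<le>
        (LBINT l. ?e s n l / 2 + ?e s n (- l) / 2)"
      using iq i_s irefl q_le by (intro integral_mono) auto
    also have "\<dots> = d n" using i_s irefl by (simp add: drefl) (simp add: d_def)
    finally show ?thesis .
  qed
  define Z where "Z = (\<lambda>n \<omega>. Re (step_integral W (q n) \<omega>))"
  have [measurable]: "Z n \<in> borel_measurable M" for n unfolding Z_def by measurable
  have real: "AE \<omega> in M. step_integral W (q n) \<omega> = of_real (Z n \<omega>)" for n
  proof -
    \<comment> \<open>The symmetry of the noise holds outside a null set depending on the Borel set;
      a list involves finitely many of them.\<close>
    have "AE \<omega> in M. \<forall>p\<in>set (s n). W (uminus ` snd p) \<omega> = cnj (W (snd p) \<omega>)"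
      using s[of n] W_hermitian by (subst AE_finite_all) auto
    thus ?thesis
    proof eventually_elim
      case (elim \<omega>)
      have "step_integral W (step_reflect t) \<omega> = cnj (step_integral W t \<omega>)"
        if "\<forall>p\<in>set t. W (uminus ` snd p) \<omega> = cnj (W (snd p) \<omega>)" for t
        using that by (induction t) (auto simp: step_reflect_def step_integral_def)
      from this[OF elim] have "step_integral W (q n) \<omega> = (step_integral W (s n) \<omega> + cnj (step_integral W (s n) \<omega>)) / 2"
        by (simp add: q_def)
      thus ?case by (simp add: Z_def complex_add_cnj)
    qed
  qed
  let ?E = "\<lambda>X n. \<integral>\<^sup>+\<omega>. ennreal ((cmod (of_real (X \<omega>) - step_integral W (q n) \<omega>))\<^sup>2) \<partial>M"
  have a: "(\<lambda>n. 2 * d n) \<longlonglongrightarrow> 0" using tendsto_mult_left[OF ls, of 2] by (simp add: d_def)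
  obtain X where X[measurable]: "X \<in> borel_measurable M"
    and le: "\<And>n. (\<integral>\<^sup>+\<omega>. ennreal ((X \<omega> - Z n \<omega>)\<^sup>2) \<partial>M) \<le> ennreal (2 * d n)"
  proof (rule L2_complete[OF _ a])
    show "0 \<le> 2 * d n" for n by (simp add: d_def)
    show "(\<integral>\<^sup>+\<omega>. ennreal ((Z m \<omega> - Z n \<omega>)\<^sup>2) \<partial>M) \<le> ennreal (2 * d m + 2 * d n)" for m n
    proof -
      \<comment> \<open>The difference of two approximants is again a step function, so the isometry
        applies to it and moves the Cauchy estimate to the frequency side.\<close>
      define r where "r = q m @ step_scale (- 1) (q n)"
      have r: "simple_steps r" using q[of m] q[of n] by (simp add: r_def image_Un)
      have ri: "step_integral W r \<omega> = step_integral W (q m) \<omega> - step_integral W (q n) \<omega>" for \<omega> by (simp add: r_def)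
      have rf: "step_fun r l = step_fun (q m) l - step_fun (q n) l" for l by (simp add: r_def)
      have "(\<integral>\<^sup>+\<omega>. ennreal ((Z m \<omega> - Z n \<omega>)\<^sup>2) \<partial>M) \<le> (\<integral>\<^sup>+\<omega>. ennreal ((cmod (step_integral W r \<omega>))\<^sup>2) \<partial>M)"
      proof (intro nn_integral_mono ennreal_leI)
        fix \<omega>
        have "\<bar>Z m \<omega> - Z n \<omega>\<bar> \<le> cmod (step_integral W r \<omega>)"
          using abs_Re_le_cmod[of "step_integral W r \<omega>"] by (simp add: ri Z_def)
        thus "(Z m \<omega> - Z n \<omega>)\<^sup>2 \<le> (cmod (step_integral W r \<omega>))\<^sup>2"
          using power_mono[of "\<bar>Z m \<omega> - Z n \<omega>\<bar>" _ 2] by simp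
      qed
      also have "\<dots> = ennreal (\<integral>\<omega>. (cmod (step_integral W r \<omega>))\<^sup>2 \<partial>M)"
        by (rule nn_integral_eq_integral[OF step_isometry(1)[OF r]]) simp
      also have "(\<integral>\<omega>. (cmod (step_integral W r \<omega>))\<^sup>2 \<partial>M) = (LBINT l. (cmod (step_fun r l))\<^sup>2)"
        by (rule step_isometry(3)[OF r])
      also have "(LBINT l. (cmod (step_fun r l))\<^sup>2) \<le>
          (LBINT l. 2 * ?e q m l + 2 * ?e q n l)"
      proof (rule integral_mono[OF step_isometry(2)[OF r]])
        show "integrable lborel (\<lambda>l. 2 * ?e q m l + 2 * ?e q n l)"
          using iq by auto
        show "(cmod (step_fun r l))\<^sup>2 \<le> 2 * ?e q m l + 2 * ?e q n l" for l
          using cmod_sq_add_le[of "- (g l - step_fun (q m) l)" "g l - step_fun (q n) l"]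
          by (simp add: rf norm_minus_commute)
      qed
      also have "\<dots> = 2 * (LBINT l. ?e q m l) + 2 * (LBINT l. ?e q n l)"
        using iq by simp
      also have "\<dots> \<le> 2 * d m + 2 * d n" using dq[of m] dq[of n] by simp
      finally show ?thesis by (simp add: ennreal_leI)
    qed
  qed auto
  have "has_white_noise_integral M W g X"
    unfolding has_white_noise_integral_def
  proof (intro conjI exI[of _ q] allI)
    show "(\<lambda>n. \<integral>\<^sup>+l. ennreal (?e q n l) \<partial>lborel) \<longlonglongrightarrow> 0"
    proof (rule tendsto_sandwich[of "\<lambda>_. 0"])
      show "(\<lambda>n. ennreal (d n)) \<longlonglongrightarrow> 0"
        using tendsto_ennrealI[OF ls] by (simp add: d_def)
      show "\<forall>\<^sub>F n in sequentially. (\<integral>\<^sup>+l. ennreal (?e q n l) \<partial>lborel) \<le> ennreal (d n)"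
        using dq by (intro always_eventually allI) (simp add: nn_integral_eq_integral[OF iq] ennreal_leI)
    qed auto
    show "(\<lambda>n. \<integral>\<^sup>+\<omega>. ennreal ((cmod (of_real (X \<omega>) - step_integral W (q n) \<omega>))\<^sup>2) \<partial>M) \<longlonglongrightarrow> 0"
    proof (rule tendsto_sandwich[of "\<lambda>_. 0"])
      show "(\<lambda>n. ennreal (2 * d n)) \<longlonglongrightarrow> 0"
        using tendsto_ennrealI[OF a] by simp
      show "\<forall>\<^sub>F n in sequentially. ?E X n \<le> ennreal (2 * d n)"
      proof (intro always_eventually allI)
        fix n
        have "?E X n =
            (\<integral>\<^sup>+\<omega>. ennreal ((X \<omega> - Z n \<omega>)\<^sup>2) \<partial>M)"
          using real[of n] by (intro nn_integral_cong_AE) (auto elim!: eventually_mono simp flip: of_real_diff)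
        thus "?E X n \<le> ennreal (2 * d n)"
          using le by simp
      qed
    qed auto
  qed (use q in auto)
  thus ?thesis by blast
qed

lemma white_noise_integral_works:
  assumes "g \<in> borel_measurable borel" "integrable lborel (\<lambda>l. (cmod (g l))\<^sup>2)" "\<And>l. g (- l) = cnj (g l)"
  shows "has_white_noise_integral M W g (white_noise_integral M W g)"
  unfolding white_noise_integral_def using someI_ex[OF white_noise_integral_exists[OF assms]] .

end

section \<open>Spectral densities\<close>

lemma set_integrable_Gamma:
  assumes a: "a > 0"
  shows "set_integrable lborel {0<..} (\<lambda>s::real. s powr (a - 1) * exp (- s))"
    and "(LBINT s:{0<..}. s powr (a - 1) * exp (- s)) = Gamma a"
proof -
  define h where "h = (\<lambda>s::real. indicator {0<..} s *\<^sub>R (s powr (a - 1) * exp (- s)))"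
  have [measurable]: "h \<in> borel_measurable borel" unfolding h_def by measurable
  have h0: "h s \<ge> 0" for s by (simp add: h_def indicator_def)
  have "h s = indicator {0..} s * s powr (a - 1) / exp s" for s
    by (auto simp: h_def indicator_def exp_minus field_simps)
  hence nn: "(\<integral>\<^sup>+s. ennreal (h s) \<partial>lborel) = ennreal (Gamma a)"
    using Gamma_conv_nn_integral_real[OF a] by simp
  have hb: "has_bochner_integral lborel h (Gamma a)"
    by (rule has_bochner_integral_nn_integral[OF _ _ _ nn]) (use a h0 Gamma_real_pos[OF a] in auto)
  show "set_integrable lborel {0<..} (\<lambda>s::real. s powr (a - 1) * exp (- s))"
    unfolding set_integrable_def using hb unfolding h_def by (rule integrable.intros)
  show "(LBINT s:{0<..}. s powr (a - 1) * exp (- s)) = Gamma a"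
    unfolding set_lebesgue_integral_def using hb unfolding h_def by (rule has_bochner_integral_integral_eq)
qed

lemma LBINT_scale_pos:
  fixes h :: "real \<Rightarrow> 'b::{banach, second_countable_topology}" and c :: real
  assumes "c > 0"
  shows "(LBINT s:{0<..}. h s) = c *\<^sub>R (LBINT s:{0<..}. h (c * s))"
proof -
  have "(LBINT s:{0<..}. h s) = \<bar>c\<bar> *\<^sub>R (LBINT s. indicator {0<..} (0 + c * s) *\<^sub>R h (0 + c * s))"
    unfolding set_lebesgue_integral_def using assms by (intro lborel_integral_real_affine) auto
  moreover have "indicator {0<..} (0 + c * s) = (indicator {0<..} s :: real)" for s
    using assms by (simp add: indicator_def zero_less_mult_iff)
  ultimately show ?thesis using assms by (simp add: set_lebesgue_integral_def)
qed

lemma Gamma_integral_scaled: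
  fixes a c :: real
  assumes "a > 0" "c > 0"
  shows "(LBINT s:{0<..}. s powr (a - 1) * exp (- (c * s))) = Gamma a / c powr a"
proof -
  have "Gamma a = c *\<^sub>R (LBINT s:{0<..}. (c * s) powr (a - 1) * exp (- (c * s)))"
    using set_integrable_Gamma(2)[OF assms(1)] LBINT_scale_pos[OF assms(2), of "\<lambda>s. s powr (a - 1) * exp (- s)"] by simp
  also have "(LBINT s:{0<..}. (c * s) powr (a - 1) * exp (- (c * s))) =
      (LBINT s:{0<..}. c powr (a - 1) * (s powr (a - 1) * exp (- (c * s))))"
    using assms by (intro set_lebesgue_integral_cong) (auto simp: powr_mult)
  also have "\<dots> = c powr (a - 1) * (LBINT s:{0<..}. s powr (a - 1) * exp (- (c * s)))" by simp
  finally have "Gamma a = (c * c powr (a - 1)) * (LBINT s:{0<..}. s powr (a - 1) * exp (- (c * s)))" by simp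
  also have "c * c powr (a - 1) = c powr a" using assms powr_add[of c 1 "a - 1"] by simp
  finally show ?thesis using assms by simp
qed

text \<open>Subordination: \<open>(1 + x\<^sup>2)\<^bsup>-\<kappa>/2\<^esup>\<close> is a Gamma mixture over \<open>s\<close> of the Gaussians \<open>e\<^bsup>-s x\<^sup>2\<^esup>\<close>, hence its
  spectral density is the same mixture of the normal densities with variance \<open>2 s\<close>.\<close>

definition mixture_kernel :: "real \<Rightarrow> real \<Rightarrow> real \<Rightarrow> real" where
  "mixture_kernel \<kappa> s l =
     indicator {0<..} s * (s powr (\<kappa> / 2 - 1) * exp (- s) / Gamma (\<kappa> / 2) * normal_density 0 (sqrt (2 * s)) l)"

text \<open>For \<kappa> < 1 the kernel at l = 0 behaves like s^((\<kappa>-1)/2 - 1) near s = 0 and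
  is not integrable, so the value at 0 is the conventional 0 although the density is singular there.
  Pointwise statements are therefore confined to nonzero arguments.\<close>

definition cauchy_density :: "real \<Rightarrow> real \<Rightarrow> real" where
  "cauchy_density \<kappa> l = (LBINT s. mixture_kernel \<kappa> s l)"

lemma mixture_kernel_measurable [measurable]:
  "(\<lambda>(s, l). mixture_kernel \<kappa> s l) \<in> borel_measurable (borel \<Otimes>\<^sub>M borel)"
  unfolding mixture_kernel_def normal_density_def by measurable

lemma mixture_kernel_nonneg: "\<kappa> > 0 \<Longrightarrow> mixture_kernel \<kappa> s l \<ge> 0"
  by (auto simp: mixture_kernel_def indicator_def)

lemma cauchy_density_measurable [measurable]: "cauchy_density \<kappa> \<in> borel_measurable borel"
proof -
  have "(\<lambda>l. \<integral>s. mixture_kernel \<kappa> s l \<partial>lborel) \<in> borel_measurable borel"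
  proof (rule lborel.borel_measurable_lebesgue_integral)
    show "(\<lambda>(l, s). mixture_kernel \<kappa> s l) \<in> borel_measurable (borel \<Otimes>\<^sub>M lborel)"
      unfolding mixture_kernel_def normal_density_def by measurable
  qed
  thus ?thesis by (simp add: cauchy_density_def[abs_def])
qed

lemma cauchy_density_minus: "cauchy_density \<kappa> (- l) = cauchy_density \<kappa> l"
  by (simp add: cauchy_density_def mixture_kernel_def normal_density_def)

text \<open>Integrating over l first leaves the Gamma density in s, because each normal density has
  mass 1. Joint integrability is what Fubini's theorem requires for the Fourier transform.\<close>

lemma integrable_mixture_kernel:
  assumes k: "\<kappa> > 0"
  shows "integrable (lborel \<Otimes>\<^sub>M lborel) (\<lambda>(s, l). mixture_kernel \<kappa> s l)"
proof -
  define q where "q = (\<lambda>s. indicator {0<..} s *\<^sub>R (s powr (\<kappa> / 2 - 1) * exp (- s) / Gamma (\<kappa> / 2)))"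
  have q0: "q s \<ge> 0" for s using k by (auto simp: q_def indicator_def)
  have inner: "(\<integral>\<^sup>+l. ennreal (mixture_kernel \<kappa> s l) \<partial>lborel) = ennreal (q s)" for s
  proof (cases "s > 0")
    case True
    have "(\<integral>\<^sup>+l. ennreal (mixture_kernel \<kappa> s l) \<partial>lborel) =
        (\<integral>\<^sup>+l. ennreal (q s) * ennreal (normal_density 0 (sqrt (2 * s)) l) \<partial>lborel)"
      using True q0[of s] by (intro nn_integral_cong) (simp add: mixture_kernel_def q_def ennreal_mult'[symmetric])
    also have "\<dots> = ennreal (q s) * (\<integral>\<^sup>+l. ennreal (normal_density 0 (sqrt (2 * s)) l) \<partial>lborel)"
      by (rule nn_integral_cmult) simp
    also have "(\<integral>\<^sup>+l. ennreal (normal_density 0 (sqrt (2 * s)) l) \<partial>lborel) = 1"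
      using True integrable_normal_density[of "sqrt (2 * s)" 0] integral_normal_density[of "sqrt (2 * s)" 0]
      by (subst nn_integral_eq_integral) auto
    finally show ?thesis by simp
  qed (simp add: mixture_kernel_def q_def)
  have "integrable lborel (\<lambda>s. indicator {0<..} s *\<^sub>R (s powr (\<kappa> / 2 - 1) * exp (- s)))"
    using set_integrable_Gamma(1)[of "\<kappa>/2"] k by (simp add: set_integrable_def)
  from integrable_divide[OF this, of "Gamma (\<kappa> / 2)"] have iq: "integrable lborel q"
    by (simp add: q_def)
  have "(\<integral>\<^sup>+p. ennreal ((\<lambda>(s, l). mixture_kernel \<kappa> s l) p) \<partial>(lborel \<Otimes>\<^sub>M lborel)) =
      (\<integral>\<^sup>+s. \<integral>\<^sup>+l. ennreal (mixture_kernel \<kappa> s l) \<partial>lborel \<partial>lborel)"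
    by (subst lborel.nn_integral_fst[symmetric]) auto
  also have "\<dots> = (\<integral>\<^sup>+s. ennreal (q s) \<partial>lborel)" unfolding inner ..
  also have "\<dots> < \<infinity>" using iq q0 by (simp add: integrable_iff_bounded)
  finally show ?thesis using mixture_kernel_nonneg[OF k]
    by (intro integrableI_nonneg) auto
qed

lemma fourier_normal_density:
  assumes "\<sigma> > 0"
  shows "(LBINT l. iexp (x * l) * complex_of_real (normal_density 0 \<sigma> l)) = of_real (exp (- (\<sigma> * x)\<^sup>2 / 2))"
proof -
  have "(LBINT l. iexp (x * l) * complex_of_real (normal_density 0 \<sigma> l)) =
      \<bar>\<sigma>\<bar> *\<^sub>R (LBINT l. iexp (x * (0 + \<sigma> * l)) * complex_of_real (normal_density 0 \<sigma> (0 + \<sigma> * l)))"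
    using assms by (intro lborel_integral_real_affine) auto
  also have "\<dots> = (LBINT l. std_normal_density l *\<^sub>R iexp ((\<sigma> * x) * l))"
  proof -
    have e: "\<sigma> * normal_density 0 \<sigma> (\<sigma> * l) = std_normal_density l" for l
      using assms by (simp add: normal_density_def real_sqrt_mult power_mult_distrib)
    have "\<bar>\<sigma>\<bar> *\<^sub>R (LBINT l. iexp (x * (0 + \<sigma> * l)) * complex_of_real (normal_density 0 \<sigma> (0 + \<sigma> * l))) =
        (LBINT l. \<sigma> *\<^sub>R (iexp (x * (0 + \<sigma> * l)) * complex_of_real (normal_density 0 \<sigma> (0 + \<sigma> * l))))"
      using assms by simp
    also have "\<dots> = (LBINT l. std_normal_density l *\<^sub>R iexp ((\<sigma> * x) * l))"
      by (intro Bochner_Integration.integral_cong refl) (simp add: scaleR_conv_of_real e[symmetric] mult_ac)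
    finally show ?thesis .
  qed
  also have "\<dots> = char std_normal_distribution (\<sigma> * x)"
    unfolding char_def by (subst integral_density) auto
  also have "\<dots> = of_real (exp (- (\<sigma> * x)\<^sup>2 / 2))" by (simp add: char_std_normal_distribution)
  finally show ?thesis .
qed

text \<open>The transform of the normal density of variance 2 s is exp(-s x^2); merged with exp(-s)
  it leaves a Gamma integral of rate 1 + x^2.\<close>

lemma fourier_cauchy_density:
  assumes k: "\<kappa> > 0"
  shows "integrable lborel (cauchy_density \<kappa>)"
    and "(LBINT l. iexp (x * l) * complex_of_real (cauchy_density \<kappa> l)) = of_real (1 / (1 + x\<^sup>2) powr (\<kappa> / 2))"
proof -
  let ?G = "\<lambda>s. s powr (\<kappa> / 2 - 1) * exp (- ((1 + x\<^sup>2) * s)) / Gamma (\<kappa> / 2)"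
  note int = integrable_mixture_kernel[OF k]
  show "integrable lborel (cauchy_density \<kappa>)"
    using lborel_pair.integrable_snd[OF int] by (simp add: cauchy_density_def[abs_def])
  define H where "H = (\<lambda>s l. iexp (x * l) * complex_of_real (mixture_kernel \<kappa> s l))"
  have iH: "integrable (lborel \<Otimes>\<^sub>M lborel) (\<lambda>(s, l). H s l)"
  proof (rule Bochner_Integration.integrable_bound[OF int])
    show "(\<lambda>(s, l). H s l) \<in> borel_measurable (lborel \<Otimes>\<^sub>M lborel)" unfolding H_def by measurable
    show "AE p in lborel \<Otimes>\<^sub>M lborel. norm ((\<lambda>(s, l). H s l) p) \<le> norm ((\<lambda>(s, l). mixture_kernel \<kappa> s l) p)"
      by (auto simp: H_def norm_mult)
  qed
  have "(LBINT l. iexp (x * l) * complex_of_real (cauchy_density \<kappa> l)) = (\<integral>l. \<integral>s. H s l \<partial>lborel \<partial>lborel)"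
    unfolding H_def cauchy_density_def by simp
  also have "\<dots> = (\<integral>s. \<integral>l. H s l \<partial>lborel \<partial>lborel)"
    by (rule lborel_pair.Fubini_integral[OF iH])
  also have "\<dots> = (LBINT s. complex_of_real (indicator {0<..} s *\<^sub>R (?G s)))"
  proof (intro Bochner_Integration.integral_cong refl)
    fix s :: real
    show "(LBINT l. H s l) = complex_of_real (indicator {0<..} s *\<^sub>R (?G s))"
    proof (cases "s > 0")
      case True
      define c where "c = s powr (\<kappa> / 2 - 1) * exp (- s) / Gamma (\<kappa> / 2)"
      have "(LBINT l. H s l) = (LBINT l. complex_of_real c * (iexp (x * l) * complex_of_real (normal_density 0 (sqrt (2 * s)) l)))"
        using True by (intro Bochner_Integration.integral_cong refl) (simp add: H_def mixture_kernel_def c_def mult_ac)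
      also have "\<dots> = complex_of_real c * of_real (exp (- (sqrt (2 * s) * x)\<^sup>2 / 2))"
        using True by (simp only: integral_mult_right_zero) (subst fourier_normal_density, auto)
      also have "- (sqrt (2 * s) * x)\<^sup>2 / 2 = - (s * x\<^sup>2)" using True by (simp add: power_mult_distrib)
      also have "complex_of_real c * of_real (exp (- (s * x\<^sup>2))) = of_real (c * exp (- (s * x\<^sup>2)))" by simp
      also have "c * exp (- (s * x\<^sup>2)) = ?G s"
        by (simp add: c_def algebra_simps exp_add exp_minus exp_diff field_simps)
      finally show ?thesis using True by simp
    qed (simp add: H_def mixture_kernel_def)
  qed
  also have "\<dots> = complex_of_real (LBINT s. indicator {0<..} s *\<^sub>R (?G s))"
    by (rule integral_complex_of_real)
  also have "(LBINT s. indicator {0<..} s *\<^sub>R (?G s)) =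
      (LBINT s:{0<..}. s powr (\<kappa> / 2 - 1) * exp (- ((1 + x\<^sup>2) * s))) / Gamma (\<kappa> / 2)"
    unfolding set_lebesgue_integral_def by simp
  also have "\<dots> = 1 / (1 + x\<^sup>2) powr (\<kappa> / 2)"
  proof -
    have "Gamma (\<kappa> / 2) \<noteq> 0" using k Gamma_real_pos[of "\<kappa> / 2"] by linarith
    thus ?thesis using k Gamma_integral_scaled[of "\<kappa> / 2" "1 + x\<^sup>2"] by (simp add: add_pos_nonneg)
  qed
  finally show "(LBINT l. iexp (x * l) * complex_of_real (cauchy_density \<kappa> l)) = of_real (1 / (1 + x\<^sup>2) powr (\<kappa> / 2))" .
qed

text \<open>Collecting the powers of s exhibits the integrand of a Bessel function of order
  (\<kappa> - 1)/2, up to scaling of s.\<close>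

lemma mixture_kernel_eq:
  assumes "s > 0"
  shows "mixture_kernel \<kappa> s l =
    1 / (2 * sqrt pi * Gamma (\<kappa> / 2)) * (s powr ((\<kappa> - 1) / 2 - 1) * exp (- s - l\<^sup>2 / (4 * s)))"
proof -
  have "normal_density 0 (sqrt (2 * s)) l = 1 / (2 * sqrt pi) * s powr (- 1 / 2) * exp (- (l\<^sup>2 / (4 * s)))"
  proof -
    have "sqrt (2 * pi * (sqrt (2 * s))\<^sup>2) = 2 * sqrt pi * s powr (1 / 2)"
    proof -
      have "2 * pi * (sqrt (2 * s))\<^sup>2 = 4 * (pi * s)" using assms by simp
      thus ?thesis using assms by (simp add: real_sqrt_mult powr_half_sqrt)
    qed
    thus ?thesis using assms unfolding normal_density_def by (simp add: powr_minus_divide)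
  qed
  moreover have "s powr (\<kappa> / 2 - 1) * s powr (- 1 / 2) = s powr ((\<kappa> - 1) / 2 - 1)"
    by (simp add: powr_add[symmetric] diff_divide_distrib)
  moreover have "exp (- s) * exp (- (l\<^sup>2 / (4 * s))) = exp (- s - l\<^sup>2 / (4 * s))"
    by (simp add: exp_add[symmetric])
  moreover have "a * e / G * (1 / (2 * sqrt pi) * b * h) = 1 / (2 * sqrt pi * G) * ((a * b) * (e * h))" for a b e h G :: real
    by (simp add: mult_ac)
  ultimately show ?thesis using assms unfolding mixture_kernel_def by simp
qed

lemma cauchy_density_eq_bessel_K:
  assumes k: "\<kappa> > 0" and w: "w \<noteq> 0"
  shows "cauchy_density \<kappa> w = c1 \<kappa> * bessel_K ((\<kappa> - 1) / 2) \<bar>w\<bar> * \<bar>w\<bar> powr ((\<kappa> - 1) / 2)"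
proof -
  \<comment> \<open>The substitution s \<mapsto> b s with b = |w|/2 balances s against w^2/(4 s):
    the exponent becomes -(s + 1/s) |w| / 2. The resulting factor b^\<nu> = |w|^\<nu>
    2^((1-\<kappa>)/2) supplies the power of 2 in \<open>c1\<close>.\<close>
  define \<nu> b where "\<nu> = (\<kappa> - 1) / 2" and "b = \<bar>w\<bar> / 2"
  define D where "D = 1 / (2 * sqrt pi * Gamma (\<kappa> / 2))"
  have b: "b > 0" using w by (simp add: b_def)
  have "cauchy_density \<kappa> w = (LBINT s:{0<..}. D * (s powr (\<nu> - 1) * exp (- s - w\<^sup>2 / (4 * s))))"
    unfolding cauchy_density_def set_lebesgue_integral_def
    by (intro Bochner_Integration.integral_cong refl)
       (auto simp: indicator_def mixture_kernel_eq D_def \<nu>_def, auto simp: mixture_kernel_def)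
  also have "\<dots> = D * (LBINT s:{0<..}. s powr (\<nu> - 1) * exp (- s - w\<^sup>2 / (4 * s)))" by simp
  also have "(LBINT s:{0<..}. s powr (\<nu> - 1) * exp (- s - w\<^sup>2 / (4 * s))) =
      b * (LBINT s:{0<..}. (b * s) powr (\<nu> - 1) * exp (- (b * s) - w\<^sup>2 / (4 * (b * s))))"
    using LBINT_scale_pos[OF b, of "\<lambda>s. s powr (\<nu> - 1) * exp (- s - w\<^sup>2 / (4 * s))"] by simp
  also have "(LBINT s:{0<..}. (b * s) powr (\<nu> - 1) * exp (- (b * s) - w\<^sup>2 / (4 * (b * s)))) =
      (LBINT s:{0<..}. b powr (\<nu> - 1) * (s powr (\<nu> - 1) * exp (- (1 / 2) * (s + 1 / s) * \<bar>w\<bar>)))"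
  proof (intro set_lebesgue_integral_cong allI impI)
    fix s :: real assume s: "s \<in> {0<..}"
    have "w\<^sup>2 / (4 * (b * s)) = b / s" using s b by (simp add: b_def power2_eq_square field_simps)
    hence "- (b * s) - w\<^sup>2 / (4 * (b * s)) = - (1 / 2) * (s + 1 / s) * \<bar>w\<bar>"
      by (simp add: b_def field_simps)
    thus "(b * s) powr (\<nu> - 1) * exp (- (b * s) - w\<^sup>2 / (4 * (b * s))) =
        b powr (\<nu> - 1) * (s powr (\<nu> - 1) * exp (- (1 / 2) * (s + 1 / s) * \<bar>w\<bar>))"
      using s b by (simp add: powr_mult)
  qed simp
  also have "\<dots> = b powr (\<nu> - 1) * (2 * bessel_K \<nu> \<bar>w\<bar>)" unfolding bessel_K_def by simp
  also have "D * (b * (b powr (\<nu> - 1) * (2 * bessel_K \<nu> \<bar>w\<bar>))) = (2 * D) * (b * b powr (\<nu> - 1)) * bessel_K \<nu> \<bar>w\<bar>" by simp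
  also have "b * b powr (\<nu> - 1) = b powr \<nu>" using b powr_add[of b 1 "\<nu> - 1"] by simp
  also have "b powr \<nu> = \<bar>w\<bar> powr \<nu> * 2 powr ((1 - \<kappa>) / 2)"
  proof -
    have "2 powr ((1 - \<kappa>) / 2) = 1 / 2 powr \<nu>"
      by (simp add: \<nu>_def powr_minus_divide[symmetric] minus_divide_left)
    thus ?thesis by (simp add: b_def powr_divide)
  qed
  also have "2 * D * (\<bar>w\<bar> powr \<nu> * 2 powr ((1 - \<kappa>) / 2)) = c1 \<kappa> * \<bar>w\<bar> powr \<nu>"
    by (simp add: D_def c1_def)
  finally show ?thesis by (simp add: \<nu>_def)
qed

text \<open>Dominated convergence away from the origin. For |l| \<ge> \<delta>, exp(-l^2/(4 s))
  \<le> 4 s/\<delta>^2 gains one power of s, so the dominating function has exponent (\<kappa> +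
  1)/2 - 1 > -1 at s = 0.\<close>

lemma isCont_cauchy_density:
  assumes k: "\<kappa> > 0" and w: "w \<noteq> 0"
  shows "isCont (cauchy_density \<kappa>) w"
proof -
  define \<delta> where "\<delta> = \<bar>w\<bar> / 2"
  have \<delta>: "\<delta> > 0" using w by (simp add: \<delta>_def)
  define D where "D = 1 / (2 * sqrt pi * Gamma (\<kappa> / 2))"
  have D: "D > 0" using k by (simp add: D_def)
  define m where "m = (\<lambda>s. D * (4 / \<delta>\<^sup>2) * (indicator {0<..} s *\<^sub>R (s powr ((\<kappa> + 1) / 2 - 1) * exp (- s))))"
  have im: "integrable lborel m"
    unfolding m_def using set_integrable_Gamma(1)[of "(\<kappa>+1)/2"] k
    by (intro integrable_mult_right) (simp add: set_integrable_def)
  have bound: "norm (mixture_kernel \<kappa> s l) \<le> m s" if l: "\<bar>l\<bar> \<ge> \<delta>" for s l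
  proof (cases "s > 0")
    case True
    define y where "y = l\<^sup>2 / (4 * s)"
    have l2: "\<delta>\<^sup>2 \<le> l\<^sup>2" using power_mono[OF l, of 2] \<delta> by simp
    have y: "y > 0" "1 / y \<le> 4 * s / \<delta>\<^sup>2"
    proof -
      have l0: "0 < l\<^sup>2" using l2 \<delta> by (smt (verit) zero_less_power)
      thus "y > 0" using True by (simp add: y_def)
      have "1 / y = 4 * s / l\<^sup>2" by (simp add: y_def)
      also have "\<dots> \<le> 4 * s / \<delta>\<^sup>2" using l2 \<delta> True l0 by (intro divide_left_mono) auto
      finally show "1 / y \<le> 4 * s / \<delta>\<^sup>2" .
    qed
    have "exp (- y) \<le> 1 / y"
    proof -
      have "y \<le> exp y" using exp_ge_add_one_self[of y] by linarith
      thus ?thesis using y(1) by (simp add: exp_minus divide_simps)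
    qed
    hence ey: "exp (- y) \<le> 4 * s / \<delta>\<^sup>2" using y by linarith
    have "norm (mixture_kernel \<kappa> s l) = D * (s powr ((\<kappa> - 1) / 2 - 1) * (exp (- s) * exp (- y)))"
    proof -
      have "norm (mixture_kernel \<kappa> s l) = mixture_kernel \<kappa> s l"
        using mixture_kernel_nonneg[OF k, of s l] by simp
      also have "\<dots> = D * (s powr ((\<kappa> - 1) / 2 - 1) * exp (- s - y))"
        unfolding mixture_kernel_eq[OF True] D_def y_def ..
      also have "exp (- s - y) = exp (- s) * exp (- y)"
        using exp_add[of "- s" "- y"] by simp
      finally show ?thesis .
    qed
    also have "\<dots> \<le> D * (s powr ((\<kappa> - 1) / 2 - 1) * (exp (- s) * (4 * s / \<delta>\<^sup>2)))"
      using ey D True by (intro mult_left_mono) auto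
    also have "\<dots> = D * (4 / \<delta>\<^sup>2) * ((s * s powr ((\<kappa> - 1) / 2 - 1)) * exp (- s))" by simp
    also have "s * s powr ((\<kappa> - 1) / 2 - 1) = s powr ((\<kappa> + 1) / 2 - 1)"
      using True powr_add[of s 1 "(\<kappa> - 1) / 2 - 1"] by (simp add: field_simps)
    finally show ?thesis using True by (simp add: m_def)
  qed (simp add: mixture_kernel_def m_def)
  show ?thesis
    unfolding isCont_def tendsto_at_iff_sequentially
  proof (intro allI impI)
    fix X assume X: "\<forall>i. X i \<in> UNIV - {w}" "X \<longlonglongrightarrow> w"
    have "(\<lambda>i. \<bar>X i\<bar>) \<longlonglongrightarrow> \<bar>w\<bar>" using X(2) by (rule tendsto_rabs)
    moreover have "\<delta> < \<bar>w\<bar>" using w by (simp add: \<delta>_def)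
    ultimately have "\<forall>\<^sub>F i in sequentially. \<delta> < \<bar>X i\<bar>" by (rule order_tendstoD)
    then obtain N where N: "\<And>i. i \<ge> N \<Longrightarrow> \<delta> < \<bar>X i\<bar>" by (auto simp: eventually_sequentially)
    have "(\<lambda>i. \<integral>s. mixture_kernel \<kappa> s (X (i + N)) \<partial>lborel) \<longlonglongrightarrow> (LBINT s. mixture_kernel \<kappa> s w)"
    proof (rule integral_dominated_convergence[OF _ _ im])
      show "(\<lambda>s. mixture_kernel \<kappa> s w) \<in> borel_measurable lborel"
        unfolding mixture_kernel_def normal_density_def by measurable
      show "(\<lambda>s. mixture_kernel \<kappa> s (X (i + N))) \<in> borel_measurable lborel" for i
        unfolding mixture_kernel_def normal_density_def by measurable
      show "AE s in lborel. (\<lambda>i. mixture_kernel \<kappa> s (X (i + N))) \<longlonglongrightarrow> mixture_kernel \<kappa> s w"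
      proof (rule AE_I2)
        fix s
        have "(\<lambda>i. X (i + N)) \<longlonglongrightarrow> w" using X(2) by (rule LIMSEQ_ignore_initial_segment)
        moreover have "Gamma (\<kappa> / 2) \<noteq> 0" using k Gamma_real_pos[of "\<kappa> / 2"] by linarith
        ultimately show "(\<lambda>i. mixture_kernel \<kappa> s (X (i + N))) \<longlonglongrightarrow> mixture_kernel \<kappa> s w"
          by (cases "s > 0") (auto simp: mixture_kernel_eq intro!: tendsto_intros, auto simp: mixture_kernel_def)
      qed
      show "AE s in lborel. norm (mixture_kernel \<kappa> s (X (i + N))) \<le> m s" for i
        using bound[of "X (i + N)"] N[of "i + N"] by (intro AE_I2) simp
    qed
    hence "(\<lambda>i. (cauchy_density \<kappa> \<circ> X) (i + N)) \<longlonglongrightarrow> cauchy_density \<kappa> w"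
      by (simp add: cauchy_density_def)
    thus "(cauchy_density \<kappa> \<circ> X) \<longlonglongrightarrow> cauchy_density \<kappa> w" by (rule LIMSEQ_offset)
  qed
qed

section \<open>Identification of the spectral density\<close>

text \<open>Positive and negative parts of f have equal transforms, hence at x = 0 equal mass c. If
  c > 0, dividing by c gives two probability measures with the same characteristic function, and
  Levy's uniqueness theorem applies; if c = 0, both parts vanish almost everywhere.\<close>

lemma fourier_L1_unique:
  fixes f :: "real \<Rightarrow> real"
  assumes f: "integrable lborel f"
    and zero: "\<And>x. (LBINT l. iexp (x * l) * complex_of_real (f l)) = 0"
  shows "AE l in lborel. f l = 0"
proof -
  define p q where "p = (\<lambda>l. max (f l) 0)" and "q = (\<lambda>l. max (- f l) 0)"
  have [measurable]: "f \<in> borel_measurable borel" using f by auto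
  have ip: "integrable lborel p" and iq: "integrable lborel q"
    using f by (auto simp: p_def q_def)
  have pq: "f l = p l - q l" "p l \<ge> 0" "q l \<ge> 0" for l by (auto simp: p_def q_def)
  have [measurable]: "p \<in> borel_measurable borel" "q \<in> borel_measurable borel" using ip iq by auto
  have ie: "integrable lborel (\<lambda>l. iexp (x * l) * complex_of_real (h l))" if "integrable lborel h" for h x
    using that by (rule Bochner_Integration.integrable_bound) (use that in \<open>auto simp: norm_mult\<close>)
  have eq: "(LBINT l. iexp (x * l) * complex_of_real (p l)) = (LBINT l. iexp (x * l) * complex_of_real (q l))" for x
  proof -
    have "0 = (LBINT l. iexp (x * l) * complex_of_real (p l) - iexp (x * l) * complex_of_real (q l))"
      using zero[of x] by (simp add: pq(1) algebra_simps)
    thus ?thesis using ie[OF ip, of x] ie[OF iq, of x] by simp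
  qed
  define c :: real where "c = (LBINT l. p l)"
  let ?M = "\<lambda>h. density lborel (\<lambda>l::real. ennreal (h l / c))"
  have cq: "(LBINT l. q l) = c"
    using eq[of 0] ip iq by (simp add: c_def)
  have c0: "c \<ge> 0" using pq by (simp add: c_def)
  have "AE l in lborel. p l = q l"
  proof (cases "c = 0")
    case True
    have "AE l in lborel. p l = 0" "AE l in lborel. q l = 0"
      using True cq pq integral_nonneg_eq_0_iff_AE[OF ip] integral_nonneg_eq_0_iff_AE[OF iq]
      by (auto simp: c_def)
    thus ?thesis by eventually_elim simp
  next
    case False
    hence c: "c > 0" using c0 by simp
    have rd: "real_distribution (?M h)"
      and ch: "\<And>x. char (?M h) x =
        (LBINT l. iexp (x * l) * complex_of_real (h l)) / c"
      if h: "integrable lborel h" "\<And>l. h l \<ge> 0" "(LBINT l. h l) = c" for h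
    proof -
      have [measurable]: "h \<in> borel_measurable borel" using h by auto
      have "emeasure (?M h) UNIV = (\<integral>\<^sup>+l. ennreal (h l / c) \<partial>lborel)"
        by (subst emeasure_density) auto
      also have "\<dots> = ennreal (LBINT l. h l / c)"
        using h c by (intro nn_integral_eq_integral) auto
      also have "\<dots> = 1" using h c by simp
      finally show "real_distribution (?M h)"
        by (intro real_distribution.intro prob_spaceI) (auto simp: real_distribution_axioms_def)
      show "char (?M h) x = (LBINT l. iexp (x * l) * complex_of_real (h l)) / c" for x
      proof -
        have "char (?M h) x = (LBINT l. (h l / c) *\<^sub>R iexp (x * l))"
          unfolding char_def using h c by (subst integral_density) auto
        also have "\<dots> = (LBINT l. iexp (x * l) * complex_of_real (h l) / c)"
          by (intro Bochner_Integration.integral_cong refl) (simp add: scaleR_conv_of_real)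
        finally show ?thesis by simp
      qed
    qed
    have "?M p = ?M q"
      by (intro Levy_uniqueness rd ip iq pq cq c_def[symmetric] ext)
         (simp only: ch[OF ip pq(2) c_def[symmetric]] ch[OF iq pq(3) cq] eq)
    hence "AE l in lborel. ennreal (p l / c) = ennreal (q l / c)"
      by (subst (asm) sigma_finite_measure.density_unique_iff) (auto intro: lborel.sigma_finite_measure_axioms)
    thus ?thesis by eventually_elim (use pq c in auto)
  qed
  thus ?thesis by eventually_elim (simp add: pq(1))
qed

text \<open>Multiplying a covariance by cos(w x) splits its spectrum into two halves shifted by w
  and -w. This explicit function is the representative of the spectral density that may be evaluated
  at 0.\<close>

definition covariance_density :: "nat \<Rightarrow> (nat \<Rightarrow> real) \<Rightarrow> (nat \<Rightarrow> real) \<Rightarrow> (nat \<Rightarrow> real) \<Rightarrow> real \<Rightarrow> real" where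
  "covariance_density n A w \<kappa> l =
     (\<Sum>j=1..n. A j / 2 * (cauchy_density (\<kappa> j) (l - w j) + cauchy_density (\<kappa> j) (l + w j)))"

lemma fourier_cauchy_density_shift:
  assumes k: "\<kappa> > 0"
  shows "integrable lborel (\<lambda>l. cauchy_density \<kappa> (l - w))"
    and "(LBINT l. iexp (x * l) * complex_of_real (cauchy_density \<kappa> (l - w))) =
      iexp (x * w) * of_real (1 / (1 + x\<^sup>2) powr (\<kappa> / 2))"
proof -
  show "integrable lborel (\<lambda>l. cauchy_density \<kappa> (l - w))"
    using lborel_integrable_real_affine[OF fourier_cauchy_density(1)[OF k], of 1 "- w"] by simp
  have "(LBINT l. iexp (x * l) * complex_of_real (cauchy_density \<kappa> (l - w))) =
      \<bar>1\<bar> *\<^sub>R (LBINT l. iexp (x * (w + 1 * l)) * complex_of_real (cauchy_density \<kappa> (w + 1 * l - w)))"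
    by (rule lborel_integral_real_affine) simp
  also have "\<dots> = (LBINT l. iexp (x * w) * (iexp (x * l) * complex_of_real (cauchy_density \<kappa> l)))"
    by (simp add: distrib_left exp_add mult_ac)
  also have "\<dots> = iexp (x * w) * (LBINT l. iexp (x * l) * complex_of_real (cauchy_density \<kappa> l))"
    by (rule integral_mult_right_zero)
  finally show "(LBINT l. iexp (x * l) * complex_of_real (cauchy_density \<kappa> (l - w))) =
      iexp (x * w) * of_real (1 / (1 + x\<^sup>2) powr (\<kappa> / 2))"
    by (simp only: fourier_cauchy_density(2)[OF k])
qed

lemma integrable_covariance_density:
  assumes "\<And>j. j \<in> {1..n} \<Longrightarrow> \<kappa> j > 0"
  shows "integrable lborel (covariance_density n A w \<kappa>)"
  unfolding covariance_density_def[abs_def]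
  using fourier_cauchy_density_shift(1)[OF assms] fourier_cauchy_density_shift(1)[OF assms, of _ "- w _"]
  by (intro Bochner_Integration.integrable_sum integrable_mult_right Bochner_Integration.integrable_add) auto

lemma fourier_covariance_density:
  assumes k: "\<And>j. j \<in> {1..n} \<Longrightarrow> \<kappa> j > 0"
  shows "(LBINT l. iexp (x * l) * complex_of_real (covariance_density n A w \<kappa> l)) =
    of_real (\<Sum>j=1..n. A j * (cos (w j * x) / (1 + x\<^sup>2) powr (\<kappa> j / 2)))"
proof -
  define a where "a = (\<lambda>j l. iexp (x * l) * complex_of_real (cauchy_density (\<kappa> j) (l - w j)))"
  define b where "b = (\<lambda>j l. iexp (x * l) * complex_of_real (cauchy_density (\<kappa> j) (l + w j)))"
  have ie: "integrable lborel (\<lambda>l. iexp (x * l) * complex_of_real (h l))" if "integrable lborel h" for h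
    using that by (rule Bochner_Integration.integrable_bound) (use that in \<open>auto simp: norm_mult\<close>)
  have ia: "integrable lborel (a j)" if "j \<in> {1..n}" for j
    unfolding a_def by (rule ie[OF fourier_cauchy_density_shift(1)[OF k[OF that]]])
  have ib: "integrable lborel (b j)" if "j \<in> {1..n}" for j
    unfolding b_def using ie[OF fourier_cauchy_density_shift(1)[OF k[OF that], of "- w j"]] by simp
  have "(LBINT l. iexp (x * l) * complex_of_real (covariance_density n A w \<kappa> l)) =
      (LBINT l. (\<Sum>j=1..n. of_real (A j / 2) * (a j l + b j l)))"
    by (intro Bochner_Integration.integral_cong refl)
       (simp add: covariance_density_def a_def b_def sum_distrib_left algebra_simps)
  also have "\<dots> = (\<Sum>j=1..n. \<integral>l. of_real (A j / 2) * (a j l + b j l) \<partial>lborel)"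
    using ia ib by (intro Bochner_Integration.integral_sum integrable_mult_right Bochner_Integration.integrable_add) auto
  also have "\<dots> = (\<Sum>j=1..n. of_real (A j * (cos (w j * x) / (1 + x\<^sup>2) powr (\<kappa> j / 2))))"
  proof (intro sum.cong refl)
    fix j assume j: "j \<in> {1..n}"
    define R where "R = 1 / (1 + x\<^sup>2) powr (\<kappa> j / 2)"
    have A: "(LBINT l. a j l) = iexp (x * w j) * of_real R"
      unfolding a_def R_def by (rule fourier_cauchy_density_shift(2)[OF k[OF j]])
    have B: "(LBINT l. b j l) = iexp (x * (- w j)) * of_real R"
      unfolding b_def R_def using fourier_cauchy_density_shift(2)[OF k[OF j], of x "- w j"] by simp
    have "(LBINT l. of_real (A j / 2) * (a j l + b j l)) =
        of_real (A j / 2) * (iexp (x * w j) * of_real R + iexp (x * (- w j)) * of_real R)"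
      using ia[OF j] ib[OF j] by (simp only: integral_mult_right_zero Bochner_Integration.integral_add A B)
    also have "\<dots> = of_real (A j / 2) * of_real R * (iexp (x * w j) + iexp (x * (- w j)))"
      by (simp add: algebra_simps)
    also have "iexp (x * w j) + iexp (x * (- w j)) = of_real (2 * cos (w j * x))"
      by (simp add: complex_eq_iff Re_exp Im_exp mult.commute)
    also have "complex_of_real (A j / 2) * of_real R * of_real (2 * cos (w j * x)) =
        of_real (A j * (cos (w j * x) / (1 + x\<^sup>2) powr (\<kappa> j / 2)))"
      by (simp add: R_def)
    finally show "(LBINT l. of_real (A j / 2) * (a j l + b j l)) =
        of_real (A j * (cos (w j * x) / (1 + x\<^sup>2) powr (\<kappa> j / 2)))" .
  qed
  finally show ?thesis by simp
qed

text \<open>Both sides are integrable with transform r. The weights may be negative, so uniqueness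
  is applied to the signed difference rather than to two densities.\<close>

lemma spectral_density_AE_eq:
  assumes sd: "spectral_density f r"
    and r: "\<And>x. r x = (\<Sum>j=1..n. A j * (cos (w j * x) / (1 + x\<^sup>2) powr (\<kappa> j / 2)))"
    and k: "\<And>j. j \<in> {1..n} \<Longrightarrow> \<kappa> j > 0"
  shows "AE l in lborel. f l = covariance_density n A w \<kappa> l"
proof -
  define g where "g = covariance_density n A w \<kappa>"
  have f: "integrable lborel f" and rf: "\<And>x. complex_of_real (r x) = (LBINT l. iexp (x * l) * of_real (f l))"
    using sd by (auto simp: spectral_density_def)
  have g: "integrable lborel g" unfolding g_def by (rule integrable_covariance_density[OF k])
  have ie: "integrable lborel (\<lambda>l. iexp (x * l) * complex_of_real (h l))" if "integrable lborel h" for h x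
    using that by (rule Bochner_Integration.integrable_bound) (use that in \<open>auto simp: norm_mult\<close>)
  have "AE l in lborel. f l - g l = 0"
  proof (rule fourier_L1_unique)
    show "integrable lborel (\<lambda>l. f l - g l)" using f g by simp
    fix x
    have "(LBINT l. iexp (x * l) * complex_of_real (f l - g l)) =
        (LBINT l. iexp (x * l) * of_real (f l) - iexp (x * l) * of_real (g l))"
      by (intro Bochner_Integration.integral_cong refl) (simp add: algebra_simps)
    also have "\<dots> = (LBINT l. iexp (x * l) * of_real (f l)) - (LBINT l. iexp (x * l) * of_real (g l))"
      by (intro Bochner_Integration.integral_diff ie f g)
    also have "(LBINT l. iexp (x * l) * of_real (g l)) = of_real (r x)"
      unfolding g_def r by (rule fourier_covariance_density[OF k])
    also have "(LBINT l. iexp (x * l) * of_real (f l)) - of_real (r x) = 0" by (simp only: rf) simp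
    finally show "(LBINT l. iexp (x * l) * complex_of_real (f l - g l)) = 0" .
  qed
  thus ?thesis by (simp add: g_def)
qed

text \<open>The singular points of the summands are w_j and -w_j, none of which is 0. At 0 the two
  halves coincide by evenness, which cancels the factor 1/2.\<close>

lemma covariance_density_0:
  assumes k: "\<And>j. j \<in> {1..n} \<Longrightarrow> \<kappa> j > 0" and w: "\<And>j. j \<in> {1..n} \<Longrightarrow> w j \<noteq> 0"
  shows "isCont (covariance_density n A w \<kappa>) 0"
    and "covariance_density n A w \<kappa> 0 =
      (\<Sum>j=1..n. c1 (\<kappa> j) * A j * bessel_K ((\<kappa> j - 1) / 2) \<bar>w j\<bar> * \<bar>w j\<bar> powr ((\<kappa> j - 1) / 2))"
proof -
  have c: "isCont (\<lambda>l. cauchy_density (\<kappa> j) (l + v)) 0" if "j \<in> {1..n}" "v = w j \<or> v = - w j" for j v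
  proof -
    have "isCont (cauchy_density (\<kappa> j)) (0 + v)"
      using that k w by (intro isCont_cauchy_density) auto
    moreover have "isCont (\<lambda>l. l + v) 0" by (intro continuous_intros)
    ultimately show ?thesis by (rule isCont_o2[rotated])
  qed
  have c': "isCont (\<lambda>l. cauchy_density (\<kappa> j) (l - w j)) 0" if "j \<in> {1..n}" for j
    using c[OF that, of "- w j"] by simp
  show "isCont (covariance_density n A w \<kappa>) 0"
    unfolding covariance_density_def by (intro continuous_sum continuous_intros c c') auto
  show "covariance_density n A w \<kappa> 0 =
      (\<Sum>j=1..n. c1 (\<kappa> j) * A j * bessel_K ((\<kappa> j - 1) / 2) \<bar>w j\<bar> * \<bar>w j\<bar> powr ((\<kappa> j - 1) / 2))"
    unfolding covariance_density_def
    by (intro sum.cong refl) (simp add: cauchy_density_minus cauchy_density_eq_bessel_K k w)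
qed

text \<open>A negative value would persist on an interval to the right of a, which is not a null
  set. This transfers f \<ge> 0 to the value at 0 of the continuous representative.\<close>

lemma AE_nonneg_isCont:
  fixes h :: "real \<Rightarrow> real"
  assumes AE: "AE x in lborel. h x \<ge> 0" and c: "isCont h a"
  shows "h a \<ge> 0"
proof (rule ccontr)
  assume "\<not> h a \<ge> 0"
  hence "\<forall>\<^sub>F x in at a. h x < 0" using c by (intro order_tendstoD(2)) (auto simp: isCont_def)
  then obtain d where d: "d > 0" "\<And>x. x \<noteq> a \<Longrightarrow> dist x a < d \<Longrightarrow> h x < 0"
    by (auto simp: eventually_at)
  obtain N where N: "{x \<in> space lborel. \<not> h x \<ge> 0} \<subseteq> N" "emeasure lborel N = 0" "N \<in> sets lborel"
    using AE by (rule AE_E)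
  have "{a<..<a + d} \<subseteq> N" using d N(1) by (force simp: dist_real_def)
  hence "emeasure lborel {a<..<a + d} \<le> emeasure lborel N" using N(3) by (rule emeasure_mono)
  thus False using N(2) d(1) by simp
qed

section \<open>Scaling limit of the variances\<close>

text \<open>For \<alpha> > 0, the square of min(1, |l|^(-\<alpha>)), the shape of the bound on the
  transforms.\<close>

definition decay_bound :: "real \<Rightarrow> real \<Rightarrow> real" where
  "decay_bound \<alpha> l = (if \<bar>l\<bar> \<le> 1 then 1 else \<bar>l\<bar> powr (- 2 * \<alpha>))"

lemma decay_bound_measurable [measurable]: "decay_bound \<alpha> \<in> borel_measurable borel"
  unfolding decay_bound_def by measurable

lemma integrable_decay_bound:
  assumes "\<alpha> > 1 / 2"
  shows "integrable lborel (decay_bound \<alpha>)"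
proof (rule Bochner_Integration.integrable_bound)
  define h where "h = (\<lambda>l::real. indicator {1..} l *\<^sub>R l powr (- 2 * \<alpha>))"
  have "(\<lambda>l::real. l powr (- 2 * \<alpha>)) integrable_on {1..}"
    using has_integral_powr_to_inf[of "- 2 * \<alpha>" 1] assms by (auto simp: integrable_on_def)
  hence "(\<lambda>l::real. l powr (- 2 * \<alpha>)) absolutely_integrable_on {1..}"
    by (subst absolutely_integrable_on_iff_nonneg) auto
  hence ih: "integrable lborel h"
    unfolding set_integrable_def h_def by (subst (asm) integrable_completion) auto
  have ih': "integrable lborel (\<lambda>l. h (- l))"
    using lborel_integrable_real_affine[OF ih, of "-1" 0] by simp
  show "integrable lborel (\<lambda>l. indicator {-1..1} l + h l + h (- l))"
    using ih ih' by (intro Bochner_Integration.integrable_add integrable_real_indicator) auto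
  show "AE l in lborel. norm (decay_bound \<alpha> l) \<le> norm (indicator {-1..1} l + h l + h (- l))"
    by (rule AE_I2) (auto simp: decay_bound_def h_def indicator_def)
qed simp

text \<open>Near the origin dominated convergence applies; the rest has mass of order \<open>\<eta>\<^bsup>2\<alpha>-1\<^esup>\<close>,
  however singular the density \<open>f\<close> is there.\<close>

lemma scaled_L2_limit:
  fixes G :: "nat \<Rightarrow> real \<Rightarrow> complex" and G\<^sub>0 :: "real \<Rightarrow> complex" and f :: "real \<Rightarrow> real"
  assumes \<alpha>: "\<alpha> > 1 / 2"
    and \<eta>: "\<And>k. \<eta> k > 0" "\<eta> \<longlonglongrightarrow> 0"
    and f: "integrable lborel f" "isCont f 0"
    and G[measurable]: "\<And>k. G k \<in> borel_measurable borel" "G\<^sub>0 \<in> borel_measurable borel"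
    and lim: "\<And>l. (\<lambda>k. G k l) \<longlonglongrightarrow> G\<^sub>0 l"
    and b0: "\<And>k l. cmod (G k l) \<le> K" and b1: "\<And>k l. l \<noteq> 0 \<Longrightarrow> cmod (G k l) \<le> K * \<bar>l\<bar> powr (- \<alpha>)"
  shows "(\<lambda>k. \<integral>l. (cmod (G k l))\<^sup>2 * f (\<eta> k * l) \<partial>lborel) \<longlonglongrightarrow> f 0 * (LBINT l. (cmod (G\<^sub>0 l))\<^sup>2)"
proof -
  let ?F = "\<lambda>k l. (cmod (G k l))\<^sup>2 * f (\<eta> k * l)"
  have [measurable]: "f \<in> borel_measurable borel" using f(1) by auto
  have K: "K \<ge> 0" using order_trans[OF norm_ge_zero b0] .
  have sq: "(cmod (G k l))\<^sup>2 \<le> K\<^sup>2 * \<bar>l\<bar> powr (- 2 * \<alpha>)" if "l \<noteq> 0" for k l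
  proof -
    have "(\<bar>l\<bar> powr (- \<alpha>))\<^sup>2 = \<bar>l\<bar> powr (- 2 * \<alpha>)"
      by (simp add: power2_eq_square powr_add[symmetric])
    thus ?thesis using power_mono[OF b1[OF that, of k], of 2] by (simp add: power_mult_distrib)
  qed
  have db: "(cmod (G k l))\<^sup>2 \<le> K\<^sup>2 * decay_bound \<alpha> l" for k l
    using sq[of l k] power_mono[OF b0[of k l], of 2] by (auto simp: decay_bound_def)
  obtain \<delta> where \<delta>: "\<delta> > 0" "\<And>l. \<bar>l\<bar> < \<delta> \<Longrightarrow> \<bar>f l\<bar> \<le> \<bar>f 0\<bar> + 1"
  proof -
    obtain d where "d > 0" "\<And>l. dist l 0 < d \<Longrightarrow> dist (f l) (f 0) < 1"
      using f(2) unfolding continuous_at by (metis zero_less_one LIM_def dist_self)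
    thus ?thesis using that[of d] by (force simp: dist_real_def)
  qed
  have si: "integrable lborel (\<lambda>l. f (\<eta> k * l))" for k
    using lborel_integrable_real_affine[OF f(1), of "\<eta> k" 0] \<eta>(1)[of k] by simp
  have I: "integrable lborel (\<lambda>l. ?F k l)" for k
  proof (rule Bochner_Integration.integrable_bound[OF integrable_mult_right[OF si, of "K\<^sup>2" k]])
    show "AE l in lborel. norm (?F k l) \<le> norm (K\<^sup>2 * f (\<eta> k * l))"
      using power_mono[OF b0[of k], of _ 2] by (intro AE_I2) (auto simp: abs_mult intro!: mult_right_mono)
  qed simp
  \<comment> \<open>Continuity bounds f only on (-\<delta>, \<delta>), so the cut is at |\<eta> l| =
    \<delta>; it recedes to infinity in l as \<eta> tends to 0.\<close>
  define near where "near = (\<lambda>k l. if \<bar>\<eta> k * l\<bar> < \<delta> then ?F k l else 0)"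
  define far where "far = (\<lambda>k l. if \<bar>\<eta> k * l\<bar> < \<delta> then 0 else ?F k l)"
  let ?near = "\<lambda>k. LBINT l. near k l" and ?far = "\<lambda>k. LBINT l. far k l"
  have [measurable]: "near k \<in> borel_measurable borel" "far k \<in> borel_measurable borel" for k
    unfolding near_def far_def by measurable
  have In: "integrable lborel (near k)" and If: "integrable lborel (far k)" for k
    by (rule Bochner_Integration.integrable_bound[OF I[of k]]; simp add: near_def far_def)+
  have split: "(LBINT l. ?F k l) = (?near k) + (?far k)" for k
    by (subst Bochner_Integration.integral_add[OF In If, symmetric])
       (intro Bochner_Integration.integral_cong refl, simp add: near_def far_def)
  have "(\<lambda>k. ?near k) \<longlonglongrightarrow> (LBINT l. (cmod (G\<^sub>0 l))\<^sup>2 * f 0)"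
  proof (rule integral_dominated_convergence)
    show "integrable lborel (\<lambda>l. K\<^sup>2 * (\<bar>f 0\<bar> + 1) * decay_bound \<alpha> l)"
      by (intro integrable_mult_right integrable_decay_bound \<alpha>)
    show "AE l in lborel. norm (near k l) \<le> K\<^sup>2 * (\<bar>f 0\<bar> + 1) * decay_bound \<alpha> l" for k
    proof (rule AE_I2)
      fix l
      have "norm (near k l) \<le> (K\<^sup>2 * decay_bound \<alpha> l) * (\<bar>f 0\<bar> + 1)"
        using \<delta>(2)[of "\<eta> k * l"] db[of k l]
        by (auto simp: near_def abs_mult decay_bound_def intro!: mult_mono)
      thus "norm (near k l) \<le> K\<^sup>2 * (\<bar>f 0\<bar> + 1) * decay_bound \<alpha> l" by (simp add: mult_ac)
    qed
    show "AE l in lborel. (\<lambda>k. near k l) \<longlonglongrightarrow> (cmod (G\<^sub>0 l))\<^sup>2 * f 0"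
    proof (rule AE_I2)
      fix l
      have e: "(\<lambda>k. \<eta> k * l) \<longlonglongrightarrow> 0" using tendsto_mult_right[OF \<eta>(2), of l] by simp
      have "(\<lambda>k. ?F k l) \<longlonglongrightarrow> (cmod (G\<^sub>0 l))\<^sup>2 * f 0"
        by (intro tendsto_intros lim isCont_tendsto_compose[OF f(2) e])
      moreover have "\<forall>\<^sub>F k in sequentially. \<bar>\<eta> k * l\<bar> < \<delta>"
        using order_tendstoD(2)[OF tendsto_rabs_zero[OF e] \<delta>(1)] .
      hence "\<forall>\<^sub>F k in sequentially. ?F k l = near k l"
        by eventually_elim (simp add: near_def)
      ultimately show "(\<lambda>k. near k l) \<longlonglongrightarrow> (cmod (G\<^sub>0 l))\<^sup>2 * f 0" by (rule Lim_transform_eventually)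
    qed
  qed auto
  moreover have "(\<lambda>k. ?far k) \<longlonglongrightarrow> 0"
  proof (rule Lim_null_comparison)
    define I where "I = (LBINT l. \<bar>f l\<bar>)"
    let ?B = "\<lambda>k. K\<^sup>2 * \<delta> powr (- 2 * \<alpha>) * I * \<eta> k powr (2 * \<alpha> - 1)"
    show "\<forall>\<^sub>F k in sequentially. norm (?far k) \<le> ?B k"
    proof (intro always_eventually allI)
      fix k
      have "norm (?far k) \<le> (LBINT l. norm (far k l))" by (rule integral_norm_bound)
      also have "\<dots> \<le> (LBINT l. K\<^sup>2 * (\<delta> / \<eta> k) powr (- 2 * \<alpha>) * \<bar>f (\<eta> k * l)\<bar>)"
      proof (rule integral_mono)
        fix l
        show "norm (far k l) \<le> K\<^sup>2 * (\<delta> / \<eta> k) powr (- 2 * \<alpha>) * \<bar>f (\<eta> k * l)\<bar>"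
        proof (cases "\<bar>\<eta> k * l\<bar> < \<delta>")
          case False
          hence "\<delta> \<le> \<bar>l\<bar> * \<eta> k" using \<eta>(1)[of k] by (simp add: abs_mult mult.commute)
          hence l: "\<delta> / \<eta> k \<le> \<bar>l\<bar>" using \<eta>(1)[of k] by (simp add: pos_divide_le_eq)
          have pos: "\<delta> / \<eta> k > 0" using \<delta>(1) \<eta>(1)[of k] by simp
          hence l0: "l \<noteq> 0" using l by auto
          have "(cmod (G k l))\<^sup>2 \<le> K\<^sup>2 * \<bar>l\<bar> powr (- 2 * \<alpha>)" by (rule sq[OF l0])
          also have "\<dots> \<le> K\<^sup>2 * (\<delta> / \<eta> k) powr (- 2 * \<alpha>)"
            using l pos \<alpha> by (intro mult_left_mono powr_mono2') auto
          finally have "(cmod (G k l))\<^sup>2 * \<bar>f (\<eta> k * l)\<bar> \<le> K\<^sup>2 * (\<delta> / \<eta> k) powr (- 2 * \<alpha>) * \<bar>f (\<eta> k * l)\<bar>"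
            by (rule mult_right_mono) simp
          thus ?thesis using False by (simp add: far_def abs_mult)
        qed (simp add: far_def)
      qed (use If[of k] si[of k] in auto)
      also have "\<dots> = K\<^sup>2 * (\<delta> / \<eta> k) powr (- 2 * \<alpha>) * (I / \<eta> k)"
      proof -
        have "I = \<bar>\<eta> k\<bar> *\<^sub>R (LBINT l. \<bar>f (0 + \<eta> k * l)\<bar>)"
          unfolding I_def using \<eta>(1)[of k] by (intro lborel_integral_real_affine) simp
        hence "(LBINT l. \<bar>f (\<eta> k * l)\<bar>) = I / \<eta> k" using \<eta>(1)[of k] by simp
        thus ?thesis by simp
      qed
      \<comment> \<open>The decay of G at |l| \<ge> \<delta>/\<eta> contributes \<eta>^(2\<alpha>),
        the change of variables in the integral of |f(\<eta> l)| costs 1/\<eta>. The exponent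
        2\<alpha> - 1 is positive.\<close>
      also have "(\<delta> / \<eta> k) powr (- 2 * \<alpha>) * (I / \<eta> k) = \<delta> powr (- 2 * \<alpha>) * I * \<eta> k powr (2 * \<alpha> - 1)"
        using \<delta>(1) \<eta>(1)[of k] by (simp add: powr_divide powr_diff powr_minus field_simps)
      hence "K\<^sup>2 * (\<delta> / \<eta> k) powr (- 2 * \<alpha>) * (I / \<eta> k) = ?B k"
        by (simp only: mult.assoc)
      finally show "norm (?far k) \<le> ?B k" .
    qed
    have "(\<lambda>k. \<eta> k powr (2 * \<alpha> - 1)) \<longlonglongrightarrow> 0 powr (2 * \<alpha> - 1)"
      using \<alpha> \<eta> by (intro tendsto_powr') (auto intro: always_eventually less_imp_le)
    from tendsto_mult_right_zero[OF this[simplified]]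
    show "(\<lambda>k. ?B k) \<longlonglongrightarrow> 0" .
  qed
  ultimately have "(\<lambda>k. (?near k) + (?far k)) \<longlonglongrightarrow> (LBINT l. (cmod (G\<^sub>0 l))\<^sup>2 * f 0) + 0"
    by (rule tendsto_add)
  thus ?thesis unfolding split by (simp add: mult.commute)
qed

section \<open>The rescaled solution\<close>

text \<open>Transform of the linear combination with weights \<open>\<theta>\<close> of the rescaled solution at the points \<open>p\<close>;
  \<open>\<eta> = 0\<close> gives the limit field.\<close>

definition profile ::
    "real \<Rightarrow> real \<Rightarrow> real \<Rightarrow> real \<Rightarrow> real ^ 'm \<Rightarrow> ('m::finite \<Rightarrow> real \<times> real) \<Rightarrow> real \<Rightarrow> real \<Rightarrow> complex" where
  "profile \<beta> \<mu> \<alpha> \<gamma> \<theta> p \<eta> l = (\<Sum>i\<in>UNIV. of_real (\<theta> $ i) * (exp (\<i> * of_real (snd (p i) * l)) *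
     of_real (mittag_leffler \<beta> (- (\<mu> * fst (p i) powr \<beta> * (\<bar>l\<bar> powr \<alpha> * (1 + (\<eta> * l)\<^sup>2) powr (\<gamma> / 2)))))))"

lemma mittag_leffler_measurable:
  assumes "0 < \<beta>"
  shows "mittag_leffler \<beta> \<in> borel_measurable borel"
  using continuous_on_mittag_leffler[OF assms] by (rule borel_measurable_continuous_onI)

lemma mittag_leffler_bounds:
  assumes "0 < \<beta>" "\<beta> \<le> 1"
  obtains D where "D > 0" "\<And>x. x \<ge> 0 \<Longrightarrow> \<bar>mittag_leffler \<beta> (- x)\<bar> \<le> D"
    "\<And>x. x > 0 \<Longrightarrow> \<bar>mittag_leffler \<beta> (- x)\<bar> \<le> D / x"
proof -
  obtain D where D: "D > 0" "\<And>x. x \<ge> 0 \<Longrightarrow> \<bar>mittag_leffler \<beta> (- x)\<bar> \<le> D / (1 + x)"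
    by (rule mittag_leffler_bound[OF assms]) (rule that)
  show thesis
  proof (rule that[OF D(1)])
    fix x :: real assume x: "x \<ge> 0"
    have "D / (1 + x) \<le> D / 1" using x D(1) by (intro divide_left_mono) auto
    thus "\<bar>mittag_leffler \<beta> (- x)\<bar> \<le> D" using D(2)[OF x] by simp
  next
    fix x :: real assume x: "x > 0"
    have "D / (1 + x) \<le> D / x" using x D(1) by (intro divide_left_mono) auto
    thus "\<bar>mittag_leffler \<beta> (- x)\<bar> \<le> D / x" using D(2)[of x] x by simp
  qed
qed

lemma profile_measurable:
  assumes "0 < \<beta>"
  shows "profile \<beta> \<mu> \<alpha> \<gamma> \<theta> p \<eta> \<in> borel_measurable borel"
proof -
  note [measurable] = mittag_leffler_measurable[OF assms]
  show ?thesis unfolding profile_def[abs_def] by measurable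
qed

text \<open>The Bessel factor (1 + (\<eta> l)^2)^(\<gamma>/2) is at least 1, so dropping it only
  weakens the bound D/x. Hence K is uniform in \<eta>, as dominated convergence demands.\<close>

lemma profile_bounds:
  fixes p :: "'m::finite \<Rightarrow> real \<times> real"
  assumes b: "0 < \<beta>" "\<beta> \<le> 1" and \<mu>: "\<mu> > 0" and \<gamma>: "\<gamma> > 0" and p: "\<And>i. fst (p i) > 0"
  obtains K where "\<And>\<eta> l. cmod (profile \<beta> \<mu> \<alpha> \<gamma> \<theta> p \<eta> l) \<le> K"
    "\<And>\<eta> l. l \<noteq> 0 \<Longrightarrow> cmod (profile \<beta> \<mu> \<alpha> \<gamma> \<theta> p \<eta> l) \<le> K * \<bar>l\<bar> powr (- \<alpha>)"
proof -
  let ?P = "profile \<beta> \<mu> \<alpha> \<gamma> \<theta> p"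
  obtain D where D: "D > 0" "\<And>x. x \<ge> 0 \<Longrightarrow> \<bar>mittag_leffler \<beta> (- x)\<bar> \<le> D"
    "\<And>x. x > 0 \<Longrightarrow> \<bar>mittag_leffler \<beta> (- x)\<bar> \<le> D / x"
    by (rule mittag_leffler_bounds[OF b]) (rule that)
  define m where "m = (\<lambda>i. \<mu> * fst (p i) powr \<beta>)"
  have m_eq: "\<mu> * fst (p i) powr \<beta> = m i" for i by (simp add: m_def)
  have m: "m i > 0" for i using \<mu> p[of i] by (simp add: m_def)
  define e where "e = (\<lambda>i \<eta> l. mittag_leffler \<beta> (- (\<mu> * fst (p i) powr \<beta> * (\<bar>l\<bar> powr \<alpha> * (1 + (\<eta> * l)\<^sup>2) powr (\<gamma> / 2)))))"
  define K where "K = (\<Sum>i\<in>UNIV. \<bar>\<theta> $ i\<bar> * (D + D / m i))"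
  have le: "cmod (?P \<eta> l) \<le> (\<Sum>i\<in>UNIV. \<bar>\<theta> $ i\<bar> * \<bar>e i \<eta> l\<bar>)" for \<eta> l
    unfolding profile_def
    by (rule order_trans[OF norm_sum]) (simp add: norm_mult e_def)
  have "cmod (?P \<eta> l) \<le> K" for \<eta> l
  proof -
    have "\<bar>e i \<eta> l\<bar> \<le> D + D / m i" for i
    proof -
      have "\<bar>e i \<eta> l\<bar> \<le> D" unfolding e_def using \<mu> p[of i] by (intro D(2)) auto
      moreover have "D / m i > 0" using D m[of i] by simp
      ultimately show ?thesis by linarith
    qed
    thus ?thesis unfolding K_def by (intro order_trans[OF le] sum_mono mult_left_mono) auto
  qed
  moreover have "cmod (?P \<eta> l) \<le> K * \<bar>l\<bar> powr (- \<alpha>)" if l: "l \<noteq> 0" for \<eta> l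
  proof -
    have "\<bar>e i \<eta> l\<bar> \<le> (D + D / m i) * \<bar>l\<bar> powr (- \<alpha>)" for i
    proof -
      define B where "B = (1 + (\<eta> * l)\<^sup>2) powr (\<gamma> / 2)"
      have B: "B \<ge> 1" unfolding B_def using \<gamma> by (intro ge_one_powr_ge_zero) auto
      have x: "m i * \<bar>l\<bar> powr \<alpha> > 0" using m[of i] l by simp
      have "m i * \<bar>l\<bar> powr \<alpha> * 1 \<le> m i * \<bar>l\<bar> powr \<alpha> * B" using x B by (intro mult_left_mono) auto
      hence y: "m i * \<bar>l\<bar> powr \<alpha> \<le> m i * (\<bar>l\<bar> powr \<alpha> * B)" by simp
      have "\<bar>e i \<eta> l\<bar> \<le> D / (m i * (\<bar>l\<bar> powr \<alpha> * B))"
        unfolding e_def m_eq B_def[symmetric] using x y by (intro D(3)) auto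
      also have "\<dots> \<le> D / (m i * \<bar>l\<bar> powr \<alpha>)"
        using D(1) by (intro divide_left_mono[OF y] mult_pos_pos[OF less_le_trans[OF x y] x]) simp
      also have "\<dots> = D / m i * \<bar>l\<bar> powr (- \<alpha>)" by (simp add: powr_minus divide_inverse)
      also have "\<dots> \<le> (D + D / m i) * \<bar>l\<bar> powr (- \<alpha>)" using D(1) by (intro mult_right_mono) auto
      finally show ?thesis .
    qed
    hence "(\<Sum>i\<in>UNIV. \<bar>\<theta> $ i\<bar> * \<bar>e i \<eta> l\<bar>) \<le> (\<Sum>i\<in>UNIV. \<bar>\<theta> $ i\<bar> * ((D + D / m i) * \<bar>l\<bar> powr (- \<alpha>)))"
      by (intro sum_mono mult_left_mono) auto
    also have "\<dots> = K * \<bar>l\<bar> powr (- \<alpha>)" by (simp add: K_def sum_distrib_right mult.assoc)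
    finally show ?thesis using le[of \<eta> l] by simp
  qed
  ultimately show thesis using that by blast
qed

lemma profile_tendsto:
  assumes b: "0 < \<beta>" and \<eta>: "\<eta> \<longlonglongrightarrow> 0"
  shows "(\<lambda>k. profile \<beta> \<mu> \<alpha> \<gamma> \<theta> p (\<eta> k) l) \<longlonglongrightarrow> profile \<beta> \<mu> \<alpha> \<gamma> \<theta> p 0 l"
proof -
  have lim: "(\<lambda>k. mittag_leffler \<beta> (h k)) \<longlonglongrightarrow> mittag_leffler \<beta> c" if "h \<longlonglongrightarrow> c" for h c
    using DERIV_isCont[OF has_real_derivative_mittag_leffler[OF b]] that by (rule isCont_tendsto_compose)
  show ?thesis unfolding profile_def by (intro tendsto_intros lim \<eta>) auto
qed

lemma profile_limit:
  fixes p :: "'m::finite \<Rightarrow> real \<times> real"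
  assumes b: "0 < \<beta>" "\<beta> \<le> 1" and \<mu>: "\<mu> > 0" and \<gamma>: "\<gamma> > 0" and \<alpha>: "\<alpha> > 1 / 2" and p: "\<And>i. fst (p i) > 0"
    and f: "integrable lborel f" "isCont f 0"
  shows "((\<lambda>\<eta>. \<integral>l. (cmod (profile \<beta> \<mu> \<alpha> \<gamma> \<theta> p \<eta> l))\<^sup>2 * f (\<eta> * l) \<partial>lborel) \<longlongrightarrow>
    f 0 * (LBINT l. (cmod (profile \<beta> \<mu> \<alpha> \<gamma> \<theta> p 0 l))\<^sup>2)) (at_right 0)"
  unfolding tendsto_at_iff_sequentially
proof (intro allI impI)
  fix \<eta> :: "nat \<Rightarrow> real" assume \<eta>: "\<forall>k. \<eta> k \<in> {0<..} - {0}" "\<eta> \<longlonglongrightarrow> 0"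
  obtain K where K: "\<And>\<eta> l. cmod (profile \<beta> \<mu> \<alpha> \<gamma> \<theta> p \<eta> l) \<le> K"
    "\<And>\<eta> l. l \<noteq> 0 \<Longrightarrow> cmod (profile \<beta> \<mu> \<alpha> \<gamma> \<theta> p \<eta> l) \<le> K * \<bar>l\<bar> powr (- \<alpha>)"
    by (rule profile_bounds[of \<beta> \<mu> \<gamma> p \<alpha> \<theta>, OF b \<mu> \<gamma> p]) (rule that)
  show "((\<lambda>\<eta>. \<integral>l. (cmod (profile \<beta> \<mu> \<alpha> \<gamma> \<theta> p \<eta> l))\<^sup>2 * f (\<eta> * l) \<partial>lborel) \<circ> \<eta>) \<longlonglongrightarrow>
    f 0 * (LBINT l. (cmod (profile \<beta> \<mu> \<alpha> \<gamma> \<theta> p 0 l))\<^sup>2)"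
    unfolding comp_def
    by (rule scaled_L2_limit[OF \<alpha> _ \<eta>(2) f profile_measurable profile_measurable profile_tendsto K])
       (use \<eta> b in auto)
qed

lemma integral_even:
  fixes h :: "real \<Rightarrow> real"
  assumes h: "integrable lborel h" and even: "\<And>l. h (- l) = h l"
  shows "(LBINT l. h l) = 2 * (LBINT l:{0<..}. h l)"
proof -
  define a where "a = (\<lambda>l. indicator {0<..} l *\<^sub>R h l)"
  have [measurable]: "h \<in> borel_measurable borel" using h by auto
  have ia: "integrable lborel a" unfolding a_def using h by (intro integrable_mult_indicator) auto
  have ia': "integrable lborel (\<lambda>l. a (- l))"
    using lborel_integrable_real_affine[OF ia, of "-1" 0] by simp
  have "(LBINT l. h l) = (LBINT l. a l + a (- l))"
  proof (rule integral_cong_AE)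
    show "AE l in lborel. h l = a l + a (- l)"
      using AE_lborel_singleton[of 0] by eventually_elim (auto simp: a_def even indicator_def)
    show "(\<lambda>l. a l + a (- l)) \<in> borel_measurable lborel" using ia ia' by auto
  qed (use h in auto)
  also have "\<dots> = (LBINT l. a l) + (LBINT l. a (- l))" using ia ia' by simp
  also have "(LBINT l. a (- l)) = (LBINT l. a l)"
    using lborel_integral_real_affine[of "-1" a 0] by simp
  finally show ?thesis by (simp add: a_def set_lebesgue_integral_def)
qed

context white_noise
begin

lemma white_noise_integral_scale:
  fixes a :: real
  assumes "has_white_noise_integral M W g X"
  shows "has_white_noise_integral M W (\<lambda>l. of_real a * g l) (\<lambda>\<omega>. a * X \<omega>)"
  using white_noise_integral_add_mult[OF assms white_noise_integral_zero, of a 0] by simp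

text \<open>Polarization: X + Y and X - Y are the integrals of g + h and g - h, and their second
  moments are already known.\<close>

lemma white_noise_integral_covariance:
  assumes X: "has_white_noise_integral M W g X" and Y: "has_white_noise_integral M W h Y"
  shows "integrable lborel (\<lambda>l. Re (g l * cnj (h l)))"
    and "covariance M X Y = (LBINT l. Re (g l * cnj (h l)))"
proof -
  have P: "has_white_noise_integral M W (\<lambda>l. g l + h l) (\<lambda>\<omega>. X \<omega> + Y \<omega>)"
    using white_noise_integral_add_mult[OF X Y, of 1 1] by simp
  have N: "has_white_noise_integral M W (\<lambda>l. g l - h l) (\<lambda>\<omega>. X \<omega> - Y \<omega>)"
    using white_noise_integral_add_mult[OF X Y, of 1 "-1"] by simp
  have e: "Re (a * cnj b) = ((cmod (a + b))\<^sup>2 - (cmod (a - b))\<^sup>2) / 4" for a b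
    unfolding cmod_power2 by (simp add: power2_eq_square algebra_simps)
  show "integrable lborel (\<lambda>l. Re (g l * cnj (h l)))"
    unfolding e using white_noise_integral_gaussian(1)[OF P] white_noise_integral_gaussian(1)[OF N] by simp
  have "covariance M X Y = expectation (\<lambda>\<omega>. ((X \<omega> + Y \<omega>)\<^sup>2 - (X \<omega> - Y \<omega>)\<^sup>2) / 4)"
    unfolding covariance_def white_noise_integral_gaussian(3)[OF X] white_noise_integral_gaussian(3)[OF Y]
    by (intro Bochner_Integration.integral_cong refl) (simp add: power2_eq_square algebra_simps)
  also have "\<dots> = (expectation (\<lambda>\<omega>. (X \<omega> + Y \<omega>)\<^sup>2) - expectation (\<lambda>\<omega>. (X \<omega> - Y \<omega>)\<^sup>2)) / 4"
    using white_noise_integral_gaussian(4)[OF P] white_noise_integral_gaussian(4)[OF N] by simp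
  also have "\<dots> = (LBINT l. Re (g l * cnj (h l)))"
    unfolding e white_noise_integral_gaussian(5)[OF P] white_noise_integral_gaussian(5)[OF N]
    using white_noise_integral_gaussian(1)[OF P] white_noise_integral_gaussian(1)[OF N] by simp
  finally show "covariance M X Y = (LBINT l. Re (g l * cnj (h l)))" .
qed

text \<open>Ensures that the choice in \<open>white_noise_integral\<close> yields a genuine integral
  for the limit field. Square integrability at infinity comes from the order |l|^(-2\<alpha>), with
  \<alpha> > 1/2.\<close>

lemma white_noise_integral_mittag_leffler:
  fixes x t :: real
  assumes b: "0 < \<beta>" "\<beta> \<le> 1" and \<mu>: "\<mu> > 0" and \<alpha>: "\<alpha> > 1 / 2" and t: "t > 0"
  defines "g \<equiv> \<lambda>l. exp (\<i> * of_real (l * x)) * of_real (mittag_leffler \<beta> (- \<mu> * t powr \<beta> * \<bar>l\<bar> powr \<alpha>))"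
  shows "has_white_noise_integral M W g (white_noise_integral M W g)"
proof (rule white_noise_integral_works)
  note [measurable] = mittag_leffler_measurable[OF b(1)]
  show g[measurable]: "g \<in> borel_measurable borel" unfolding g_def by measurable
  show "g (- l) = cnj (g l)" for l by (simp add: g_def exp_cnj)
  obtain D where D: "D > 0" "\<And>x. x \<ge> 0 \<Longrightarrow> \<bar>mittag_leffler \<beta> (- x)\<bar> \<le> D"
    "\<And>x. x > 0 \<Longrightarrow> \<bar>mittag_leffler \<beta> (- x)\<bar> \<le> D / x"
    by (rule mittag_leffler_bounds[OF b]) (rule that)
  define m where "m = \<mu> * t powr \<beta>"
  have m: "m > 0" using \<mu> t by (simp add: m_def)
  have gm: "cmod (g l) = \<bar>mittag_leffler \<beta> (- (m * \<bar>l\<bar> powr \<alpha>))\<bar>" for l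
    by (simp add: g_def m_def norm_mult)
  show "integrable lborel (\<lambda>l. (cmod (g l))\<^sup>2)"
  proof (rule Bochner_Integration.integrable_bound)
    show "integrable lborel (\<lambda>l. (D\<^sup>2 + (D / m)\<^sup>2) * decay_bound \<alpha> l)"
      by (intro integrable_mult_right integrable_decay_bound \<alpha>)
    have "(cmod (g l))\<^sup>2 \<le> (D\<^sup>2 + (D / m)\<^sup>2) * decay_bound \<alpha> l" for l
    proof (cases "\<bar>l\<bar> \<le> 1")
      case True
      have "cmod (g l) \<le> D" unfolding gm using m by (intro D(2)) simp
      hence "(cmod (g l))\<^sup>2 \<le> D\<^sup>2" by (intro power_mono) auto
      thus ?thesis using True by (simp add: decay_bound_def add_increasing2)
    next
      case False
      have "cmod (g l) \<le> D / (m * \<bar>l\<bar> powr \<alpha>)" unfolding gm using m False by (intro D(3)) auto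
      also have "\<dots> = D / m * \<bar>l\<bar> powr (- \<alpha>)" by (simp add: powr_minus divide_inverse)
      finally have "(cmod (g l))\<^sup>2 \<le> (D / m * \<bar>l\<bar> powr (- \<alpha>))\<^sup>2" by (intro power_mono) auto
      also have "\<dots> = (D / m)\<^sup>2 * \<bar>l\<bar> powr (- 2 * \<alpha>)"
        unfolding power_mult_distrib by (simp add: power2_eq_square powr_add[symmetric])
      also have "\<dots> \<le> (D\<^sup>2 + (D / m)\<^sup>2) * \<bar>l\<bar> powr (- 2 * \<alpha>)" by (intro mult_right_mono) auto
      finally show ?thesis using False by (simp add: decay_bound_def)
    qed
    thus "AE l in lborel. norm ((cmod (g l))\<^sup>2) \<le> norm ((D\<^sup>2 + (D / m)\<^sup>2) * decay_bound \<alpha> l)"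
      by (intro AE_I2) (smt (verit) real_norm_def zero_le_power2)
  qed simp
qed

end

text \<open>Since \<eta>^\<alpha> = \<epsilon>^\<beta>, the time factor is absorbed by the
  frequency: |l|^\<alpha> (t/\<epsilon>)^\<beta> = |l/\<eta>|^\<alpha> t^\<beta>. In the variable
  l/\<eta> the Bessel factor carries \<eta> explicitly and flattens to 1 in the limit.\<close>

lemma rescaled_solution_integrand:
  fixes p :: "'m::finite \<Rightarrow> real \<times> real" and \<beta> :: real
  assumes \<epsilon>: "\<epsilon> > 0" and \<alpha>: "\<alpha> > 1 / 2" and p: "\<And>i. fst (p i) > 0"
  defines "\<eta> \<equiv> \<epsilon> powr (\<beta> / \<alpha>)"
  shows "(\<Sum>i\<in>UNIV. of_real (\<theta> $ i * \<epsilon> powr (- \<beta> / (2 * \<alpha>))) *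
      (exp (\<i> * of_real (snd (p i) / \<eta> * l)) *
        of_real (mittag_leffler \<beta> (- \<mu> * riesz_bessel_symbol \<alpha> \<gamma> l * (fst (p i) / \<epsilon>) powr \<beta>) * sqrt (f l)))) =
    of_real (\<epsilon> powr (- \<beta> / (2 * \<alpha>)) * sqrt (f l)) * profile \<beta> \<mu> \<alpha> \<gamma> \<theta> p \<eta> (l / \<eta>)"
proof -
  have \<eta>: "\<eta> > 0" using \<epsilon> by (simp add: \<eta>_def)
  have \<eta>\<alpha>: "\<eta> powr \<alpha> = \<epsilon> powr \<beta>" using \<alpha> by (simp add: \<eta>_def powr_powr)
  have "\<mu> * riesz_bessel_symbol \<alpha> \<gamma> l * (fst (p i) / \<epsilon>) powr \<beta> =
      \<mu> * fst (p i) powr \<beta> * (\<bar>l / \<eta>\<bar> powr \<alpha> * (1 + (\<eta> * (l / \<eta>))\<^sup>2) powr (\<gamma> / 2))" for i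
    using \<epsilon> \<eta> p[of i]
    by (simp add: riesz_bessel_symbol_def abs_divide powr_divide \<eta>\<alpha>)
  hence e: "- \<mu> * riesz_bessel_symbol \<alpha> \<gamma> l * (fst (p i) / \<epsilon>) powr \<beta> =
      - (\<mu> * fst (p i) powr \<beta> * (\<bar>l / \<eta>\<bar> powr \<alpha> * (1 + (\<eta> * (l / \<eta>))\<^sup>2) powr (\<gamma> / 2)))" for i
    by simp
  show ?thesis unfolding profile_def e sum_distrib_left
    by (intro sum.cong refl) (simp only: of_real_mult mult_ac times_divide_eq_left times_divide_eq_right)
qed

text \<open>The squared prefactor is \<epsilon>^(-\<beta>/\<alpha>) = 1/\<eta>, which cancels the
  Jacobian of the substitution l \<mapsto> \<eta> l. This is also where \<open>f\<close> is
  exchanged for its representative \<open>h\<close>.\<close>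

lemma rescaled_variance:
  fixes p :: "'m::finite \<Rightarrow> real \<times> real" and \<beta> :: real
  assumes \<epsilon>: "\<epsilon> > 0" and \<alpha>: "\<alpha> > 1 / 2" and \<beta>: "\<beta> > 0"
    and f: "\<And>l. f l \<ge> 0" "AE l in lborel. f l = h l"
    and [measurable]: "f \<in> borel_measurable borel" "h \<in> borel_measurable borel"
  defines "\<eta> \<equiv> \<epsilon> powr (\<beta> / \<alpha>)"
  shows "(LBINT l. (cmod (of_real (\<epsilon> powr (- \<beta> / (2 * \<alpha>)) * sqrt (f l)) * profile \<beta> \<mu> \<alpha> \<gamma> \<theta> p \<eta> (l / \<eta>)))\<^sup>2) =
    (LBINT l. (cmod (profile \<beta> \<mu> \<alpha> \<gamma> \<theta> p \<eta> l))\<^sup>2 * h (\<eta> * l))"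
proof -
  have \<eta>: "\<eta> > 0" using \<epsilon> by (simp add: \<eta>_def)
  note [measurable] = profile_measurable[OF \<beta>]
  define P where "P = profile \<beta> \<mu> \<alpha> \<gamma> \<theta> p \<eta>"
  have [measurable]: "P \<in> borel_measurable borel" unfolding P_def by measurable
  let ?L = "\<lambda>l. (cmod (of_real (\<epsilon> powr (- \<beta> / (2 * \<alpha>)) * sqrt (f l)) * P (l / \<eta>)))\<^sup>2"
  have s: "(\<epsilon> powr (- \<beta> / (2 * \<alpha>)))\<^sup>2 = 1 / \<eta>"
  proof -
    have "(\<epsilon> powr (- \<beta> / (2 * \<alpha>)))\<^sup>2 = \<epsilon> powr (- (\<beta> / \<alpha>))"
      using \<alpha> by (simp add: power2_eq_square powr_add[symmetric] field_simps)
    thus ?thesis by (simp add: \<eta>_def powr_minus_divide)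
  qed
  have "(LBINT l. ?L l) =
      (LBINT l. 1 / \<eta> * ((cmod (P (l / \<eta>)))\<^sup>2 * h l))"
  proof (rule integral_cong_AE)
    show "AE l in lborel. ?L l =
        1 / \<eta> * ((cmod (P (l / \<eta>)))\<^sup>2 * h l)"
      using f(2)
    proof eventually_elim
      case (elim l)
      have "?L l =
          (\<epsilon> powr (- \<beta> / (2 * \<alpha>)))\<^sup>2 * (sqrt (f l))\<^sup>2 * (cmod (P (l / \<eta>)))\<^sup>2"
        unfolding norm_mult norm_of_real by (simp add: power_mult_distrib abs_mult)
      moreover have "(sqrt (f l))\<^sup>2 = h l" using f(1)[of l] elim by simp
      ultimately show ?case unfolding s by simp
    qed
  qed measurable
  also have "\<dots> = 1 / \<eta> * (LBINT l. (cmod (P (l / \<eta>)))\<^sup>2 * h l)" by (rule integral_mult_right_zero)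
  also have "(LBINT l. (cmod (P (l / \<eta>)))\<^sup>2 * h l) =
      \<bar>\<eta>\<bar> *\<^sub>R (LBINT l. (cmod (P ((0 + \<eta> * l) / \<eta>)))\<^sup>2 * h (0 + \<eta> * l))"
    using \<eta> by (intro lborel_integral_real_affine) simp
  finally show ?thesis using \<eta> by (simp add: P_def)
qed

theorem theorem3p1:
  fixes M :: "'w measure"
    and W :: "real set \<Rightarrow> 'w \<Rightarrow> complex"
    and \<xi> :: "real \<Rightarrow> 'w \<Rightarrow> real"
    and u U\<^sub>0 :: "real \<Rightarrow> real \<Rightarrow> 'w \<Rightarrow> real"
    and U :: "real \<Rightarrow> real \<Rightarrow> real \<Rightarrow> 'w \<Rightarrow> real"
    and r f :: "real \<Rightarrow> real"
    and A w \<kappa> :: "nat \<Rightarrow> real"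
    and \<alpha> \<beta> \<gamma> \<mu> C :: real
    and n :: nat
  assumes "0 < \<beta>" "\<beta> \<le> 1" "\<mu> > 0" "\<gamma> > 0" "\<alpha> > 1 / 2"
    and "prob_space M"
    and "hermitian_white_noise M W"
    and "gaussian_process M UNIV \<xi>"
    and "zero_mean_process M UNIV \<xi>"
    and "stationary_process M \<xi>"
    and "\<And>x. covariance M (\<xi> 0) (\<xi> x) = r x"
    and "\<And>x. r x = (\<Sum>j=0..n. A j * (cos (w j * x) / (1 + x\<^sup>2) powr (\<kappa> j / 2)))"
    and "(\<Sum>j=0..n. A j) = 1" "A 0 = 0" "w 0 = 0"
    and "\<And>j. j \<in> {1..n} \<Longrightarrow> w j > 0"
    and "\<And>j. j \<in> {1..n} \<Longrightarrow> 0 < \<kappa> j \<and> \<kappa> j < 1"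
    and "spectral_density f r"
    and "\<And>x. has_white_noise_integral M W
           (\<lambda>l. exp (\<i> * of_real (x * l)) * of_real (sqrt (f l))) (\<xi> x)"
    and "mean_square_solution M W f \<beta> \<mu> \<gamma> \<alpha> \<xi> u"
    and "\<And>\<epsilon> t x \<omega>. U \<epsilon> t x \<omega> =
           \<epsilon> powr (- \<beta> / (2 * \<alpha>)) * u (t / \<epsilon>) (x / \<epsilon> powr (\<beta> / \<alpha>)) \<omega>"
    and "C = (\<Sum>j=1..n. c1 (\<kappa> j) * A j * bessel_K ((\<kappa> j - 1) / 2) \<bar>w j\<bar> *
                          \<bar>w j\<bar> powr ((\<kappa> j - 1) / 2))"
    and "\<And>t x \<omega>. U\<^sub>0 t x \<omega> = sqrt C *
           white_noise_integral M W
             (\<lambda>l. exp (\<i> * of_real (l * x)) *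
                   of_real (mittag_leffler \<beta> (- \<mu> * t powr \<beta> * \<bar>l\<bar> powr \<alpha>))) \<omega>"
  shows "(\<forall>p :: 'm::finite \<Rightarrow> real \<times> real. (\<forall>i. fst (p i) > 0) \<longrightarrow>
            weakly_converges (\<lambda>\<epsilon>. fin_dim_distr M (U \<epsilon>) p) (fin_dim_distr M U\<^sub>0 p) (at_right 0))
       \<and> gaussian_process M ({0<..} \<times> UNIV) (\<lambda>(t, x). U\<^sub>0 t x)
       \<and> zero_mean_process M ({0<..} \<times> UNIV) (\<lambda>(t, x). U\<^sub>0 t x)
       \<and> (\<forall>t>0. \<forall>t'>0. \<forall>x x'. covariance M (U\<^sub>0 t x) (U\<^sub>0 t' x') =
            (\<Sum>j=1..n. 2 * c1 (\<kappa> j) * A j * bessel_K ((\<kappa> j - 1) / 2) \<bar>w j\<bar> *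
                          \<bar>w j\<bar> powr ((\<kappa> j - 1) / 2) *
              (LBINT l:{0<..}. cos (l * (x - x')) *
                 mittag_leffler \<beta> (- \<mu> * t powr \<beta> * \<bar>l\<bar> powr \<alpha>) *
                 mittag_leffler \<beta> (- \<mu> * t' powr \<beta> * \<bar>l\<bar> powr \<alpha>))))"
proof -
  let ?W = "has_white_noise_integral M W" and ?E = "\<lambda>t l. mittag_leffler \<beta> (- \<mu> * t powr \<beta> * \<bar>l\<bar> powr \<alpha>)"
  interpret white_noise M W
    using \<open>prob_space M\<close> \<open>hermitian_white_noise M W\<close>
    by (simp add: white_noise_def white_noise_axioms_def)
  note \<beta> = \<open>0 < \<beta>\<close> \<open>\<beta> \<le> 1\<close> and \<mu> = \<open>\<mu> > 0\<close> and \<gamma> = \<open>\<gamma> > 0\<close> and \<alpha> = \<open>\<alpha> > 1 / 2\<close>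
  have \<kappa>: "\<kappa> j > 0" if "j \<in> {1..n}" for j using assms(17)[OF that] by simp
  have w: "w j \<noteq> 0" if "j \<in> {1..n}" for j using assms(16)[OF that] by simp
  define h where "h = covariance_density n A w \<kappa>"
  have r: "r x = (\<Sum>j=1..n. A j * (cos (w j * x) / (1 + x\<^sup>2) powr (\<kappa> j / 2)))" for x
    unfolding assms(12) using \<open>A 0 = 0\<close> by (simp add: sum.atLeast_Suc_atMost)
  have f: "\<And>l. 0 \<le> f l" "integrable lborel f"
    using \<open>spectral_density f r\<close> by (auto simp: spectral_density_def)
  have fh: "AE l in lborel. f l = h l"
    unfolding h_def by (rule spectral_density_AE_eq[OF \<open>spectral_density f r\<close> r \<kappa>])
  have ih: "integrable lborel h" unfolding h_def by (rule integrable_covariance_density[OF \<kappa>])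
  have h0: "isCont h 0" "h 0 = C"
    unfolding h_def assms(22) using covariance_density_0[of n \<kappa> w A] \<kappa> w by blast+
  \<comment> \<open>\<open>C\<close> stands under a square root in the limit field, so variances and
    covariances have the factor C only once C \<ge> 0 is known.\<close>
  have "AE l in lborel. h l \<ge> 0" using fh by eventually_elim (metis f(1))
  from AE_nonneg_isCont[OF this h0(1)] have C: "C \<ge> 0" by (simp add: h0(2))

  define g where "g = (\<lambda>t x l. exp (\<i> * of_real (l * x)) *
      of_real (?E t l))"
  have U0: "?W (\<lambda>l. of_real (sqrt C) * g t x l) (U\<^sub>0 t x)" if "t > 0" for t x
  proof -
    have "U\<^sub>0 t x = (\<lambda>\<omega>. sqrt C * white_noise_integral M W (g t x) \<omega>)"
      by (simp add: fun_eq_iff assms(23) g_def)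
    thus ?thesis
      using white_noise_integral_scale[OF white_noise_integral_mittag_leffler[OF \<beta> \<mu> \<alpha> that, of x], of "sqrt C"]
      by (simp add: g_def)
  qed

  have "weakly_converges (\<lambda>\<epsilon>. fin_dim_distr M (U \<epsilon>) p) (fin_dim_distr M U\<^sub>0 p) (at_right 0)"
    if p: "\<forall>i. fst (p i) > 0" for p :: "'m \<Rightarrow> real \<times> real"
  proof -
    define Y where "Y = (\<lambda>\<epsilon> \<omega>. \<chi> i. U \<epsilon> (fst (p i)) (snd (p i)) \<omega>)"
    define Y\<^sub>0 where "Y\<^sub>0 = (\<lambda>\<omega>. \<chi> i. U\<^sub>0 (fst (p i)) (snd (p i)) \<omega>)"
    let ?P = "\<lambda>\<theta>. profile \<beta> \<mu> \<alpha> \<gamma> \<theta> p" and ?Y = "\<lambda>\<epsilon> \<theta> \<omega>. \<theta> \<bullet> Y \<epsilon> \<omega>"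
    define v where "v = (\<lambda>\<epsilon> \<theta>. \<integral>l. (cmod (?P \<theta> (\<epsilon> powr (\<beta> / \<alpha>)) l))\<^sup>2 * h (\<epsilon> powr (\<beta> / \<alpha>) * l) \<partial>lborel)"
    define v\<^sub>0 where "v\<^sub>0 = (\<lambda>\<theta>. h 0 * (LBINT l. (cmod (?P \<theta> 0 l))\<^sup>2))"
    have u: "has_white_noise_integral M W
        (\<lambda>l. exp (\<i> * of_real (x * l)) *
              of_real (mittag_leffler \<beta> (- \<mu> * riesz_bessel_symbol \<alpha> \<gamma> l * t powr \<beta>) * sqrt (f l)))
        (u t x)" if "t > 0" for t x
      using \<open>mean_square_solution M W f \<beta> \<mu> \<gamma> \<alpha> \<xi> u\<close> that unfolding mean_square_solution_def by blast
    \<comment> \<open>The transform k stays existential: Gaussianity and the variance depend on its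
      L2 norm alone.\<close>
    have WY: "\<exists>k. ?W k (?Y \<epsilon> \<theta>) \<and> (LBINT l. (cmod (k l))\<^sup>2) = v \<epsilon> \<theta>"
      if \<epsilon>: "\<epsilon> > 0" for \<epsilon> \<theta>
    proof -
      define \<eta> where "\<eta> = \<epsilon> powr (\<beta> / \<alpha>)"
      have "has_white_noise_integral M W
          (\<lambda>l. \<Sum>i\<in>UNIV. of_real (\<theta> $ i * \<epsilon> powr (- \<beta> / (2 * \<alpha>))) *
            (exp (\<i> * of_real (snd (p i) / \<eta> * l)) *
             of_real (mittag_leffler \<beta> (- \<mu> * riesz_bessel_symbol \<alpha> \<gamma> l * (fst (p i) / \<epsilon>) powr \<beta>) * sqrt (f l))))
          (\<lambda>\<omega>. \<Sum>i\<in>UNIV. (\<theta> $ i * \<epsilon> powr (- \<beta> / (2 * \<alpha>))) * u (fst (p i) / \<epsilon>) (snd (p i) / \<eta>) \<omega>)"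
        using p \<epsilon> by (intro white_noise_integral_sum u) auto
      also have "(\<lambda>\<omega>. \<Sum>i\<in>UNIV. (\<theta> $ i * \<epsilon> powr (- \<beta> / (2 * \<alpha>))) * u (fst (p i) / \<epsilon>) (snd (p i) / \<eta>) \<omega>) = (?Y \<epsilon> \<theta>)"
        by (simp add: Y_def inner_vec_def assms(21) \<eta>_def mult.assoc)
      finally have W1: "has_white_noise_integral M W
          (\<lambda>l. of_real (\<epsilon> powr (- \<beta> / (2 * \<alpha>)) * sqrt (f l)) * ?P \<theta> \<eta> (l / \<eta>)) (?Y \<epsilon> \<theta>)"
        unfolding \<eta>_def rescaled_solution_integrand[where f = f, OF \<epsilon> \<alpha> p[rule_format]] .
      have "(LBINT l. (cmod (of_real (\<epsilon> powr (- \<beta> / (2 * \<alpha>)) * sqrt (f l)) * ?P \<theta> \<eta> (l / \<eta>)))\<^sup>2) = v \<epsilon> \<theta>"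
        unfolding \<eta>_def v_def using f(2) ih by (intro rescaled_variance \<epsilon> \<alpha> \<beta>(1) f(1) fh) auto
      with W1 show ?thesis by blast
    qed
    have W0: "\<exists>k. ?W k (\<lambda>\<omega>. \<theta> \<bullet> Y\<^sub>0 \<omega>) \<and> (LBINT l. (cmod (k l))\<^sup>2) = v\<^sub>0 \<theta>" for \<theta>
    proof -
      have "has_white_noise_integral M W
          (\<lambda>l. \<Sum>i\<in>UNIV. of_real (\<theta> $ i) * (of_real (sqrt C) * g (fst (p i)) (snd (p i)) l))
          (\<lambda>\<omega>. \<Sum>i\<in>UNIV. \<theta> $ i * U\<^sub>0 (fst (p i)) (snd (p i)) \<omega>)"
        using p by (intro white_noise_integral_sum U0) auto
      moreover have "(\<Sum>i\<in>UNIV. of_real (\<theta> $ i) * (of_real (sqrt C) * g (fst (p i)) (snd (p i)) l)) =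
          of_real (sqrt C) * ?P \<theta> 0 l" for l
        by (simp add: profile_def g_def sum_distrib_left mult_ac)
      moreover have "(\<lambda>\<omega>. \<Sum>i\<in>UNIV. \<theta> $ i * U\<^sub>0 (fst (p i)) (snd (p i)) \<omega>) = (\<lambda>\<omega>. \<theta> \<bullet> Y\<^sub>0 \<omega>)"
        by (simp add: Y\<^sub>0_def inner_vec_def)
      ultimately have W1: "?W (\<lambda>l. of_real (sqrt C) * ?P \<theta> 0 l) (\<lambda>\<omega>. \<theta> \<bullet> Y\<^sub>0 \<omega>)"
        by simp
      have "(LBINT l. (cmod (of_real (sqrt C) * ?P \<theta> 0 l))\<^sup>2) = v\<^sub>0 \<theta>"
        using C by (simp add: v\<^sub>0_def h0(2) norm_mult power_mult_distrib)
      with W1 show ?thesis by blast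
    qed
    have meas: "Z \<in> borel_measurable M" if "\<And>\<theta>. \<exists>k. ?W k (\<lambda>\<omega>. \<theta> \<bullet> Z \<omega>)" for Z :: "'w \<Rightarrow> real ^ 'm"
    proof (rule borel_measurable_euclidean_space[THEN iffD2], intro ballI)
      fix b :: "real ^ 'm"
      show "(\<lambda>\<omega>. Z \<omega> \<bullet> b) \<in> borel_measurable M"
        using that[of b] by (auto simp: has_white_noise_integral_def inner_commute)
    qed
    have "weakly_converges (\<lambda>\<epsilon>. distr M borel (Y \<epsilon>)) (distr M borel Y\<^sub>0) (at_right 0)"
    proof (rule gaussian_weak_convergence[where v = v and v\<^sub>0 = v\<^sub>0])
      let ?G = "\<lambda>\<epsilon>. Y \<epsilon> \<in> borel_measurable M \<and> (\<forall>\<theta>. centered_gaussian M (?Y \<epsilon> \<theta>) (v \<epsilon> \<theta>) \<and>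
          integrable M (\<lambda>\<omega>. (?Y \<epsilon> \<theta> \<omega>)\<^sup>2) \<and> expectation (\<lambda>\<omega>. (?Y \<epsilon> \<theta> \<omega>)\<^sup>2) = v \<epsilon> \<theta>)"
      have "?G \<epsilon>" if \<epsilon>: "\<epsilon> > 0" for \<epsilon>
      proof (intro conjI allI)
        show "Y \<epsilon> \<in> borel_measurable M" using WY[OF \<epsilon>] by (intro meas) blast
        fix \<theta>
        obtain k where k: "?W k (?Y \<epsilon> \<theta>)" "(LBINT l. (cmod (k l))\<^sup>2) = v \<epsilon> \<theta>"
          using WY[OF \<epsilon>] by blast
        show "centered_gaussian M (?Y \<epsilon> \<theta>) (v \<epsilon> \<theta>)" "integrable M (\<lambda>\<omega>. (?Y \<epsilon> \<theta> \<omega>)\<^sup>2)"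
          "expectation (\<lambda>\<omega>. (?Y \<epsilon> \<theta> \<omega>)\<^sup>2) = v \<epsilon> \<theta>"
          using white_noise_integral_gaussian(4-6)[OF k(1)] unfolding k(2) by blast+
      qed
      thus "\<forall>\<^sub>F \<epsilon> in at_right 0. ?G \<epsilon>"
        by (intro eventually_at_right_less[THEN eventually_mono]) blast
      show "Y\<^sub>0 \<in> borel_measurable M" using W0 by (intro meas) blast
      fix \<theta>
      obtain k where k: "?W k (\<lambda>\<omega>. \<theta> \<bullet> Y\<^sub>0 \<omega>)" "(LBINT l. (cmod (k l))\<^sup>2) = v\<^sub>0 \<theta>"
        using W0 by blast
      show "centered_gaussian M (\<lambda>\<omega>. \<theta> \<bullet> Y\<^sub>0 \<omega>) (v\<^sub>0 \<theta>)" "integrable M (\<lambda>\<omega>. (\<theta> \<bullet> Y\<^sub>0 \<omega>)\<^sup>2)"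
        "expectation (\<lambda>\<omega>. (\<theta> \<bullet> Y\<^sub>0 \<omega>)\<^sup>2) = v\<^sub>0 \<theta>"
        using white_noise_integral_gaussian(4-6)[OF k(1)] unfolding k(2) by blast+
      have "filterlim (\<lambda>\<epsilon>. \<epsilon> powr (\<beta> / \<alpha>)) (at_right 0) (at_right (0::real))"
      proof -
        have "((\<lambda>\<epsilon>. \<epsilon> powr (\<beta> / \<alpha>)) \<longlongrightarrow> 0 powr (\<beta> / \<alpha>)) (at_right (0::real))"
          using \<beta> \<alpha> by (intro tendsto_powr') (auto intro!: tendsto_intros eventually_at_right_less[THEN eventually_mono])
        thus ?thesis
          unfolding filterlim_at by (auto intro: eventually_at_right_less[THEN eventually_mono])
      qed
      from filterlim_compose[OF profile_limit[OF \<beta> \<mu> \<gamma> \<alpha> p[rule_format] ih h0(1), of \<theta>] this]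
      show "((\<lambda>\<epsilon>. v \<epsilon> \<theta>) \<longlongrightarrow> v\<^sub>0 \<theta>) (at_right 0)" by (simp add: v_def v\<^sub>0_def)
    qed
    thus ?thesis by (simp add: fin_dim_distr_def Y_def Y\<^sub>0_def)
  qed
  moreover have "gaussian_process M ({0<..} \<times> UNIV) (\<lambda>(t, x). U\<^sub>0 t x)"
    unfolding gaussian_process_def
  proof (intro allI impI, elim conjE)
    fix F :: "(real \<times> real) set" and c assume F: "finite F" "F \<subseteq> {0<..} \<times> UNIV"
    have "?W (\<lambda>l. \<Sum>i\<in>F. of_real (c i) * (of_real (sqrt C) * g (fst i) (snd i) l))
        (\<lambda>\<omega>. \<Sum>i\<in>F. c i * U\<^sub>0 (fst i) (snd i) \<omega>)"
      using F by (intro white_noise_integral_sum U0) auto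
    from centered_gaussian_imp_gaussian_rv[OF white_noise_integral_gaussian(6)[OF this]]
    show "gaussian_rv M (\<lambda>\<omega>. \<Sum>i\<in>F. c i * (case i of (t, x) \<Rightarrow> U\<^sub>0 t x) \<omega>)"
      by (simp add: case_prod_beta)
  qed
  moreover have "zero_mean_process M ({0<..} \<times> UNIV) (\<lambda>(t, x). U\<^sub>0 t x)"
    unfolding zero_mean_process_def using white_noise_integral_gaussian(2,3)[OF U0] by auto
  moreover have "covariance M (U\<^sub>0 t x) (U\<^sub>0 t' x') =
      (\<Sum>j=1..n. 2 * c1 (\<kappa> j) * A j * bessel_K ((\<kappa> j - 1) / 2) \<bar>w j\<bar> *
                    \<bar>w j\<bar> powr ((\<kappa> j - 1) / 2) *
        (LBINT l:{0<..}. cos (l * (x - x')) *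
           ?E t l *
           ?E t' l))"
    if t: "t > 0" "t' > 0" for t t' x x'
  proof -
    define e where "e = (\<lambda>l. cos (l * (x - x')) *
           ?E t l *
           ?E t' l)"
    have Re: "Re ((of_real (sqrt C) * g t x l) * cnj (of_real (sqrt C) * g t' x' l)) = C * e l" for l
    proof -
      have "(of_real (sqrt C) * g t x l) * cnj (of_real (sqrt C) * g t' x' l) =
          of_real (sqrt C * sqrt C * (?E t l *
            ?E t' l)) *
          (exp (\<i> * of_real (l * x)) * cnj (exp (\<i> * of_real (l * x'))))"
        by (simp only: g_def complex_cnj_mult complex_cnj_complex_of_real of_real_mult mult_ac)
      also have "exp (\<i> * of_real (l * x)) * cnj (exp (\<i> * of_real (l * x'))) = exp (\<i> * of_real (l * (x - x')))"
        by (simp add: exp_cnj exp_add[symmetric] algebra_simps)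
      finally have "(of_real (sqrt C) * g t x l) * cnj (of_real (sqrt C) * g t' x' l) =
          of_real (sqrt C * sqrt C * (?E t l *
            ?E t' l)) * exp (\<i> * of_real (l * (x - x')))" .
      thus ?thesis using C by (simp add: Re_exp e_def)
    qed
    have int: "integrable lborel (\<lambda>l. C * e l)" and cov: "covariance M (U\<^sub>0 t x) (U\<^sub>0 t' x') = (LBINT l. C * e l)"
      using white_noise_integral_covariance[OF U0[OF t(1), of x] U0[OF t(2), of x']] by (simp_all only: Re)
    \<comment> \<open>\<open>e\<close> depends on l through a cosine and |l|, so it is even; this
      produces the factor 2 and the half-line integral in the covariance.\<close>
    have "(LBINT l. C * e l) = 2 * (LBINT l:{0<..}. C * e l)"
      by (rule integral_even[OF int]) (simp add: e_def)
    also have "\<dots> = 2 * C * (LBINT l:{0<..}. e l)" by simp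
    finally show ?thesis unfolding cov assms(22) e_def by (simp add: sum_distrib_left sum_distrib_right mult_ac)
  qed
  ultimately show ?thesis by blast
qed

end
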